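(* Let $m\in\mathbb{N}$ and $0<\sigma\ll 1$. There exist a full measure $G_\delta$-subset $\Gamma_{m,\sigma}\subseteq\mathcal{D}_{m,\sigma}^*$ and a measure-preserving family of diffeomorphisms $(\Psi_m^t)_{t\in\mathbb{R}}:\Gamma_{m,\sigma}\to\Gamma_{m,\sigma}$ (the flow of the $m$-particle dynamics with interaction zone $\sigma$ described in the context) such that $$\Psi_m^{t+s}Z_m=(\Psi_m^t\circ\Psi_m^s)(Z_m)=(\Psi_m^s\circ\Psi_m^t)(Z_m),\qquad \forall Z_m\in\Gamma_{m,\sigma},\ \forall t,s\in\mathbb{R},$$ $$E_m(\Psi_m^tZ_m)=E_m(Z_m),\qquad\forall Z_m\in\Gamma_{m,\sigma},\ \forall t\in\mathbb{R}.$$ Moreover, for $m\ge 3$ the flow is defined a.e. on $\Gamma_{m,\sigma}\cap\partial_{sc,ng}\mathcal{D}_{m,\sigma}$ with respect to the induced measure $d\sigma$, and $$\Psi_m^tZ_m^*=\Psi_m^tZ_m,\qquad \sigma\text{-a.e. on }\Gamma_{m,\sigma}\cap\partial_{sc,ng}\mathcal{D}_{m,\sigma},\ \forall t\in\mathbb{R}.$$ This family of maps is called the $\sigma$-interaction zone flow of $m$-particles. For $m=1,2$ the flow coincides with the free flow $\Phi_m^t(X_m,V_m)=(X_m+tV_m,V_m)$.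
   Context: Notation. $d\ge 2$ is the space dimension. $x\ll y$ means $x<cy$ for a sufficiently small number $0<c<1$. $Z_m=(X_m,V_m)\in\mathbb{R}^{2dm}$, with $X_m=(x_1,\dots,x_m)$ positions and $V_m=(v_1,\dots,v_m)$ velocities in $\mathbb{R}^{dm}$. Kinetic energy: $E_m(Z_m)=\frac12\sum_{i=1}^m|v_i|^2$. $\mathbb{S}_1^{2d-1}$ is the unit sphere of $\mathbb{R}^{2d}$. Phase space. $\mathcal{I}_m=\{(i,j,k)\in\{1,\dots,m\}^3:i<j<k\}$, $d^2(x_i;x_j,x_k)=|x_i-x_j|^2+|x_i-x_k|^2$, and $$\mathcal{D}_{m,\sigma}=\{Z_m\in\mathbb{R}^{2dm}: d^2(x_i;x_j,x_k)\ge 2\sigma^2\ \ \forall (i,j,k)\in\mathcal{I}_m\}$$ (so $\mathcal{D}_{m,\sigma}=\mathbb{R}^{2dm}$ for $m=1,2$). $\mathring{\mathcal{D}}_{m,\sigma}$ is the same set with strict inequalities. $\Sigma_{ijk}=\{Z_m\in\mathcal{D}_{m,\sigma}:d^2(x_i;x_j,x_k)=2\sigma^2\}$ and $\partial\mathcal{D}_{m,\sigma}=\bigcup_{(i,j,k)\in\mathcal{I}_m}\Sigma_{ijk}$. $\partial_{sc}\mathcal{D}_{m,\sigma}$ (simple collisions) is the set of $Z_m\in\partial\mathcal{D}_{m,\sigma}$ lying in $\Sigma_{ijk}$ for exactly one $(i,j,k)\in\mathcal{I}_m$; such a $Z_m$ is called an $(i;j,k)$ simple collision. Collisions. For $(\omega_1,\omega_2)\in\mathbb{S}_1^{2d-1}$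 let $T_{\omega_1,\omega_2}(v_1,v_2,v_3)=(v_1+c(\omega_1+\omega_2),\,v_2-c\,\omega_1,\,v_3-c\,\omega_2)$ with $c=\frac{\langle\omega_1,v_2-v_1\rangle+\langle\omega_2,v_3-v_1\rangle}{1+\langle\omega_1,\omega_2\rangle}$. For an $(i;j,k)$ simple collision $Z_m$ set $(\widetilde\omega_1,\widetilde\omega_2)=\frac{1}{\sqrt2\sigma}(x_j-x_i,x_k-x_i)\in\mathbb{S}_1^{2d-1}$ and let $Z_m^*=(X_m,V_m^* )$, where $V_m^*$ is $V_m$ with $(v_i,v_j,v_k)$ replaced by $T_{\widetilde\omega_1,\widetilde\omega_2}(v_i,v_j,v_k)$. $Z_m$ is pre-collisional, post-collisional, or grazing according to whether $\langle\widetilde\omega_1,v_j-v_i\rangle+\langle\widetilde\omega_2,v_k-v_i\rangle$ is $<0$, $>0$, or $=0$. $\partial_{sc,ng}\mathcal{D}_{m,\sigma}$ is the set of non-grazing simple collisions, and $\mathcal{D}_{m,\sigma}^*=\mathring{\mathcal{D}}_{m,\sigma}\cup\partial_{sc,ng}\mathcal{D}_{m,\sigma}$ (equal to $\mathbb{R}^{2dm}$ when $m=1,2$). Dynamics. The particles move freely ($\dot x_i=v_i$, $\dot v_i=0$) as long as there is no interaction; when the trajectory reaches a non-grazing $(i;j,k)$ simple collision, the velocities $(v_i,v_j,v_k)$ are instantaneously replaced by $T_{\widetilde\omega_1,\widetilde\omega_2}(v_i,v_j,v_k)$ and free motion resumes; backward evolution is defined analogously. Thus, for $t>0$ and until the next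 collision, a pre-collisional $Z_m$ evolves as $(X_m+tV_m^*,V_m^* )$ and a non-collisional or post-collisional one as $(X_m+tV_m,V_m)$. Full measure and measure-preserving refer to Lebesgue measure on $\mathbb{R}^{2dm}$; $d\sigma$ denotes the induced surface measure on the boundary (not to be confused with the parameter $\sigma$).
   Formalization: Since Ψ^t Z* = Ψ^t Z rules out injectivity on Γ (and velocities jump at collisions), "diffeomorphism of Γ" is read as: a homeomorphism of Γ with Z and Z* identified, and a smooth diffeomorphism from the interior states of Γ with interior image onto their image. *)

theory Defs
  imports "HOL-Analysis.Analysis"
begin

text \<open>
  The space dimension is \<open>d = CARD('d)\<close> and the number of particles is \<open>m = CARD('m)\<close>. The
  particle labels are an arbitrary finite linearly ordered type, i.e. \<open>{1, ..., m}\<close> up to order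
  isomorphism. A phase point is a pair (positions, velocities); \<open>lebesgue\<close> on this Euclidean
  space is Lebesgue measure on \<open>\<real>\<close>-space of dimension \<open>2 * d * m\<close>.
\<close>

type_synonym ('d, 'm) phase = "((real ^ 'd) ^ 'm) \<times> ((real ^ 'd) ^ 'm)"

definition kinetic_energy :: "('d::finite, 'm::finite) phase \<Rightarrow> real" where
  "kinetic_energy Z = 1 / 2 * (\<Sum>i\<in>UNIV. (norm (snd Z $ i))\<^sup>2)"

definition free_flow :: "real \<Rightarrow> ('d::finite, 'm::finite) phase \<Rightarrow> ('d, 'm) phase" where
  "free_flow t Z = (fst Z + t *\<^sub>R snd Z, snd Z)"


subsection \<open>Phase space\<close>

definition triples :: "('m::linorder \<times> 'm \<times> 'm) set" where
  "triples = {(i, j, k). i < j \<and> j < k}"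

definition triple_dist2 :: "'m \<times> 'm \<times> 'm \<Rightarrow> ('d::finite, 'm::finite) phase \<Rightarrow> real" where
  "triple_dist2 = (\<lambda>(i, j, k) Z.
     (norm (fst Z $ i - fst Z $ j))\<^sup>2 + (norm (fst Z $ i - fst Z $ k))\<^sup>2)"

definition phase_space :: "real \<Rightarrow> ('d::finite, 'm::{finite,linorder}) phase set" where
  "phase_space \<sigma> = {Z. \<forall>p\<in>triples. triple_dist2 p Z \<ge> 2 * \<sigma>\<^sup>2}"

definition phase_interior :: "real \<Rightarrow> ('d::finite, 'm::{finite,linorder}) phase set" where
  "phase_interior \<sigma> = {Z. \<forall>p\<in>triples. triple_dist2 p Z > 2 * \<sigma>\<^sup>2}"

definition collision_surface ::
  "real \<Rightarrow> 'm \<times> 'm \<times> 'm \<Rightarrow> ('d::finite, 'm::{finite,linorder}) phase set" where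
  "collision_surface \<sigma> p = {Z \<in> phase_space \<sigma>. triple_dist2 p Z = 2 * \<sigma>\<^sup>2}"

definition phase_boundary :: "real \<Rightarrow> ('d::finite, 'm::{finite,linorder}) phase set" where
  "phase_boundary \<sigma> = (\<Union>p\<in>triples. collision_surface \<sigma> p)"

definition simple_collisions :: "real \<Rightarrow> ('d::finite, 'm::{finite,linorder}) phase set" where
  "simple_collisions \<sigma> =
     {Z \<in> phase_boundary \<sigma>. \<exists>!p. p \<in> triples \<and> Z \<in> collision_surface \<sigma> p}"


subsection \<open>Collisions\<close>

definition collision_map ::
  "real ^ 'd::finite \<Rightarrow> real ^ 'd \<Rightarrow> (real ^ 'd) \<times> (real ^ 'd) \<times> (real ^ 'd)
     \<Rightarrow> (real ^ 'd) \<times> (real ^ 'd) \<times> (real ^ 'd)" where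
  "collision_map \<omega>1 \<omega>2 = (\<lambda>(v1, v2, v3).
     let c = (\<omega>1 \<bullet> (v2 - v1) + \<omega>2 \<bullet> (v3 - v1)) / (1 + \<omega>1 \<bullet> \<omega>2)
     in (v1 + c *\<^sub>R (\<omega>1 + \<omega>2), v2 - c *\<^sub>R \<omega>1, v3 - c *\<^sub>R \<omega>2))"

text \<open>The following five notions are meaningful at simple collisions only.\<close>

definition colliding_triple :: "real \<Rightarrow> ('d::finite, 'm::{finite,linorder}) phase \<Rightarrow> 'm \<times> 'm \<times> 'm" where
  "colliding_triple \<sigma> Z = (THE p. p \<in> triples \<and> Z \<in> collision_surface \<sigma> p)"

definition impact_direction1 :: "real \<Rightarrow> ('d::finite, 'm::{finite,linorder}) phase \<Rightarrow> real ^ 'd" where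
  "impact_direction1 \<sigma> Z = (case colliding_triple \<sigma> Z of (i, j, k) \<Rightarrow>
     (1 / (sqrt 2 * \<sigma>)) *\<^sub>R (fst Z $ j - fst Z $ i))"

definition impact_direction2 :: "real \<Rightarrow> ('d::finite, 'm::{finite,linorder}) phase \<Rightarrow> real ^ 'd" where
  "impact_direction2 \<sigma> Z = (case colliding_triple \<sigma> Z of (i, j, k) \<Rightarrow>
     (1 / (sqrt 2 * \<sigma>)) *\<^sub>R (fst Z $ k - fst Z $ i))"

definition impact_rate :: "real \<Rightarrow> ('d::finite, 'm::{finite,linorder}) phase \<Rightarrow> real" where
  "impact_rate \<sigma> Z = (case colliding_triple \<sigma> Z of (i, j, k) \<Rightarrow>
     impact_direction1 \<sigma> Z \<bullet> (snd Z $ j - snd Z $ i) +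
     impact_direction2 \<sigma> Z \<bullet> (snd Z $ k - snd Z $ i))"

definition star :: "real \<Rightarrow> ('d::finite, 'm::{finite,linorder}) phase \<Rightarrow> ('d, 'm) phase" where
  "star \<sigma> Z = (case colliding_triple \<sigma> Z of (i, j, k) \<Rightarrow>
     (case collision_map (impact_direction1 \<sigma> Z) (impact_direction2 \<sigma> Z)
             (snd Z $ i, snd Z $ j, snd Z $ k) of (vi, vj, vk) \<Rightarrow>
       (fst Z, \<chi> l. if l = i then vi else if l = j then vj else if l = k then vk else snd Z $ l)))"

definition pre_collisional :: "real \<Rightarrow> ('d::finite, 'm::{finite,linorder}) phase \<Rightarrow> bool" where
  "pre_collisional \<sigma> Z \<longleftrightarrow> Z \<in> simple_collisions \<sigma> \<and> impact_rate \<sigma> Z < 0"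

definition post_collisional :: "real \<Rightarrow> ('d::finite, 'm::{finite,linorder}) phase \<Rightarrow> bool" where
  "post_collisional \<sigma> Z \<longleftrightarrow> Z \<in> simple_collisions \<sigma> \<and> impact_rate \<sigma> Z > 0"

definition grazing :: "real \<Rightarrow> ('d::finite, 'm::{finite,linorder}) phase \<Rightarrow> bool" where
  "grazing \<sigma> Z \<longleftrightarrow> Z \<in> simple_collisions \<sigma> \<and> impact_rate \<sigma> Z = 0"

definition nongrazing_collisions :: "real \<Rightarrow> ('d::finite, 'm::{finite,linorder}) phase set" where
  "nongrazing_collisions \<sigma> = {Z \<in> simple_collisions \<sigma>. \<not> grazing \<sigma> Z}"

definition refined_phase_space :: "real \<Rightarrow> ('d::finite, 'm::{finite,linorder}) phase set" where
  "refined_phase_space \<sigma> = phase_interior \<sigma> \<union> nongrazing_collisions \<sigma>"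


subsection \<open>Dynamics\<close>

text \<open>
  \<open>outgoing\<close> and \<open>incoming\<close> give the state from which the free motion is continued forward,
  respectively backward, in time.
\<close>

definition outgoing :: "real \<Rightarrow> ('d::finite, 'm::{finite,linorder}) phase \<Rightarrow> ('d, 'm) phase" where
  "outgoing \<sigma> Z = (if pre_collisional \<sigma> Z then star \<sigma> Z else Z)"

definition incoming :: "real \<Rightarrow> ('d::finite, 'm::{finite,linorder}) phase \<Rightarrow> ('d, 'm) phase" where
  "incoming \<sigma> Z = (if post_collisional \<sigma> Z then star \<sigma> Z else Z)"

text \<open>
  A global trajectory with initial state \<open>Z\<close>. At a collision time the velocities have been
  replaced already, so its value is the post-collisional state; in particular it starts
  at \<open>outgoing \<sigma> Z\<close>. As the step \<open>\<epsilon>\<close> serves both time directions at every \<open>t\<close>, collision times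
  cannot accumulate.
\<close>

definition trajectory ::
  "real \<Rightarrow> ('d::finite, 'm::{finite,linorder}) phase \<Rightarrow> (real \<Rightarrow> ('d, 'm) phase) \<Rightarrow> bool" where
  "trajectory \<sigma> Z z \<longleftrightarrow>
     z 0 = outgoing \<sigma> Z \<and>
     (\<forall>t. z t \<in> refined_phase_space \<sigma> \<and> \<not> pre_collisional \<sigma> (z t) \<and>
       (\<exists>\<epsilon>>0. \<forall>s. 0 < s \<and> s < \<epsilon> \<longrightarrow>
          z (t + s) = free_flow s (z t) \<and>
          z (t - s) = free_flow (- s) (incoming \<sigma> (z t))))"


subsection \<open>Diffeomorphisms\<close>

text \<open>Continuous differentiability of order \<open>k\<close>; used on open sets only.\<close>

primrec Ck_on :: "nat \<Rightarrow> 'a::real_normed_vector set \<Rightarrow> ('a \<Rightarrow> 'b::real_normed_vector) \<Rightarrow> bool" where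
  "Ck_on 0 U f \<longleftrightarrow> continuous_on U f"
| "Ck_on (Suc k) U f \<longleftrightarrow>
     (\<forall>x\<in>U. f differentiable (at x)) \<and> (\<forall>v. Ck_on k U (\<lambda>x. frechet_derivative f (at x) v))"

text \<open>Smooth maps and diffeomorphisms between arbitrary subsets of normed spaces, as in
  Milnor's book on differential topology: smooth means locally extendable to a smooth map on an
  open set.\<close>

definition smooth_map_on ::
  "'a::real_normed_vector set \<Rightarrow> ('a \<Rightarrow> 'b::real_normed_vector) \<Rightarrow> bool" where
  "smooth_map_on S f \<longleftrightarrow>
     (\<forall>x\<in>S. \<exists>U F. open U \<and> x \<in> U \<and> (\<forall>k. Ck_on k U F) \<and> (\<forall>y\<in>S \<inter> U. F y = f y))"

definition diffeomorphism ::
  "'a::real_normed_vector set \<Rightarrow> 'b::real_normed_vector set \<Rightarrow> ('a \<Rightarrow> 'b) \<Rightarrow> bool" where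
  "diffeomorphism S T f \<longleftrightarrow>
     bij_betw f S T \<and> smooth_map_on S f \<and> smooth_map_on T (the_inv_into S f)"

text \<open>
  The states \<open>Z\<close> and \<open>star \<sigma> Z\<close> of a collision are the same point of the dynamics, so the flow
  lives on the quotient of \<open>\<Gamma>\<close> identifying them. The classes are the fibres of \<open>outgoing \<sigma>\<close>;
  representing each by its non-pre-collisional member, \<open>glued_topology\<close> is the quotient topology.
\<close>

definition glued_topology ::
  "real \<Rightarrow> ('d::finite, 'm::{finite,linorder}) phase set \<Rightarrow> ('d, 'm) phase topology" where
  "glued_topology \<sigma> \<Gamma> = topology (\<lambda>U. U \<subseteq> outgoing \<sigma> ` \<Gamma> \<and>
     openin (top_of_set \<Gamma>) {Z \<in> \<Gamma>. outgoing \<sigma> Z \<in> U})"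

lemma openin_glued_topology:
  "openin (glued_topology \<sigma> \<Gamma>) U \<longleftrightarrow>
     U \<subseteq> outgoing \<sigma> ` \<Gamma> \<and> openin (top_of_set \<Gamma>) {Z \<in> \<Gamma>. outgoing \<sigma> Z \<in> U}"
proof -
  have 1: "{Z \<in> \<Gamma>. outgoing \<sigma> Z \<in> S \<inter> T} =
      {Z \<in> \<Gamma>. outgoing \<sigma> Z \<in> S} \<inter> {Z \<in> \<Gamma>. outgoing \<sigma> Z \<in> T}" for S T
    by auto
  have 2: "{Z \<in> \<Gamma>. outgoing \<sigma> Z \<in> \<Union>\<K>} = (\<Union>K\<in>\<K>. {Z \<in> \<Gamma>. outgoing \<sigma> Z \<in> K})" for \<K>
    by auto
  have "istopology (\<lambda>U. U \<subseteq> outgoing \<sigma> ` \<Gamma> \<and>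
      openin (top_of_set \<Gamma>) {Z \<in> \<Gamma>. outgoing \<sigma> Z \<in> U})"
    unfolding istopology_def 1 2 by (auto intro!: openin_Union)
  then show ?thesis
    by (simp add: glued_topology_def topology_inverse')
qed

text \<open>
  In the Euclidean topology no map \<open>\<Psi>\<close> of the flow is continuous where \<open>\<Psi> Z\<close> is a collision,
  since the velocities jump there. A diffeomorphism of \<open>\<Gamma>\<close> is therefore a homeomorphism of the
  glued space which is a diffeomorphism between the parts of \<open>\<Gamma>\<close> away from the gluing locus.
\<close>

definition glued_diffeomorphism ::
  "real \<Rightarrow> ('d::finite, 'm::{finite,linorder}) phase set
     \<Rightarrow> (('d, 'm) phase \<Rightarrow> ('d, 'm) phase) \<Rightarrow> bool" where
  "glued_diffeomorphism \<sigma> \<Gamma> f \<longleftrightarrow>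
     f \<in> \<Gamma> \<rightarrow> \<Gamma> \<and>
     (\<forall>Z\<in>\<Gamma>. \<forall>W\<in>\<Gamma>. outgoing \<sigma> Z = outgoing \<sigma> W \<longrightarrow> f Z = f W) \<and>
     homeomorphic_map (glued_topology \<sigma> \<Gamma>) (glued_topology \<sigma> \<Gamma>) f \<and>
     (let S = {Z \<in> \<Gamma> \<inter> phase_interior \<sigma>. f Z \<in> phase_interior \<sigma>}
      in diffeomorphism S (f ` S) f)"


subsection \<open>Measures\<close>

definition measure_preserving_on :: "'a::euclidean_space set \<Rightarrow> ('a \<Rightarrow> 'a) \<Rightarrow> bool" where
  "measure_preserving_on S f \<longleftrightarrow>
     f \<in> lebesgue_on S \<rightarrow>\<^sub>M lebesgue_on S \<and>
     distr (lebesgue_on S) (lebesgue_on S) f = lebesgue_on S"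

text \<open>
  Surface measure of subsets of hypersurfaces: the Hausdorff (outer) measure of codimension 1,
  normalised so as to agree with the measure induced by Lebesgue measure on smooth hypersurfaces.
\<close>

definition surface_measure :: "'a::euclidean_space set \<Rightarrow> ennreal" where
  "surface_measure A =
     ennreal (unit_ball_vol (real (DIM('a) - 1)) / 2 ^ (DIM('a) - 1)) *
     (SUP \<delta>\<in>{0<..}. INF C\<in>{C :: nat \<Rightarrow> 'a set.
          A \<subseteq> (\<Union>n. C n) \<and> (\<forall>n. bounded (C n) \<and> diameter (C n) \<le> \<delta>)}.
        (\<Sum>n. ennreal (diameter (C n) ^ (DIM('a) - 1))))"

end

theory Submission
  imports Defs
begin

text \<open>
  The collision law is specular reflection at the boundary of the obstacles
  \<open>{x. \<langle>G\<^sub>p x, x\<rangle> < 2\<sigma>\<^sup>2}\<close>, where \<open>G\<^sub>p\<close> is the positive semidefinite matrix of the quadratic form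
  \<open>triple_dist2 p\<close>. Near a collision the flow is the free flow composed with a scattering map, which
  moves a state to the obstacle, reflects it and moves it back for the same time. This map is smooth
  and commutes with the free flow. At the obstacle its derivative is block triangular with the
  reflection as both diagonal blocks, so it preserves volume.

  Collisions never accumulate. Otherwise positions and velocities would converge to some \<open>x*\<close> and
  \<open>v*\<close> at a time \<open>T\<close>. The remaining impulse \<open>w = v* - v(t)\<close> is a positive combination of the normals
  \<open>G\<^sub>p x\<close> at the collisions, with weights of total mass \<open>M\<close>, and conservation of energy gives
  \<open>|w|\<^sup>2 = 2 \<langle>w, v*\<rangle>\<close>. As \<open>v*\<close> is tangent to the obstacles that are hit infinitely often,
  \<open>\<langle>w, v*\<rangle>\<close> is at most of order \<open>(T - t) M\<^sup>2\<close>. The obstacles are star-shaped about the origin, so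
  \<open>\<langle>w, x*\<rangle>\<close> is at least of order \<open>M\<close>. For \<open>t\<close> close to \<open>T\<close> this forces \<open>M = 0\<close>.

  Hence a trajectory can only end at a grazing or multiple collision. The states whose free motion
  meets such a configuration form a null set, and so do their preimages under the flow at rational times.
\<close>

section \<open>Smooth maps\<close>

text \<open>Two features shape the proof. Velocities jump at a collision, so a time map of the flow
  is not even continuous near a state that it sends to a collision. Statements about derivatives and
  volume are therefore made for final states in the open set \<open>phase_interior \<sigma>\<close>,
  and a collision is crossed by continuing to a slightly later interior state. Moreover, there is no
  a priori lower bound for the time between collisions, so global existence cannot be reached by
  iterating steps of a fixed length. The argument against accumulation replaces such a bound: it
  leaves a last stretch of free motion that ends at a singular contact. This stretch fills an open
  interval of times, hence contains a rational one, which is why countably many preimages suffice.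

  Only forward motion is constructed. Backward motion is its conjugate under reversal of all
  velocities; the same symmetry gives injectivity and turns preimages of null sets into
  images.\<close>

lemma Ck_on_subset: "Ck_on k U f \<Longrightarrow> V \<subseteq> U \<Longrightarrow> Ck_on k V f"
  by (induction k arbitrary: f) (auto intro: continuous_on_subset)

text \<open>That \<open>Ck_on\<close> depends on the values on \<open>U\<close> alone enters as the
  hypothesis \<open>cong\<close>, because this fact is itself proved by induction with the present
  rule; \<open>Ck_on_derivI\<close> discharges it afterwards.\<close>

lemma Ck_on_SucI:
  assumes "open U" "\<And>x. x \<in> U \<Longrightarrow> (f has_derivative D x) (at x)" "\<And>v. Ck_on k U (\<lambda>x. D x v)"
    and cong: "\<And>f g :: _ \<Rightarrow> 'b. (\<And>x. x \<in> U \<Longrightarrow> f x = g x) \<Longrightarrow> Ck_on k U f = Ck_on k U g"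
  shows "Ck_on (Suc k) U (f :: _ \<Rightarrow> 'b::real_normed_vector)"
proof -
  have "frechet_derivative f (at x) = D x" if "x \<in> U" for x
    using assms(2)[OF that] by (metis frechet_derivative_at)
  then have "Ck_on k U (\<lambda>x. frechet_derivative f (at x) v) = Ck_on k U (\<lambda>x. D x v)" for v
    by (intro cong) simp
  then show ?thesis
    using assms(2,3) unfolding Ck_on.simps differentiable_def by blast
qed

text \<open>On an open set the derivative at a point depends on nearby values only, so a derivative
  of one map is a derivative of the other and the induction passes to directional
  derivatives.\<close>

lemma Ck_on_cong:
  fixes f g :: "'a::real_normed_vector \<Rightarrow> 'b::real_normed_vector"
  assumes "open U" "\<And>x. x \<in> U \<Longrightarrow> f x = g x"
  shows "Ck_on k U f = Ck_on k U g"
  using assms(2)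
proof (induction k arbitrary: f g)
  case 0
  then show ?case
    by (metis Ck_on.simps(1) continuous_on_cong)
next
  case (Suc k)
  have *: "Ck_on (Suc k) U h" if h: "Ck_on (Suc k) U f" and eq: "\<And>x. x \<in> U \<Longrightarrow> f x = h x"
    for f h :: "'a \<Rightarrow> 'b"
  proof (rule Ck_on_SucI[OF assms(1) _ _ Suc.IH])
    show "(h has_derivative frechet_derivative f (at x)) (at x)" if "x \<in> U" for x
      using h that eq assms(1)
      by (auto intro: has_derivative_transform_within_open[of f] simp: frechet_derivative_works)
    show "Ck_on k U (\<lambda>x. frechet_derivative f (at x) v)" for v
      using h by simp
  qed auto
  show ?case
    using *[of f g] *[of g f] Suc.prems by metis
qed

lemmas Ck_on_derivI = Ck_on_SucI[OF _ _ _ Ck_on_cong]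

lemma Ck_on_lower:
  assumes "open U" "Ck_on (Suc k) U f"
  shows "Ck_on k U f"
  using assms(2)
proof (induction k arbitrary: f)
  case 0
  then show ?case
    by (auto intro!: differentiable_imp_continuous_on simp: differentiable_on_def differentiable_at_withinI)
next
  case (Suc k)
  then show ?case by simp
qed

lemma Ck_on_has_derivative:
  "Ck_on (Suc k) U f \<Longrightarrow> x \<in> U \<Longrightarrow> (f has_derivative frechet_derivative f (at x)) (at x)"
  by (simp add: frechet_derivative_works)

lemma Ck_on_const [simp]: "Ck_on k U (\<lambda>x. c)"
  by (induction k arbitrary: c) auto

lemma Ck_on_linear:
  assumes "open U" "bounded_linear f"
  shows "Ck_on k U f"
proof (cases k)
  case 0
  then show ?thesis by (simp add: assms(2) linear_continuous_on)
next
  case (Suc n)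
  then show ?thesis
    using Ck_on_derivI[OF assms(1), of f "\<lambda>x. f" n] assms bounded_linear.has_derivative[OF assms(2) has_derivative_ident]
    by simp
qed

lemma Ck_on_add:
  assumes "open U" "Ck_on k U f" "Ck_on k U g"
  shows "Ck_on k U (\<lambda>x. f x + g x)"
  using assms(2,3)
proof (induction k arbitrary: f g)
  case 0
  then show ?case by (simp add: continuous_on_add)
next
  case (Suc k)
  show ?case
    by (rule Ck_on_derivI[OF assms(1), where D = "\<lambda>x v. frechet_derivative f (at x) v + frechet_derivative g (at x) v"])
      (use Suc assms(1) in \<open>auto intro!: has_derivative_add simp: frechet_derivative_works\<close>)
qed

lemma Ck_on_sum:
  assumes "open U" "\<And>i. i \<in> I \<Longrightarrow> Ck_on k U (f i)"
  shows "Ck_on k U (\<lambda>x. \<Sum>i\<in>I. f i x)"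
  using assms(2) by (induction I rule: infinite_finite_induct) (auto intro!: Ck_on_add[OF assms(1)])

text \<open>Induction with the product rule: each summand pairs one map with a directional
  derivative of the other, so the maps themselves are needed only one order lower.\<close>

lemma Ck_on_bilinear:
  assumes "bounded_bilinear bl" "open U" "Ck_on k U f" "Ck_on k U g"
  shows "Ck_on k U (\<lambda>x. bl (f x) (g x))"
  using assms(3,4)
proof (induction k arbitrary: f g)
  case 0
  then show ?case by (simp add: bounded_bilinear.continuous_on[OF assms(1)])
next
  case (Suc k)
  show ?case
  proof (rule Ck_on_derivI[OF assms(2), where D = "\<lambda>x v. bl (f x) (frechet_derivative g (at x) v)
      + bl (frechet_derivative f (at x) v) (g x)"])
    show "((\<lambda>x. bl (f x) (g x)) has_derivative
        (\<lambda>v. bl (f x) (frechet_derivative g (at x) v) + bl (frechet_derivative f (at x) v) (g x))) (at x)"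
      if "x \<in> U" for x
      using Suc.prems that by (intro bounded_bilinear.FDERIV[OF assms(1)] Ck_on_has_derivative)
    show "Ck_on k U (\<lambda>x. bl (f x) (frechet_derivative g (at x) v) + bl (frechet_derivative f (at x) v) (g x))" for v
      using Suc.prems Ck_on_lower[OF assms(2) Suc.prems(1)] Ck_on_lower[OF assms(2) Suc.prems(2)]
      by (intro Ck_on_add assms Suc.IH) auto
  qed (use assms(2) in auto)
qed

text \<open>\<open>Ck_on\<close> controls the derivative of \<open>g\<close> in fixed directions
  only, whereas the chain rule evaluates it in a direction that varies with the point. Expanding
  this direction in a basis gives a finite sum of products to which the induction hypothesis
  applies; hence the Euclidean space in the middle.\<close>

lemma Ck_on_compose:
  fixes f :: "'a::real_normed_vector \<Rightarrow> 'b::euclidean_space" and g :: "'b \<Rightarrow> 'c::real_normed_vector"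
  assumes "open U" "open V" "f ` U \<subseteq> V" "Ck_on k U f" "Ck_on k V g"
  shows "Ck_on k U (\<lambda>x. g (f x))"
  using assms(3-5)
proof (induction k arbitrary: g)
  case 0
  then show ?case by (auto intro: continuous_on_compose2)
next
  case (Suc k)
  let ?f' = "\<lambda>x. frechet_derivative f (at x)" and ?g' = "\<lambda>y. frechet_derivative g (at y)"
  show ?case
  proof (rule Ck_on_derivI[OF assms(1), where D = "\<lambda>x v. \<Sum>b\<in>Basis. (?f' x v \<bullet> b) *\<^sub>R ?g' (f x) b"])
    show "((\<lambda>x. g (f x)) has_derivative (\<lambda>v. \<Sum>b\<in>Basis. (?f' x v \<bullet> b) *\<^sub>R ?g' (f x) b)) (at x)"
      if "x \<in> U" for x
    proof -
      have g: "(g has_derivative ?g' (f x)) (at (f x))"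
        using Suc.prems that by (intro Ck_on_has_derivative) auto
      then have lin: "linear (?g' (f x))"
        by (simp add: has_derivative_linear)
      have "?g' (f x) = (\<lambda>w. \<Sum>b\<in>Basis. (w \<bullet> b) *\<^sub>R ?g' (f x) b)"
      proof
        fix w
        show "?g' (f x) w = (\<Sum>b\<in>Basis. (w \<bullet> b) *\<^sub>R ?g' (f x) b)"
          using linear_sum[OF lin, of "\<lambda>b. (w \<bullet> b) *\<^sub>R b" Basis] linear_cmul[OF lin]
          by (simp add: euclidean_representation)
      qed
      note eq = fun_cong[OF this]
      have "((\<lambda>x. g (f x)) has_derivative (\<lambda>v. ?g' (f x) (?f' x v))) (at x)"
        using Suc.prems that g
        by (intro has_derivative_compose[of f _ x UNIV g]) (auto simp: frechet_derivative_works)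
      moreover have "(\<lambda>v. ?g' (f x) (?f' x v)) = (\<lambda>v. \<Sum>b\<in>Basis. (?f' x v \<bullet> b) *\<^sub>R ?g' (f x) b)"
        by (rule ext) (rule eq)
      ultimately show ?thesis by simp
    qed
    show "Ck_on k U (\<lambda>x. \<Sum>b\<in>Basis. (?f' x v \<bullet> b) *\<^sub>R ?g' (f x) b)" for v
    proof (rule Ck_on_sum[OF assms(1)])
      fix b :: 'b assume "b \<in> Basis"
      have f: "Ck_on k U f"
        by (rule Ck_on_lower[OF assms(1) Suc.prems(2)])
      have 1: "Ck_on k U (\<lambda>x. ?g' (f x) b)"
        by (rule Suc.IH) (use Suc.prems f in auto)
      have 2: "Ck_on k U (\<lambda>x. ?f' x v \<bullet> b)"
        by (rule Ck_on_bilinear[OF bounded_bilinear_inner assms(1), of k "\<lambda>x. ?f' x v" "\<lambda>x. b"])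
          (use Suc.prems in auto)
      show "Ck_on k U (\<lambda>x. (?f' x v \<bullet> b) *\<^sub>R ?g' (f x) b)"
        by (rule Ck_on_bilinear[OF bounded_bilinear_scaleR assms(1) 2 1])
    qed
  qed (use assms(1) in auto)
qed

text \<open>The derivative is again a product of copies of \<open>inverse\<close>, so the induction
  closes without a formula for higher derivatives.\<close>

lemma Ck_on_inverse: "Ck_on k {0<..} (inverse :: real \<Rightarrow> real)"
proof (induction k)
  case 0
  then show ?case by (auto intro!: continuous_intros)
next
  case (Suc k)
  show ?case
  proof (rule Ck_on_derivI[where D = "\<lambda>x v. - (inverse x * v * inverse x)"])
    show "Ck_on k {0<..} (\<lambda>x. - (inverse x * v * inverse x))" for v :: real
    proof -
      have "Ck_on k {0<..} (\<lambda>x. (- v) * (inverse x * inverse x))"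
        by (intro Ck_on_bilinear[OF bounded_bilinear_mult] Suc Ck_on_const) auto
      then show ?thesis by (simp add: mult.commute mult.left_commute)
    qed
  qed (auto intro!: derivative_eq_intros)
qed

lemma Ck_on_sqrt: "Ck_on k {0<..} sqrt"
proof (induction k)
  case 0
  then show ?case by (auto intro!: continuous_intros)
next
  case (Suc k)
  show ?case
  proof (rule Ck_on_derivI[where D = "\<lambda>x v. v * (inverse (sqrt x) / 2)"])
    show "Ck_on k {0<..} (\<lambda>x. v * (inverse (sqrt x) / 2))" for v :: real
    proof -
      have "Ck_on k {0<..} (\<lambda>x. (v / 2) * inverse (sqrt x))"
        by (intro Ck_on_bilinear[OF bounded_bilinear_mult] Ck_on_const
            Ck_on_compose[OF _ _ _ Suc Ck_on_inverse]) auto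
      then show ?thesis by (simp add: field_simps)
    qed
    show "(sqrt has_derivative (\<lambda>v. v * (inverse (sqrt x) / 2))) (at x)" if "x \<in> {0<..}" for x
    proof -
      have "(*) (inverse (sqrt x) / 2) = (\<lambda>v. v * (inverse (sqrt x) / 2))"
        by (simp add: fun_eq_iff)
      then show ?thesis
        using DERIV_real_sqrt[of x] that by (simp add: has_field_derivative_def)
    qed
  qed auto
qed

section \<open>Infinitely differentiable maps\<close>

definition smooth_on :: "'a::real_normed_vector set \<Rightarrow> ('a \<Rightarrow> 'b::real_normed_vector) \<Rightarrow> bool" where
  "smooth_on U f \<longleftrightarrow> (\<forall>k. Ck_on k U f)"

lemma smooth_on_subset: "smooth_on U f \<Longrightarrow> V \<subseteq> U \<Longrightarrow> smooth_on V f"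
  by (auto simp: smooth_on_def intro: Ck_on_subset)

lemma smooth_on_const: "smooth_on U (\<lambda>x. c)"
  by (simp add: smooth_on_def)

lemma smooth_on_linear: "open U \<Longrightarrow> bounded_linear f \<Longrightarrow> smooth_on U f"
  by (simp add: smooth_on_def Ck_on_linear)

lemma smooth_on_add: "open U \<Longrightarrow> smooth_on U f \<Longrightarrow> smooth_on U g \<Longrightarrow> smooth_on U (\<lambda>x. f x + g x)"
  by (simp add: smooth_on_def Ck_on_add)

lemma smooth_on_bilinear:
  "bounded_bilinear bl \<Longrightarrow> open U \<Longrightarrow> smooth_on U f \<Longrightarrow> smooth_on U g \<Longrightarrow>
    smooth_on U (\<lambda>x. bl (f x) (g x))"
  by (simp add: smooth_on_def Ck_on_bilinear)

lemmas smooth_on_scaleR = smooth_on_bilinear[OF bounded_bilinear_scaleR]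
lemmas smooth_on_inner = smooth_on_bilinear[OF bounded_bilinear_inner]
lemmas smooth_on_mult = smooth_on_bilinear[OF bounded_bilinear_mult]

lemma smooth_on_compose:
  fixes f :: "'a::real_normed_vector \<Rightarrow> 'b::euclidean_space" and g :: "'b \<Rightarrow> 'c::real_normed_vector"
  shows "open U \<Longrightarrow> open V \<Longrightarrow> f ` U \<subseteq> V \<Longrightarrow> smooth_on U f \<Longrightarrow> smooth_on V g \<Longrightarrow>
    smooth_on U (\<lambda>x. g (f x))"
  unfolding smooth_on_def by (blast intro: Ck_on_compose)

lemma smooth_on_linear_compose:
  fixes f :: "'a::real_normed_vector \<Rightarrow> 'b::euclidean_space" and g :: "'b \<Rightarrow> 'c::real_normed_vector"
  shows "open U \<Longrightarrow> bounded_linear g \<Longrightarrow> smooth_on U f \<Longrightarrow> smooth_on U (\<lambda>x. g (f x))"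
  by (rule smooth_on_compose[of U UNIV f g]) (auto intro: smooth_on_linear)

lemma smooth_on_uminus:
  fixes f :: "'a::real_normed_vector \<Rightarrow> 'b::euclidean_space"
  shows "open U \<Longrightarrow> smooth_on U f \<Longrightarrow> smooth_on U (\<lambda>x. - f x)"
  by (rule smooth_on_linear_compose[of U uminus f]) (auto intro: bounded_linear_minus bounded_linear_ident)

lemma smooth_on_diff:
  fixes f :: "'a::real_normed_vector \<Rightarrow> 'b::euclidean_space"
  shows "open U \<Longrightarrow> smooth_on U f \<Longrightarrow> smooth_on U g \<Longrightarrow> smooth_on U (\<lambda>x. f x - g x)"
  using smooth_on_add[of U f "\<lambda>x. - g x"] smooth_on_uminus[of U g] by simp

lemma smooth_on_divide:
  fixes f :: "'a::real_normed_vector \<Rightarrow> real"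
  assumes "open U" "smooth_on U f" "smooth_on U g" "\<And>x. x \<in> U \<Longrightarrow> g x > 0"
  shows "smooth_on U (\<lambda>x. f x / g x)"
proof -
  have "smooth_on U (\<lambda>x. inverse (g x))"
    by (rule smooth_on_compose[of U "{0<..}" g inverse]) (use assms in \<open>auto simp: smooth_on_def Ck_on_inverse\<close>)
  then show ?thesis
    using smooth_on_mult[OF assms(1,2)] by (simp add: divide_inverse)
qed

lemma smooth_on_sqrt:
  assumes "open U" "smooth_on U g" "\<And>x. x \<in> U \<Longrightarrow> g x > 0"
  shows "smooth_on U (\<lambda>x. sqrt (g x))"
  by (rule smooth_on_compose[of U "{0<..}" g sqrt]) (use assms in \<open>auto simp: smooth_on_def Ck_on_sqrt\<close>)

lemma smooth_on_Pair:
  fixes f :: "'a::real_normed_vector \<Rightarrow> 'b::euclidean_space" and g :: "'a \<Rightarrow> 'c::euclidean_space"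
  assumes "open U" "smooth_on U f" "smooth_on U g"
  shows "smooth_on U (\<lambda>x. (f x, g x))"
proof -
  have "smooth_on U (\<lambda>x. (f x, 0) + (0, g x))"
    by (intro smooth_on_add assms smooth_on_linear_compose[of U "\<lambda>x. (x, 0)"]
        smooth_on_linear_compose[of U "\<lambda>x. (0, x)"] bounded_linear_Pair bounded_linear_ident bounded_linear_zero)
  then show ?thesis by simp
qed

lemma smooth_on_differentiable:
  assumes "smooth_on U f" "x \<in> U"
  shows "f differentiable (at x)"
proof -
  have "Ck_on (Suc 0) U f"
    using assms(1) by (simp only: smooth_on_def)
  then show ?thesis
    using assms(2) by simp
qed

lemma smooth_on_imp_continuous_on:
  assumes "smooth_on U f"
  shows "continuous_on U f"
proof -
  have "Ck_on 0 U f"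
    using assms by (simp only: smooth_on_def)
  then show ?thesis
    by simp
qed

section \<open>Volume preserving maps of Euclidean spaces\<close>

text \<open>Preimages of null sets are null because the image measure is Lebesgue measure; this
  extends measurability from Borel to Lebesgue sets.\<close>

lemma lebesgue_preserving:
  fixes f :: "'a::euclidean_space \<Rightarrow> 'b::euclidean_space"
  assumes [measurable]: "f \<in> borel \<rightarrow>\<^sub>M borel" and f: "distr lborel borel f = lborel"
  shows "f \<in> lebesgue \<rightarrow>\<^sub>M lebesgue" "distr lebesgue lebesgue f = lebesgue"
proof -
  have m: "f \<in> lebesgue \<rightarrow>\<^sub>M lborel"
    by (simp add: measurable_completion)
  have d: "distr lebesgue lborel f = lborel"
    using f distr_completion[of f lborel lborel] by (simp cong: distr_cong)
  show "f \<in> lebesgue \<rightarrow>\<^sub>M lebesgue"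
    by (rule completion.measurable_completion2[OF m]) (simp add: d)
  show "distr lebesgue lebesgue f = lebesgue"
    using completion.completion_distr_eq[OF m] by (simp add: d)
qed

text \<open>The change of variables theorem of the library is about \<open>real ^ 'n\<close> with a well-ordered
  index type, so an arbitrary Euclidean space is transported to coordinates indexed by a copy of
  \<open>{..<DIM('a)}\<close>.\<close>

typedef (overloaded) ('a::euclidean_space) coord = "{..<DIM('a)}"
  using DIM_positive by blast

instantiation coord :: (euclidean_space) wellorder
begin

definition less_eq_coord :: "'a coord \<Rightarrow> 'a coord \<Rightarrow> bool" where
  "x \<le> y \<longleftrightarrow> Rep_coord x \<le> Rep_coord y"

definition less_coord :: "'a coord \<Rightarrow> 'a coord \<Rightarrow> bool" where
  "x < y \<longleftrightarrow> Rep_coord x < Rep_coord y"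

instance
proof
  fix x y z :: "'a coord"
  show "x < y \<longleftrightarrow> x \<le> y \<and> \<not> y \<le> x"
    unfolding less_eq_coord_def less_coord_def by linarith
  show "x \<le> x" "x \<le> y \<Longrightarrow> y \<le> z \<Longrightarrow> x \<le> z" "x \<le> y \<or> y \<le> x"
    unfolding less_eq_coord_def by linarith+
  show "x \<le> y \<Longrightarrow> y \<le> x \<Longrightarrow> x = y"
    unfolding less_eq_coord_def by (meson Rep_coord_inject le_antisym)
next
  fix P :: "'a coord \<Rightarrow> bool" and a :: "'a coord"
  assume *: "\<And>x. (\<And>y. y < x \<Longrightarrow> P y) \<Longrightarrow> P x"
  have "wfp (\<lambda>x y :: 'a coord. Rep_coord x < Rep_coord y)"
    by (rule wfp_if_convertible_to_nat)
  then show "P a"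
    by (induction a rule: wfp_induct_rule) (rule *, simp add: less_coord_def)
qed

end

lemma bij_betw_Abs_coord: "bij_betw (Abs_coord :: nat \<Rightarrow> 'a coord) {..<DIM('a::euclidean_space)} UNIV"
  by (rule bij_betwI[of _ _ _ Rep_coord]) (use Rep_coord in \<open>auto simp: Abs_coord_inverse Rep_coord_inverse\<close>)

instance coord :: (euclidean_space) finite
  by standard (use bij_betw_Abs_coord bij_betw_finite finite_lessThan in blast)

lemma ex_coord_basis: "\<exists>b :: 'a coord \<Rightarrow> 'a::euclidean_space. bij_betw b UNIV Basis"
proof -
  have "card (UNIV :: 'a coord set) = DIM('a)"
    using bij_betw_same_card[of "Abs_coord :: nat \<Rightarrow> 'a coord"] bij_betw_Abs_coord by fastforce
  then show ?thesis
    by (intro finite_same_card_bij) auto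
qed

definition coord_basis :: "'a coord \<Rightarrow> 'a::euclidean_space" where
  "coord_basis = (SOME b. bij_betw b UNIV Basis)"

lemma coord_basis: "bij_betw (coord_basis :: 'a coord \<Rightarrow> 'a::euclidean_space) UNIV Basis"
  unfolding coord_basis_def by (rule someI_ex[OF ex_coord_basis])

definition flat :: "'a::euclidean_space \<Rightarrow> real ^ 'a coord" where
  "flat x = (\<chi> i. x \<bullet> coord_basis i)"

definition unflat :: "real ^ 'a coord \<Rightarrow> 'a::euclidean_space" where
  "unflat y = (\<Sum>i\<in>UNIV. y $ i *\<^sub>R coord_basis i)"

lemma sum_coord_basis: "(\<Sum>i\<in>UNIV. g (coord_basis i)) = (\<Sum>b\<in>Basis. g b)"
  by (rule sum.reindex_bij_betw[OF coord_basis])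

lemma inner_coord_basis: "coord_basis i \<bullet> coord_basis j = (if i = j then 1 else 0)"
proof -
  have "coord_basis i \<in> Basis" "coord_basis j \<in> Basis"
    using coord_basis by (auto simp: bij_betw_def)
  then show ?thesis
    using bij_betw_imp_inj_on[OF coord_basis] by (auto simp: inner_Basis dest: injD)
qed

lemma unflat_flat [simp]: "unflat (flat x) = x"
  unfolding unflat_def flat_def by (simp add: sum_coord_basis[of "\<lambda>b. (x \<bullet> b) *\<^sub>R b"] euclidean_representation)

lemma flat_unflat [simp]: "flat (unflat y) = y"
  by (simp add: vec_eq_iff unflat_def flat_def inner_sum_left inner_coord_basis if_distrib cong: if_cong)

lemma linear_flat: "linear flat"
  by (rule linearI) (simp_all add: flat_def vec_eq_iff inner_add_left)

lemma linear_unflat: "linear unflat"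
  by (rule linearI) (simp_all add: unflat_def scaleR_left_distrib sum.distrib scaleR_sum_right)

lemma inner_flat: "flat x \<bullet> flat y = x \<bullet> y"
  using sum_coord_basis[of "\<lambda>b. (x \<bullet> b) * (y \<bullet> b)"] by (simp add: inner_vec_def flat_def euclidean_inner[of x y])

lemma bij_flat: "bij flat"
  by (rule bij_betwI[of _ _ _ unflat]) auto

lemma measurable_flat [measurable]: "flat \<in> borel \<rightarrow>\<^sub>M borel"
  by (intro borel_measurable_continuous_onI linear_continuous_on linear_linear[THEN iffD2] linear_flat)

lemma measurable_unflat [measurable]: "unflat \<in> borel \<rightarrow>\<^sub>M borel"
  by (intro borel_measurable_continuous_onI linear_continuous_on linear_linear[THEN iffD2] linear_unflat)

text \<open>Lebesgue measure is determined by the volumes of boxes, and \<open>flat\<close> matches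
  basis vectors, so the preimage of a box is a box with the same edge lengths.\<close>

lemma distr_flat: "distr lborel borel (flat :: 'a::euclidean_space \<Rightarrow> _) = lborel"
proof (rule lborel_eqI[symmetric])
  fix l u :: "real ^ 'a coord"
  assume le: "\<And>b. b \<in> Basis \<Longrightarrow> l \<bullet> b \<le> u \<bullet> b"
  have comp: "unflat y \<bullet> coord_basis i = y $ i" for y :: "real ^ 'a coord" and i
    using arg_cong[OF flat_unflat[of y], of "\<lambda>y. y $ i"] by (simp add: flat_def)
  have B: "(Basis :: 'a set) = range coord_basis"
    using coord_basis unfolding bij_betw_def by metis
  have le': "l $ i \<le> u $ i" for i
    using le[of "axis i 1"] by (simp add: inner_axis axis_in_Basis_iff)
  have "flat -` box l u = box (unflat l) (unflat u :: 'a)"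
    by (auto simp: mem_box_cart mem_box B comp flat_def)
  then have "emeasure (distr lborel borel (flat :: 'a \<Rightarrow> _)) (box l u) = emeasure lborel (box (unflat l) (unflat u :: 'a))"
    by (simp add: emeasure_distr)
  also have "\<dots> = ennreal (\<Prod>b\<in>Basis. (unflat u - unflat l :: 'a) \<bullet> b)"
    using le' by (subst emeasure_lborel_box) (auto simp: B comp)
  also have "(\<Prod>b\<in>Basis. (unflat u - unflat l :: 'a) \<bullet> b) = (\<Prod>i\<in>UNIV. (unflat u - unflat l :: 'a) \<bullet> coord_basis i)"
    by (rule prod.reindex_bij_betw[OF coord_basis, symmetric])
  also have "\<dots> = (\<Prod>i\<in>UNIV. (u - l) \<bullet> axis i 1)"
    by (simp add: inner_diff_left comp inner_axis)
  also have "\<dots> = (\<Prod>b\<in>Basis. (u - l) \<bullet> b)"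
    unfolding axis_inverse by (rule prod.reindex_bij_betw) (auto simp: bij_betw_def inj_on_def axis_eq_axis Basis_vec_def)
  finally show "emeasure (distr lborel borel (flat :: 'a \<Rightarrow> _)) (box l u) = ennreal (\<Prod>b\<in>Basis. (u - l) \<bullet> b)" .
qed simp

lemma distr_unflat: "distr lborel borel (unflat :: _ \<Rightarrow> 'a::euclidean_space) = lborel"
proof -
  have "distr lborel borel (unflat :: _ \<Rightarrow> 'a) = distr (distr lborel borel flat) borel unflat"
    by (simp add: distr_flat)
  also have "\<dots> = distr lborel borel (\<lambda>x. x)"
    by (subst distr_distr) (auto simp: o_def)
  finally show ?thesis
    by (simp add: distr_id2)
qed

section \<open>Volume preserving linear maps and change of variables\<close>

lemma vimage_lebesgue:
  assumes "f \<in> borel \<rightarrow>\<^sub>M borel" "distr lborel borel f = lborel" "S \<in> sets lebesgue"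
  shows "f -` S \<in> sets lebesgue" "emeasure lebesgue (f -` S) = emeasure lebesgue S"
proof -
  note * = lebesgue_preserving[OF assms(1,2)]
  show "f -` S \<in> sets lebesgue"
    using measurable_sets[OF *(1) assms(3)] by simp
  have "emeasure lebesgue S = emeasure (distr lebesgue lebesgue f) S"
    by (simp add: *(2))
  then show "emeasure lebesgue (f -` S) = emeasure lebesgue S"
    using assms(3) *(1) by (simp add: emeasure_distr)
qed

lemma image_flat: "flat ` S = unflat -` S"
  by (auto simp: image_iff) (metis flat_unflat)

text \<open>Stated through the image measure instead of a determinant, so that it makes sense on
  products and phase spaces without a choice of coordinates and passes to compositions
  directly.\<close>

definition volume_preserving :: "('a::euclidean_space \<Rightarrow> 'a) \<Rightarrow> bool" where
  "volume_preserving L \<longleftrightarrow> linear L \<and> inj L \<and> distr lborel borel L = lborel"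

lemma linear_borel: "linear (L :: 'a::euclidean_space \<Rightarrow> 'b::euclidean_space) \<Longrightarrow> L \<in> borel \<rightarrow>\<^sub>M borel"
  by (intro borel_measurable_continuous_onI linear_continuous_on linear_linear[THEN iffD2])

lemma volume_preserving_compose:
  assumes "volume_preserving L" "volume_preserving M"
  shows "volume_preserving (\<lambda>x. L (M x))"
proof -
  have "distr lborel borel (\<lambda>x. L (M x)) = distr (distr lborel borel M) borel L"
    using assms linear_borel by (subst distr_distr) (auto simp: volume_preserving_def o_def)
  then show ?thesis
    using assms linear_compose[of M L] inj_compose[of L M] by (simp add: volume_preserving_def o_def)
qed

lemma volume_preserving_id: "volume_preserving (\<lambda>x. x)"
  by (simp add: volume_preserving_def linear_ident distr_id2)

text \<open>In coordinates the image of the unit cube has measure equal to the absolute value of the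
  determinant. By injectivity the cube is the full preimage of its image, so this measure is
  1.\<close>

lemma volume_preserving_det:
  assumes "volume_preserving (L :: 'a::euclidean_space \<Rightarrow> 'a)"
  shows "\<bar>det (matrix (\<lambda>y. flat (L (unflat y))))\<bar> = 1"
proof -
  define K where "K y = flat (L (unflat y))" for y
  have L: "linear L" "inj L" "distr lborel borel L = lborel"
    using assms by (auto simp: volume_preserving_def)
  have K: "linear K"
    unfolding K_def[abs_def] using linear_compose[OF linear_compose[OF linear_unflat L(1)] linear_flat]
    by (simp add: o_def)
  have injK: "inj K"
    unfolding K_def[abs_def] using L(2) bij_flat by (metis (mono_tags, lifting) flat_unflat injD injI unflat_flat)
  have mK: "K \<in> borel \<rightarrow>\<^sub>M borel"
    using linear_borel[OF K] .
  have [measurable]: "L \<in> borel \<rightarrow>\<^sub>M borel"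
    by (rule linear_borel[OF L(1)])
  have "distr lborel borel K = distr (distr (distr lborel borel unflat) borel L) borel flat"
    unfolding K_def[abs_def] by (subst distr_distr distr_distr; (simp add: o_def)?)+
  then have dK: "distr lborel borel K = lborel"
    by (simp add: distr_unflat L distr_flat)
  let ?C = "cbox 0 One :: (real ^ 'a coord) set"
  have C: "?C \<in> lmeasurable" "measure lebesgue ?C = 1"
    by auto
  have img: "K ` ?C \<in> lmeasurable" "measure lebesgue (K ` ?C) = \<bar>det (matrix K)\<bar>"
    using measurable_linear_image[OF K C(1)] measure_linear_image[OF K C(1)] C(2) by auto
  have "emeasure lebesgue (K -` (K ` ?C)) = emeasure lebesgue (K ` ?C)"
    using vimage_lebesgue(2)[OF mK dK] img(1) by (simp add: fmeasurableD)
  moreover have "K -` (K ` ?C) = ?C"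
    by (rule inj_vimage_image_eq[OF injK])
  ultimately have "measure lebesgue (K ` ?C) = measure lebesgue ?C"
    by (simp add: measure_def)
  then show ?thesis
    using img C unfolding K_def by simp
qed

text \<open>Change of variables in flat coordinates, where the Jacobian determinant has absolute
  value 1. It is used for sets of finite measure, so \<open>S\<close> is exhausted by its
  intersections with balls.\<close>

theorem volume_preserving_image:
  fixes f :: "'a::euclidean_space \<Rightarrow> 'a"
  assumes S: "S \<in> sets lebesgue" and inj: "inj_on f S"
    and der: "\<And>x. x \<in> S \<Longrightarrow> (f has_derivative D x) (at x)"
    and vol: "\<And>x. x \<in> S \<Longrightarrow> volume_preserving (D x)"
  shows "f ` S \<in> sets lebesgue" "emeasure lebesgue (f ` S) = emeasure lebesgue S"
proof -
  define F where "F y = flat (f (unflat y))" for y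
  have *: "f ` T \<in> lmeasurable \<and> emeasure lebesgue (f ` T) = emeasure lebesgue T"
    if T: "T \<in> lmeasurable" "T \<subseteq> S" for T
  proof -
    let ?T = "flat ` T"
    have T': "?T \<in> sets lebesgue" "emeasure lebesgue ?T = emeasure lebesgue T"
      using vimage_lebesgue[OF measurable_unflat distr_unflat, of T] T(1)
      by (simp_all add: image_flat fmeasurableD)
    then have T'': "?T \<in> lmeasurable"
      using T(1) by (auto simp: fmeasurable_def)
    have "F ` ?T \<in> lmeasurable \<and> measure lebesgue (F ` ?T) = measure lebesgue ?T"
    proof (subst has_measure_differentiable_image[OF T'(1)])
      show "(F has_derivative (\<lambda>y. flat (D (unflat y') (unflat y)))) (at y' within ?T)" if "y' \<in> ?T" for y'
      proof -
        have "(f has_derivative D (unflat y')) (at (unflat y'))"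
          using that T(2) der by auto
        then have "((\<lambda>y. f (unflat y)) has_derivative (\<lambda>y. D (unflat y') (unflat y))) (at y')"
          using has_derivative_compose[of unflat unflat y' UNIV f]
            linear_imp_has_derivative[OF linear_unflat] by auto
        then have "(F has_derivative (\<lambda>y. flat (D (unflat y') (unflat y)))) (at y')"
          unfolding F_def[abs_def]
          using bounded_linear.has_derivative[OF linear_linear[THEN iffD2, OF linear_flat]] by blast
        then show ?thesis by (rule has_derivative_at_withinI)
      qed
      show "inj_on F ?T"
      proof (rule inj_onI)
        fix y z assume "y \<in> ?T" "z \<in> ?T" and eq: "F y = F z"
        then obtain a b where ab: "a \<in> T" "b \<in> T" "y = flat a" "z = flat b"
          by blast
        then have "f a = f b"
          using arg_cong[OF eq, of unflat] by (simp add: F_def)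
        then show "y = z"
          using inj ab T(2) by (auto dest: inj_onD)
      qed
      have "((\<lambda>y. 1::real) has_integral measure lebesgue ?T) ?T"
        using T'' by (simp add: has_integral_iff lmeasurable_iff_integrable_on lmeasure_integral)
      then show "((\<lambda>y'. \<bar>det (matrix (\<lambda>y. flat (D (unflat y') (unflat y))))\<bar>) has_integral measure lebesgue ?T) ?T"
      proof (rule has_integral_eq[rotated])
        fix y' assume "y' \<in> ?T"
        then have "volume_preserving (D (unflat y'))"
          using vol T(2) by auto
        from volume_preserving_det[OF this]
        show "1 = \<bar>det (matrix (\<lambda>y. flat (D (unflat y') (unflat y))))\<bar>"
          by (rule sym)
      qed
    qed
    then have F: "F ` ?T \<in> lmeasurable" "emeasure lebesgue (F ` ?T) = emeasure lebesgue ?T"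
      using T'' by (auto simp: emeasure_eq_measure2)
    have "F ` ?T = flat ` (f ` T)"
      by (auto simp: F_def image_iff)
    then have eq: "f ` T = flat -` (F ` ?T)"
      by (auto simp: image_iff) (metis unflat_flat)
    have "f ` T \<in> sets lebesgue" "emeasure lebesgue (f ` T) = emeasure lebesgue (F ` ?T)"
      unfolding eq using vimage_lebesgue[OF measurable_flat distr_flat, of "F ` ?T"] F(1)
      by (simp_all add: fmeasurableD)
    then show ?thesis
      using F T' T by (auto simp: fmeasurable_def)
  qed
  define A where "A n = S \<inter> ball 0 (real n)" for n :: nat
  have A: "A n \<in> lmeasurable" "A n \<subseteq> S" for n
    using S unfolding A_def by (auto intro!: bounded_set_imp_lmeasurable bounded_Int)
  have S_eq: "S = (\<Union>n. A n)"
    using reals_Archimedean2 by (auto simp: A_def)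
  have fS: "f ` S = (\<Union>n. f ` A n)"
    by (subst S_eq) auto
  show "f ` S \<in> sets lebesgue"
    unfolding fS using *[OF A] by (intro sets.countable_UN) (auto simp: fmeasurableD)
  have inc: "incseq A"
    by (auto simp: incseq_def A_def)
  have "emeasure lebesgue (f ` S) = (SUP n. emeasure lebesgue (f ` A n))"
    unfolding fS using *[OF A] inc image_mono[of _ _ f]
    by (intro SUP_emeasure_incseq[symmetric]) (auto simp: fmeasurableD incseq_def simp del: image_subset_iff)
  also have "\<dots> = (SUP n. emeasure lebesgue (A n))"
    using *[OF A] by simp
  also have "\<dots> = emeasure lebesgue (\<Union>n. A n)"
    using A inc by (intro SUP_emeasure_incseq) (auto simp: fmeasurableD)
  finally show "emeasure lebesgue (f ` S) = emeasure lebesgue S"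
    by (simp add: S_eq[symmetric])
qed

text \<open>Preimages under \<open>R\<close> are images under its inverse, which is orthogonal in
  flat coordinates, and orthogonal images keep measure.\<close>

lemma isometry_volume_preserving:
  fixes R :: "'a::euclidean_space \<Rightarrow> 'a"
  assumes lin: "linear R" and norm: "\<And>x. norm (R x) = norm x"
  shows "volume_preserving R"
proof -
  have orth: "orthogonal_transformation R"
    by (simp add: orthogonal_transformation lin norm)
  obtain Q where Q: "linear Q" "R \<circ> Q = id" "Q \<circ> R = id"
    using orthogonal_transformation_inj[OF orth] linear_injective_isomorphism[OF lin] by (metis fun_eq_iff comp_apply id_apply)
  define K where "K y = flat (Q (unflat y))" for y
  have Q': "R (Q x) = x" "Q (R x) = x" for x
    using Q(2,3) by (metis comp_apply id_apply)+
  have nQ: "norm (Q x) = norm x" for x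
    using norm[of "Q x"] Q' by simp
  have nf: "norm (flat x) = norm x" for x :: 'a
    by (simp add: norm_eq_sqrt_inner inner_flat)
  have nu: "norm (unflat y) = norm y" for y :: "real ^ 'a coord"
    using nf[of "unflat y"] by simp
  have "linear K"
    unfolding K_def[abs_def] using linear_compose[OF linear_compose[OF linear_unflat Q(1)] linear_flat]
    by (simp add: o_def)
  then have K: "orthogonal_transformation K"
    by (simp add: orthogonal_transformation K_def nf nQ nu)
  have "distr lborel borel R = lborel"
  proof (rule lborel_eqI[symmetric])
    fix l u :: 'a
    assume le: "\<And>b. b \<in> Basis \<Longrightarrow> l \<bullet> b \<le> u \<bullet> b"
    have box: "box l u \<in> lmeasurable" by simp
    then have f1: "flat ` box l u \<in> sets lebesgue" "emeasure lebesgue (flat ` box l u) = emeasure lebesgue (box l u)"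
      using vimage_lebesgue[OF measurable_unflat distr_unflat, of "box l u"] by (simp_all add: image_flat)
    then have f2: "flat ` box l u \<in> lmeasurable"
      using fmeasurableD2[OF box] by (intro fmeasurableI) (auto simp only: top.not_eq_extremum infinity_ennreal_def)
    have "R -` box l u = Q ` box l u"
    proof (intro equalityI subsetI)
      fix x assume "x \<in> R -` box l u"
      then show "x \<in> Q ` box l u"
        by (intro image_eqI[of _ _ "R x"]) (auto simp: Q')
    qed (auto simp: Q')
    moreover have "K ` flat ` box l u = flat ` Q ` box l u"
      by (simp add: image_comp K_def o_def)
    ultimately have eq: "R -` box l u = flat -` (K ` (flat ` box l u))"
      using inj_vimage_image_eq[OF bij_is_inj[OF bij_flat]] by metis
    have "emeasure lebesgue (R -` box l u) = emeasure lebesgue (K ` (flat ` box l u))"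
      unfolding eq using measurable_orthogonal_image[OF K f2]
      by (intro vimage_lebesgue measurable_flat distr_flat) (auto simp: fmeasurableD)
    also have "\<dots> = emeasure lebesgue (flat ` box l u)"
      using measurable_orthogonal_image[OF K f2] measure_orthogonal_image[OF K f2] f2
      by (simp add: emeasure_eq_measure2)
    also have "\<dots> = emeasure lborel (box l u)"
      using f1 by simp
    finally have "emeasure lborel (R -` box l u) = emeasure lborel (box l u)"
      using measurable_sets[OF linear_borel[OF lin], of "box l u"] by simp
    then show "emeasure (distr lborel borel R) (box l u) = ennreal (\<Prod>b\<in>Basis. (u - l) \<bullet> b)"
      using le linear_borel[OF lin] by (simp add: emeasure_distr emeasure_lborel_box)
  qed simp
  then show ?thesis
    using lin orthogonal_transformation_inj[OF orth] by (simp add: volume_preserving_def)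
qed

text \<open>Tonelli: for fixed \<open>x\<close> the fibre map is \<open>Q\<close> followed by a
  translation, which keeps the inner integral, and the outer integral is then transformed by
  \<open>R\<close>. The off-diagonal block merely translates fibres.\<close>

lemma triangular_volume_preserving:
  fixes L :: "'a::euclidean_space \<times> 'b::euclidean_space \<Rightarrow> 'a \<times> 'b"
  assumes L: "linear L" and R: "volume_preserving R" and Q: "volume_preserving Q"
    and fst_L: "\<And>x y. fst (L (x, y)) = R x" and snd_L: "\<And>y. snd (L (0, y)) = Q y"
  shows "volume_preserving L"
proof -
  define K where "K x = snd (L (x, 0))" for x
  have Leq: "L (x, y) = (R x, K x + Q y)" for x y
  proof -
    have "L (x, y) = L (x, 0) + L (0, y)"
      using linear_add[OF L, of "(x, 0)" "(0, y)"] by simp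
    then show ?thesis
      using fst_L[of x y] snd_L[of y] by (simp add: K_def prod_eq_iff)
  qed
  have [measurable]: "R \<in> borel \<rightarrow>\<^sub>M borel" "Q \<in> borel \<rightarrow>\<^sub>M borel" "L \<in> borel \<rightarrow>\<^sub>M borel"
    using R Q L by (auto simp: volume_preserving_def linear_borel)
  have "inj L"
  proof (subst linear_injective_0[OF L], intro allI impI)
    fix z assume "L z = 0"
    then obtain x y where z: "z = (x, y)" "R x = 0" "K x + Q y = 0"
      by (cases z) (auto simp: Leq zero_prod_def)
    then have "x = 0"
      using R linear_injective_0 by (auto simp: volume_preserving_def)
    moreover have "K 0 = 0"
      using linear_0[OF L] by (simp add: K_def zero_prod_def[symmetric])
    ultimately show "z = 0"
      using z Q linear_injective_0 by (auto simp: volume_preserving_def zero_prod_def)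
  qed
  moreover have "distr lborel borel L = lborel"
  proof (rule measure_eqI)
    fix A assume "A \<in> sets (distr lborel borel L)"
    then have [measurable]: "A \<in> sets borel" by simp
    have sets_eq: "sets (lborel \<Otimes>\<^sub>M lborel) = sets (borel :: ('a \<times> 'b) measure)"
      by (metis lborel_prod sets_lborel)
    have A': "A \<in> sets (lborel \<Otimes>\<^sub>M lborel)"
      unfolding sets_eq by fact
    have ind: "(\<lambda>z. indicator A z) \<in> borel_measurable (lborel \<Otimes>\<^sub>M lborel)"
      if "A \<in> sets borel" for A :: "('a \<times> 'b) set"
      by (rule borel_measurable_indicator) (use that sets_eq in blast)
    have AL: "L -` A \<in> sets borel"
      using measurable_sets[of L borel borel A] by simp
    have "emeasure (distr lborel borel L) A = emeasure (lborel \<Otimes>\<^sub>M lborel) (L -` A)"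
      by (simp add: emeasure_distr lborel_prod)
    also have "\<dots> = (\<integral>\<^sup>+x. \<integral>\<^sup>+y. indicator (L -` A) (x, y) \<partial>lborel \<partial>lborel)"
      by (rule lborel.emeasure_pair_measure) (use AL sets_eq in blast)
    also have "\<dots> = (\<integral>\<^sup>+x. \<integral>\<^sup>+y. indicator A (R x, y) \<partial>lborel \<partial>lborel)"
    proof (rule nn_integral_cong)
      fix x :: 'a
      have sec: "(\<lambda>y. indicator A (R x, y) :: ennreal) \<in> borel_measurable borel"
        by measurable
      have "(\<integral>\<^sup>+y. indicator (L -` A) (x, y) \<partial>lborel) = (\<integral>\<^sup>+y. indicator A (R x, K x + Q y) \<partial>lborel)"
        by (simp add: indicator_def Leq)
      also have "\<dots> = (\<integral>\<^sup>+y. indicator A (R x, K x + y) \<partial>(distr lborel borel Q))"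
        by (subst nn_integral_distr) auto
      also have "\<dots> = (\<integral>\<^sup>+y. indicator A (R x, K x + y) \<partial>lborel)"
        using Q by (simp add: volume_preserving_def)
      also have "\<dots> = (\<integral>\<^sup>+y. indicator A (R x, y) \<partial>(distr lborel borel ((+) (K x))))"
        using sec by (subst nn_integral_distr) auto
      also have "\<dots> = (\<integral>\<^sup>+y. indicator A (R x, y) \<partial>lborel)"
        by (simp add: lborel_distr_plus)
      finally show "(\<integral>\<^sup>+y. indicator (L -` A) (x, y) \<partial>lborel) = (\<integral>\<^sup>+y. indicator A (R x, y) \<partial>lborel)" .
    qed
    also have "\<dots> = (\<integral>\<^sup>+x. \<integral>\<^sup>+y. indicator A (x, y) \<partial>lborel \<partial>(distr lborel borel R))"
      using lborel.borel_measurable_nn_integral_fst[OF ind[of A]]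
      by (intro nn_integral_distr[symmetric]) auto
    also have "\<dots> = (\<integral>\<^sup>+x. \<integral>\<^sup>+y. indicator A (x, y) \<partial>lborel \<partial>lborel)"
      using R by (simp add: volume_preserving_def)
    also have "\<dots> = emeasure lborel A"
      using lborel.emeasure_pair_measure[OF A'] by (simp add: lborel_prod)
    finally show "emeasure (distr lborel borel L) A = emeasure lborel A" .
  qed simp
  ultimately show ?thesis
    using L by (simp add: volume_preserving_def)
qed

text \<open>All translates of \<open>S\<close> along \<open>a\<close> have the same measure.
  Averaging it over translations by \<open>t\<close> in the unit interval and exchanging the
  integrals yields the integral of the measures of the line sections, which vanish.\<close>

lemma null_set_lines:
  fixes S :: "'a::euclidean_space set"
  assumes S: "S \<in> sets borel" and lines: "\<And>x. countable {t. x + t *\<^sub>R a \<in> S}"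
  shows "S \<in> null_sets lborel"
proof -
  have [measurable]: "S \<in> sets borel" by fact
  let ?m = "\<lambda>t. \<integral>\<^sup>+x. indicator S (x + t *\<^sub>R a) \<partial>lborel"
  have const: "?m t = emeasure lborel S" for t
  proof -
    have "?m t = (\<integral>\<^sup>+x. indicator S x \<partial>(distr lborel borel ((+) (t *\<^sub>R a))))"
      by (subst nn_integral_distr) (auto simp: add.commute)
    then show ?thesis by (simp add: lborel_distr_plus)
  qed
  have "(\<integral>\<^sup>+t. indicator {0..1::real} t * ?m t \<partial>lborel) = (\<integral>\<^sup>+t. indicator {0..1::real} t * emeasure lborel S \<partial>lborel)"
    by (simp only: const)
  also have "\<dots> = emeasure lborel S"
    by (simp add: nn_integral_multc)
  finally have "emeasure lborel S = (\<integral>\<^sup>+t. indicator {0..1::real} t * ?m t \<partial>lborel)" ..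
  also have "\<dots> = (\<integral>\<^sup>+t. \<integral>\<^sup>+x. indicator {0..1::real} t * indicator S (x + t *\<^sub>R a) \<partial>lborel \<partial>lborel)"
    by (intro nn_integral_cong nn_integral_cmult[symmetric]) auto
  also have "\<dots> = (\<integral>\<^sup>+x. \<integral>\<^sup>+t. indicator {0..1::real} t * indicator S (x + t *\<^sub>R a) \<partial>lborel \<partial>lborel)"
    by (rule lborel_pair.Fubini') measurable
  also have "\<dots> = (\<integral>\<^sup>+(x::'a). 0 \<partial>lborel)"
  proof (rule nn_integral_cong)
    fix x
    have "(\<integral>\<^sup>+t. indicator {0..1::real} t * indicator S (x + t *\<^sub>R a) \<partial>lborel)
        \<le> (\<integral>\<^sup>+t. indicator {t. x + t *\<^sub>R a \<in> S} t \<partial>lborel)"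
      by (intro nn_integral_mono) (auto simp: indicator_def)
    also have "\<dots> = emeasure lborel {t. x + t *\<^sub>R a \<in> S}"
      using lines[of x] by (intro nn_integral_indicator) (auto intro: countable_imp_null_set_lborel)
    also have "\<dots> = 0"
      using lines[of x] by (rule emeasure_lborel_countable)
    finally show "(\<integral>\<^sup>+t. indicator {0..1::real} t * indicator S (x + t *\<^sub>R a) \<partial>lborel) = 0"
      by simp
  qed
  finally show ?thesis
    using S by (simp add: null_sets_def)
qed

section \<open>Reflection at a single obstacle\<close>

text \<open>The class of local models of the flow: near suitable states a time map agrees with such
  an \<open>F\<close>. Models can be composed and restricted, hence chained from one collision to
  the next.\<close>

definition smooth_vp :: "'a::euclidean_space set \<Rightarrow> ('a \<Rightarrow> 'a) \<Rightarrow> bool" where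
  "smooth_vp U F \<longleftrightarrow> open U \<and> smooth_on U F \<and>
     (\<forall>z\<in>U. \<exists>D. (F has_derivative D) (at z) \<and> volume_preserving D)"

lemma smooth_vp_subset: "smooth_vp U F \<Longrightarrow> open V \<Longrightarrow> V \<subseteq> U \<Longrightarrow> smooth_vp V F"
  unfolding smooth_vp_def using smooth_on_subset by blast

lemma smooth_vp_continuous: "smooth_vp U F \<Longrightarrow> continuous_on U F"
  by (simp add: smooth_vp_def smooth_on_imp_continuous_on)

lemma smooth_vp_compose:
  assumes F: "smooth_vp U F" and H: "smooth_vp V H"
  shows "smooth_vp (U \<inter> F -` V) (\<lambda>z. H (F z))"
proof -
  let ?W = "U \<inter> F -` V"
  have W: "open ?W"
    using F H continuous_open_preimage[OF smooth_vp_continuous[OF F]] by (auto simp: smooth_vp_def)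
  have "smooth_on ?W (\<lambda>z. H (F z))"
    by (rule smooth_on_compose[of ?W V F H]) (use F H W smooth_on_subset[of U F ?W] in \<open>auto simp: smooth_vp_def\<close>)
  moreover have "\<exists>D. ((\<lambda>z. H (F z)) has_derivative D) (at z) \<and> volume_preserving D" if z: "z \<in> ?W" for z
  proof -
    obtain D E where "(F has_derivative D) (at z)" "volume_preserving D"
      "(H has_derivative E) (at (F z))" "volume_preserving E"
      using F H z unfolding smooth_vp_def by blast
    then have "((\<lambda>z. H (F z)) has_derivative (\<lambda>x. E (D x))) (at z)" "volume_preserving (\<lambda>x. E (D x))"
      using has_derivative_compose[of F D z UNIV H E] volume_preserving_compose by auto
    then show ?thesis by blast
  qed
  ultimately show ?thesis
    using W by (simp add: smooth_vp_def)
qed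

lemma smooth_vp_linear:
  assumes "volume_preserving L"
  shows "smooth_vp UNIV L"
  using assms linear_linear linear_imp_has_derivative
  unfolding smooth_vp_def volume_preserving_def by (auto intro!: smooth_on_linear)

text \<open>Exchanging the two components is an isometry and conjugates the shear to a block
  triangular map with identity diagonal blocks.\<close>

lemma volume_preserving_shear:
  "volume_preserving (\<lambda>z :: 'a::euclidean_space \<times> 'a. (fst z + t *\<^sub>R snd z, snd z))"
proof -
  let ?L = "\<lambda>z :: 'a \<times> 'a. (fst z, snd z + t *\<^sub>R fst z)" and ?w = "\<lambda>z :: 'a \<times> 'a. (snd z, fst z)"
  have w: "volume_preserving ?w"
    by (rule isometry_volume_preserving) (auto intro!: linearI simp: norm_prod_def add.commute)
  have "volume_preserving ?L"
    by (rule triangular_volume_preserving[OF _ volume_preserving_id volume_preserving_id])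
      (auto intro!: linearI simp: algebra_simps)
  from volume_preserving_compose[OF w volume_preserving_compose[OF this w]] show ?thesis
    by simp
qed

locale obstacle =
  fixes G :: "'a::euclidean_space \<Rightarrow> 'a" and s :: real
  assumes linear_G: "linear G"
    and sym: "G x \<bullet> y = x \<bullet> G y"
    and psd: "0 \<le> G x \<bullet> x"
    and s_pos: "0 < s"
begin

lemma sym': "G x \<bullet> y = G y \<bullet> x"
  using sym[of x y] by (simp add: inner_commute)

lemmas G_lin = linear_add[OF linear_G] linear_diff[OF linear_G] linear_cmul[OF linear_G]
  linear_neg[OF linear_G] linear_0[OF linear_G]

lemma form_flow: "G (x + t *\<^sub>R v) \<bullet> (x + t *\<^sub>R v) = G x \<bullet> x + 2 * t * (G x \<bullet> v) + t\<^sup>2 * (G v \<bullet> v)"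
  by (simp add: G_lin inner_add_left inner_add_right sym'[of v x] power2_eq_square algebra_simps)

lemma polar_flow: "G (x + t *\<^sub>R v) \<bullet> v = G x \<bullet> v + t * (G v \<bullet> v)"
  by (simp add: G_lin inner_add_left)

lemma Cauchy_Schwarz: "(G x \<bullet> y)\<^sup>2 \<le> (G x \<bullet> x) * (G y \<bullet> y)"
proof -
  have *: "(G x \<bullet> y)\<^sup>2 \<le> (G x \<bullet> x) * (G y \<bullet> y)" if "G y \<bullet> y > 0" for x y
  proof -
    have "0 \<le> G x \<bullet> x + 2 * (- (G x \<bullet> y) / (G y \<bullet> y)) * (G x \<bullet> y) + (- (G x \<bullet> y) / (G y \<bullet> y))\<^sup>2 * (G y \<bullet> y)"
      using psd[of "x + (- (G x \<bullet> y) / (G y \<bullet> y)) *\<^sub>R y"] unfolding form_flow .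
    then have "0 \<le> (G y \<bullet> y) * (G x \<bullet> x + 2 * (- (G x \<bullet> y) / (G y \<bullet> y)) * (G x \<bullet> y) + (- (G x \<bullet> y) / (G y \<bullet> y))\<^sup>2 * (G y \<bullet> y))"
      using that by simp
    also have "\<dots> = (G y \<bullet> y) * (G x \<bullet> x) - (G x \<bullet> y)\<^sup>2"
      using that by (simp add: field_simps power2_eq_square)
    finally show ?thesis by (simp add: mult.commute)
  qed
  consider "G y \<bullet> y > 0" | "G x \<bullet> x > 0" | "G y \<bullet> y = 0" "G x \<bullet> x = 0"
    using psd[of x] psd[of y] by linarith
  then show ?thesis
  proof cases
    case 2
    then show ?thesis using *[of x y] by (simp add: sym'[of y x] mult.commute)
  next
    case 3
    \<comment> \<open>The form is only semidefinite, so both squares may vanish. Then its values at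
      \<open>x + y\<close> and \<open>x - y\<close> are plus and minus twice the mixed term, and
      both are nonnegative.\<close>
    have "G x \<bullet> y = 0"
      using psd[of "x + 1 *\<^sub>R y"] psd[of "x + (-1) *\<^sub>R y"] 3 unfolding form_flow by simp
    then show ?thesis using 3 by simp
  qed (rule *)
qed

lemma G_nonzero: "G x \<bullet> y \<noteq> 0 \<Longrightarrow> G x \<noteq> 0" "G x \<bullet> y \<noteq> 0 \<Longrightarrow> G y \<bullet> y > 0"
  using Cauchy_Schwarz[of x y] psd[of y] by (auto simp: order_le_less)

text \<open>\<open>G x\<close> is normal to the level set of the quadratic form through
  \<open>x\<close>, so this is specular reflection in the tangent hyperplane. Where
  \<open>G x = 0\<close> it is the identity, hence an isometry for every \<open>x\<close>.\<close>

definition reflection :: "'a \<Rightarrow> 'a \<Rightarrow> 'a" where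
  "reflection x v = v - (2 * (G x \<bullet> v) / (G x \<bullet> G x)) *\<^sub>R G x"

lemma linear_reflection: "linear (reflection x)"
  by (rule linearI) (simp_all add: reflection_def algebra_simps add_divide_distrib)

lemma polar_reflection: "G x \<bullet> reflection x v = - (G x \<bullet> v)"
  by (cases "G x = 0") (simp_all add: reflection_def inner_diff_right)

lemma reflection_reflection: "reflection x (reflection x v) = v"
  using polar_reflection[of x v] by (simp add: reflection_def[of x "reflection x v"]) (simp add: reflection_def)

lemma norm_reflection: "norm (reflection x v) = norm v"
proof -
  have "reflection x v \<bullet> reflection x v = reflection x v \<bullet> v - (2 * (G x \<bullet> v) / (G x \<bullet> G x)) * (reflection x v \<bullet> G x)"
    by (subst (2) reflection_def) (simp add: inner_diff_right)
  also have "reflection x v \<bullet> G x = - (G x \<bullet> v)"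
    using polar_reflection[of x v] by (simp add: inner_commute)
  also have "reflection x v \<bullet> v = v \<bullet> v - (2 * (G x \<bullet> v) / (G x \<bullet> G x)) * (G x \<bullet> v)"
    by (simp add: reflection_def inner_diff_left)
  finally show ?thesis by (simp add: norm_eq_sqrt_inner)
qed

lemma reflection_volume_preserving: "volume_preserving (reflection x)"
  by (rule isometry_volume_preserving[OF linear_reflection norm_reflection])

text \<open>A quarter of the discriminant of the quadratic polynomial
  \<open>t \<mapsto> G (x + t v) \<bullet> (x + t v) - s\<close>. A shift of time does not change
  it, so it is constant along free motion.\<close>

definition discr :: "'a \<times> 'a \<Rightarrow> real" where
  "discr z = (G (fst z) \<bullet> snd z)\<^sup>2 - (G (snd z) \<bullet> snd z) * (G (fst z) \<bullet> fst z - s)"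

text \<open>The form may be degenerate, so the leading coefficient has to be positive; a positive
  discriminant then makes the crossing transversal. Crossings in the past count as well.\<close>

definition hits :: "('a \<times> 'a) set" where
  "hits = {z. 0 < G (snd z) \<bullet> snd z \<and> 0 < discr z}"

text \<open>The smaller solution \<open>t\<close> of \<open>G (x + t *\<^sub>R v) \<bullet> (x + t *\<^sub>R v) = s\<close>.\<close>

definition entry :: "'a \<times> 'a \<Rightarrow> real" where
  "entry z = (- (G (fst z) \<bullet> snd z) - sqrt (discr z)) / (G (snd z) \<bullet> snd z)"

text \<open>The free motion that agrees with the reflected motion after the collision.\<close>

definition scatter :: "'a \<times> 'a \<Rightarrow> 'a \<times> 'a" where
  "scatter z = (let w = reflection (fst z + entry z *\<^sub>R snd z) (snd z)
     in (fst z + entry z *\<^sub>R (snd z - w), w))"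

lemma discr_flow: "discr (x + t *\<^sub>R v, v) = discr (x, v)"
  unfolding discr_def fst_conv snd_conv polar_flow form_flow
  by (simp add: power2_eq_square algebra_simps)

lemma entry_flow: "(x, v) \<in> hits \<Longrightarrow> entry (x + t *\<^sub>R v, v) = entry (x, v) - t"
  by (simp add: entry_def discr_flow polar_flow hits_def field_simps)

lemma scatter_flow:
  "(x, v) \<in> hits \<Longrightarrow>
    scatter (x + t *\<^sub>R v, v) = (fst (scatter (x, v)) + t *\<^sub>R snd (scatter (x, v)), snd (scatter (x, v)))"
  by (simp add: scatter_def Let_def entry_flow algebra_simps)

lemma polar_entry:
  assumes "(x, v) \<in> hits"
  shows "G (x + entry (x, v) *\<^sub>R v) \<bullet> v = - sqrt (discr (x, v))" "sqrt (discr (x, v)) > 0"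
  using assms by (simp_all add: polar_flow entry_def hits_def)

lemma form_entry:
  assumes "(x, v) \<in> hits"
  shows "G (x + entry (x, v) *\<^sub>R v) \<bullet> (x + entry (x, v) *\<^sub>R v) = s"
proof -
  let ?y = "x + entry (x, v) *\<^sub>R v"
  have "discr (?y, v) = discr (x, v)"
    by (rule discr_flow)
  moreover have "(G ?y \<bullet> v)\<^sup>2 = discr (x, v)"
    using polar_entry[OF assms] by simp
  ultimately have "(G v \<bullet> v) * (G ?y \<bullet> ?y - s) = 0"
    unfolding discr_def[of "(?y, v)"] by simp
  then show ?thesis
    using assms by (simp add: hits_def)
qed

text \<open>An upward parabola is strictly decreasing only at the smaller of its two roots, which is
  the one that \<open>entry\<close> selects.\<close>

lemma crossing:
  assumes "G (x + t *\<^sub>R v) \<bullet> (x + t *\<^sub>R v) = s" "G (x + t *\<^sub>R v) \<bullet> v < 0"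
  shows "(x, v) \<in> hits" "entry (x, v) = t"
proof -
  let ?y = "x + t *\<^sub>R v"
  have d: "discr (x, v) = (G ?y \<bullet> v)\<^sup>2"
    using assms discr_flow[of x t v] by (simp add: discr_def)
  have v: "G v \<bullet> v > 0"
    using G_nonzero(2)[of ?y v] assms(2) by simp
  show "(x, v) \<in> hits"
    using v d assms(2) by (simp add: hits_def)
  have "sqrt (discr (x, v)) = - (G ?y \<bullet> v)"
    using assms(2) by (simp add: d real_sqrt_unique)
  then show "entry (x, v) = t"
    using v by (simp add: entry_def polar_flow field_simps)
qed

lemma form_from_entry:
  assumes "(x, v) \<in> hits"
  shows "G (x + t *\<^sub>R v) \<bullet> (x + t *\<^sub>R v) =
    s - 2 * (t - entry (x, v)) * sqrt (discr (x, v)) + (t - entry (x, v))\<^sup>2 * (G v \<bullet> v)"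
proof -
  let ?y = "x + entry (x, v) *\<^sub>R v"
  have eq: "x + t *\<^sub>R v = ?y + (t - entry (x, v)) *\<^sub>R v"
    by (simp add: algebra_simps)
  show ?thesis
    unfolding eq form_flow[of ?y] form_entry[OF assms] polar_entry(1)[OF assms] by simp
qed

lemma form_before:
  assumes "(x, v) \<in> hits" "t < entry (x, v)"
  shows "s < G (x + t *\<^sub>R v) \<bullet> (x + t *\<^sub>R v)"
proof -
  have "(t - entry (x, v)) * sqrt (discr (x, v)) < 0"
    using assms polar_entry(2)[OF assms(1)] by (simp add: mult_neg_pos)
  moreover have "0 \<le> (t - entry (x, v))\<^sup>2 * (G v \<bullet> v)"
    using psd by simp
  ultimately show ?thesis
    unfolding form_from_entry[OF assms(1)] by linarith
qed

text \<open>The entry lies in the past and the form is still decreasing, so the state sits between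
  the smaller root and the vertex of the parabola.\<close>

lemma form_inside:
  assumes "(x, v) \<in> hits" "entry (x, v) < 0" "G x \<bullet> v < 0"
  shows "G x \<bullet> x < s"
proof -
  let ?r = "sqrt (discr (x, v))" and ?e = "entry (x, v)"
  have "?r + ?e * (G v \<bullet> v) > 0"
    using polar_entry(1)[OF assms(1)] assms(3) unfolding polar_flow by linarith
  then have "?e * (2 * ?r + ?e * (G v \<bullet> v)) < 0"
    using polar_entry(2)[OF assms(1)] by (intro mult_neg_pos[OF assms(2)]) linarith
  then show ?thesis
    using form_from_entry[OF assms(1), of 0] by (simp add: power2_eq_square algebra_simps)
qed

lemma scatter_entry:
  "fst (scatter z) + entry z *\<^sub>R snd (scatter z) = fst z + entry z *\<^sub>R snd z"
  "snd (scatter z) = reflection (fst z + entry z *\<^sub>R snd z) (snd z)"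
  by (simp_all add: scatter_def Let_def algebra_simps)

lemma form_after:
  assumes "(x, v) \<in> hits" "entry (x, v) < t"
  shows "s < G (fst (scatter (x, v)) + t *\<^sub>R snd (scatter (x, v))) \<bullet> (fst (scatter (x, v)) + t *\<^sub>R snd (scatter (x, v)))"
proof -
  let ?y = "x + entry (x, v) *\<^sub>R v" and ?w = "snd (scatter (x, v))"
  have eq: "fst (scatter (x, v)) + t *\<^sub>R ?w = ?y + (t - entry (x, v)) *\<^sub>R ?w"
    using scatter_entry(1)[of "(x, v)"] by (simp add: algebra_simps)
  have w: "G ?y \<bullet> ?w = sqrt (discr (x, v))"
    using scatter_entry(2)[of "(x, v)"] polar_reflection polar_entry(1)[OF assms(1)] by simp
  have "0 < (t - entry (x, v)) * sqrt (discr (x, v))"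
    using assms polar_entry(2)[OF assms(1)] by simp
  moreover have "0 \<le> (t - entry (x, v))\<^sup>2 * (G ?w \<bullet> ?w)"
    using psd by simp
  ultimately show ?thesis
    unfolding eq form_flow[of ?y] form_entry[OF assms(1)] w mult.assoc by linarith
qed

lemma bounded_linear_G: "bounded_linear G"
  using linear_G linear_linear by blast

lemma smooth_forms:
  assumes "open U" "smooth_on U f" "smooth_on U g"
  shows "smooth_on U (\<lambda>z :: 'a \<times> 'a. G (f z) \<bullet> g z)"
  using assms by (intro smooth_on_inner smooth_on_linear_compose[of U G f] bounded_linear_G)

lemma continuous_forms [continuous_intros]:
  "continuous_on A f \<Longrightarrow> continuous_on A g \<Longrightarrow> continuous_on A (\<lambda>z. G (f z) \<bullet> g z)"
  by (intro continuous_on_inner bounded_linear.continuous_on[OF bounded_linear_G])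

lemma open_hits: "open hits"
proof -
  have "hits = {z. 0 < G (snd z) \<bullet> snd z} \<inter> {z. 0 < discr z}"
    by (auto simp: hits_def)
  then show ?thesis
    unfolding discr_def by (auto intro!: open_Collect_less continuous_intros)
qed

lemma smooth_fst: "open U \<Longrightarrow> smooth_on U (fst :: 'a \<times> 'a \<Rightarrow> 'a)"
  and smooth_snd: "open U \<Longrightarrow> smooth_on U (snd :: 'a \<times> 'a \<Rightarrow> 'a)"
  by (simp_all add: smooth_on_linear bounded_linear_fst bounded_linear_snd)

lemma smooth_entry: "smooth_on hits entry"
proof -
  have 1: "smooth_on hits discr"
    unfolding discr_def[abs_def] power2_eq_square
    by (intro smooth_on_diff smooth_on_mult smooth_forms smooth_fst smooth_snd smooth_on_const open_hits)
  have 2: "smooth_on hits (\<lambda>z. sqrt (discr z))"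
    by (rule smooth_on_sqrt[OF open_hits 1]) (simp add: hits_def)
  have 3: "smooth_on hits (\<lambda>z. - (G (fst z) \<bullet> snd z) - sqrt (discr z))"
    by (intro smooth_on_diff smooth_on_uminus smooth_forms smooth_fst smooth_snd open_hits 2)
  show ?thesis
    unfolding entry_def[abs_def]
  proof (rule smooth_on_divide[OF open_hits 3])
    show "smooth_on hits (\<lambda>z. G (snd z) \<bullet> snd z)"
      by (intro smooth_forms smooth_snd open_hits)
  qed (auto simp: hits_def)
qed

lemma smooth_entry_velocity:
  "smooth_on hits (\<lambda>z. reflection (fst z + entry z *\<^sub>R snd z) (snd z))"
proof -
  let ?y = "\<lambda>z. fst z + entry z *\<^sub>R snd z"
  have y: "smooth_on hits ?y"
    by (intro smooth_on_add smooth_on_scaleR smooth_fst smooth_snd open_hits smooth_entry)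
  have Gy: "smooth_on hits (\<lambda>z. G (?y z))"
    by (rule smooth_on_linear_compose[OF open_hits bounded_linear_G y])
  have num: "smooth_on hits (\<lambda>z. 2 * (G (?y z) \<bullet> snd z))"
    by (intro smooth_on_mult smooth_on_const smooth_on_inner Gy smooth_snd open_hits)
  have den: "smooth_on hits (\<lambda>z. G (?y z) \<bullet> G (?y z))"
    by (intro smooth_on_inner Gy open_hits)
  have "smooth_on hits (\<lambda>z. 2 * (G (?y z) \<bullet> snd z) / (G (?y z) \<bullet> G (?y z)))"
  proof (rule smooth_on_divide[OF open_hits num den])
    fix z assume "z \<in> hits"
    then have "G (?y z) \<bullet> snd z \<noteq> 0"
      using polar_entry[of "fst z" "snd z"] by simp
    then show "0 < G (?y z) \<bullet> G (?y z)"
      using G_nonzero(1) by auto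
  qed
  then show ?thesis
    unfolding reflection_def
    by (intro smooth_on_diff smooth_on_scaleR Gy smooth_snd open_hits)
qed

lemma smooth_scatter: "smooth_on hits scatter"
  unfolding scatter_def[abs_def] Let_def
  by (intro smooth_on_Pair smooth_on_add smooth_on_scaleR smooth_on_diff smooth_fst smooth_snd
      smooth_entry smooth_entry_velocity open_hits)

text \<open>At a state on the obstacle the derivative of \<open>scatter\<close> is block triangular, with the reflection
  as both diagonal blocks. Along the free motion \<open>scatter\<close> is conjugated by a volume preserving
  linear map, which gives the general case.\<close>

lemma scatter_derivative_boundary:
  assumes q: "G y \<bullet> y = s" and B: "G y \<bullet> v < 0"
  shows "\<exists>D. (scatter has_derivative D) (at (y, v)) \<and> volume_preserving D"
proof -
  let ?w = "(y, v)"
  have w: "?w \<in> hits" and e0: "entry ?w = 0"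
    using crossing[of y 0 v] q B by auto
  obtain D where D: "(scatter has_derivative D) (at ?w)"
    using smooth_on_differentiable[OF smooth_scatter w] by (auto simp: differentiable_def)
  obtain E where E: "(entry has_derivative E) (at ?w)"
    using smooth_on_differentiable[OF smooth_entry w] by (auto simp: differentiable_def)
  let ?n = "\<lambda>z. reflection (fst z + entry z *\<^sub>R snd z) (snd z)"
  obtain N where N: "(?n has_derivative N) (at ?w)"
    using smooth_on_differentiable[OF smooth_entry_velocity w] by (auto simp: differentiable_def)
  have nw: "?n ?w = reflection y v"
    by (simp add: e0)
  have "((\<lambda>z. fst (scatter z)) has_derivative (\<lambda>h. fst (D h))) (at ?w)"
    by (rule has_derivative_fst[OF D])
  moreover have "((\<lambda>z. fst z + entry z *\<^sub>R (snd z - ?n z)) has_derivative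
      (\<lambda>h. fst h + (entry ?w *\<^sub>R (snd h - N h) + E h *\<^sub>R (snd ?w - ?n ?w)))) (at ?w)"
    by (intro has_derivative_add has_derivative_scaleR has_derivative_diff E N
        has_derivative_fst has_derivative_snd has_derivative_ident)
  moreover have "(\<lambda>z. fst (scatter z)) = (\<lambda>z. fst z + entry z *\<^sub>R (snd z - ?n z))"
    by (simp add: scatter_def Let_def fun_eq_iff)
  \<comment> \<open>Two expressions for the derivative of the first component agree. As the entry
    time is 0 at this state, the derivative \<open>N\<close> of the reflected velocity drops out and
    only \<open>E\<close> has to be computed.\<close>
  ultimately have "(\<lambda>h. fst (D h)) = (\<lambda>h. fst h + (entry ?w *\<^sub>R (snd h - N h) + E h *\<^sub>R (snd ?w - ?n ?w)))"
    by (intro has_derivative_unique[where x = ?w and f = "\<lambda>z. fst (scatter z)"]) simp_all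
  from fun_cong[OF this] have fstD: "fst (D h) = fst h + E h *\<^sub>R (v - reflection y v)" for h
    by (simp add: e0)
  have E_eq: "E h = - (G y \<bullet> fst h) / (G y \<bullet> v)" for h
  proof -
    let ?f = "\<lambda>z. G (fst z + entry z *\<^sub>R snd z) \<bullet> (fst z + entry z *\<^sub>R snd z)"
    have Y: "((\<lambda>z. fst z + entry z *\<^sub>R snd z) has_derivative
        (\<lambda>h. fst h + (entry ?w *\<^sub>R snd h + E h *\<^sub>R snd ?w))) (at ?w)"
      by (intro has_derivative_add has_derivative_scaleR E
          has_derivative_fst has_derivative_snd has_derivative_ident)
    have "(?f has_derivative (\<lambda>h. G (fst ?w + entry ?w *\<^sub>R snd ?w) \<bullet> (fst h + (entry ?w *\<^sub>R snd h + E h *\<^sub>R snd ?w))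
        + G (fst h + (entry ?w *\<^sub>R snd h + E h *\<^sub>R snd ?w)) \<bullet> (fst ?w + entry ?w *\<^sub>R snd ?w))) (at ?w)"
      by (intro has_derivative_inner Y bounded_linear.has_derivative[OF bounded_linear_G])
    \<comment> \<open>The form at the entry point equals \<open>s\<close> throughout
      \<open>hits\<close>; differentiating this identity determines \<open>E\<close>.\<close>
    moreover have "(?f has_derivative (\<lambda>h. 0)) (at ?w)"
    proof (rule has_derivative_transform_within_open[OF has_derivative_const open_hits w])
      show "s = ?f z" if "z \<in> hits" for z
        using form_entry[of "fst z" "snd z"] that by simp
    qed
    ultimately have "(\<lambda>h. G (fst ?w + entry ?w *\<^sub>R snd ?w) \<bullet> (fst h + (entry ?w *\<^sub>R snd h + E h *\<^sub>R snd ?w))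
        + G (fst h + (entry ?w *\<^sub>R snd h + E h *\<^sub>R snd ?w)) \<bullet> (fst ?w + entry ?w *\<^sub>R snd ?w)) = (\<lambda>h. 0)"
      by (rule has_derivative_unique)
    from fun_cong[OF this, of h] have "G y \<bullet> (fst h + E h *\<^sub>R v) + G (fst h + E h *\<^sub>R v) \<bullet> y = 0"
      by (simp add: e0)
    then have "G y \<bullet> (fst h + E h *\<^sub>R v) = 0"
      using sym'[of "fst h + E h *\<^sub>R v" y] by simp
    then show ?thesis
      using B by (simp add: inner_add_right field_simps)
  qed
  \<comment> \<open>\<open>v - reflection y v\<close> is
    \<open>2 (G y \<bullet> v) / (G y \<bullet> G y)\<close> times \<open>G y\<close>. The factor
    \<open>G y \<bullet> v\<close> cancels against the denominator in \<open>E_eq\<close>, and what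
    is left is the reflection of \<open>x\<close>.\<close>
  have fst_D: "fst (D (x, u)) = reflection y x" for x u
    using B by (simp add: fstD E_eq reflection_def)
  \<comment> \<open>With the position kept on the obstacle, the entry time is 0 for all nearby
    velocities, so \<open>scatter\<close> just reflects the velocity, linearly.\<close>
  have snd_D: "snd (D (0, u)) = reflection y u" for u
  proof -
    have "((\<lambda>r. scatter (y, v + r *\<^sub>R u)) has_derivative (\<lambda>r. D (0, r *\<^sub>R u))) (at (0::real))"
      by (rule has_derivative_compose[of "\<lambda>r. (y, v + r *\<^sub>R u)" "\<lambda>r. (0, r *\<^sub>R u)" 0 UNIV scatter])
        (auto intro!: derivative_eq_intros simp: D)
    moreover have "((\<lambda>r. scatter (y, v + r *\<^sub>R u)) has_derivative (\<lambda>r. (0, r *\<^sub>R reflection y u))) (at (0::real))"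
    proof (rule has_derivative_transform_within_open[where f = "\<lambda>r. (y, reflection y v + r *\<^sub>R reflection y u)"])
      show "((\<lambda>r. (y, reflection y v + r *\<^sub>R reflection y u)) has_derivative (\<lambda>r. (0, r *\<^sub>R reflection y u))) (at (0::real))"
        by (auto intro!: derivative_eq_intros)
      show "open {r. G y \<bullet> (v + r *\<^sub>R u) < 0}"
        by (intro open_Collect_less continuous_intros)
      show "(y, reflection y v + r *\<^sub>R reflection y u) = scatter (y, v + r *\<^sub>R u)"
        if "r \<in> {r. G y \<bullet> (v + r *\<^sub>R u) < 0}" for r
        using crossing(2)[of y 0 "v + r *\<^sub>R u"] that q linear_add[OF linear_reflection]
          linear_cmul[OF linear_reflection]
        by (simp add: scatter_def)
    qed (use B in auto)
    ultimately have "(\<lambda>r. D (0, r *\<^sub>R u)) = (\<lambda>r. (0, r *\<^sub>R reflection y u))"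
      by (rule has_derivative_unique)
    from fun_cong[OF this, of 1] show ?thesis by simp
  qed
  have "volume_preserving D"
    using triangular_volume_preserving[OF has_derivative_linear[OF D] reflection_volume_preserving[of y]
        reflection_volume_preserving[of y]] fst_D snd_D by simp
  then show ?thesis using D by blast
qed

lemma smooth_vp_scatter: "smooth_vp hits scatter"
  unfolding smooth_vp_def
proof (intro conjI ballI open_hits smooth_scatter)
  fix z assume z: "z \<in> hits"
  obtain x v where xv: "z = (x, v)" by (cases z)
  define t where "t = entry z"
  let ?\<phi> = "\<lambda>t (z :: 'a \<times> 'a). (fst z + t *\<^sub>R snd z, snd z)"
  let ?y = "x + t *\<^sub>R v"
  have "G ?y \<bullet> ?y = s" "G ?y \<bullet> v < 0"
    using z form_entry polar_entry unfolding xv t_def by auto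
  then obtain D where D: "(scatter has_derivative D) (at (?\<phi> t z))" "volume_preserving D"
    using scatter_derivative_boundary unfolding xv by fastforce
  have lin: "(?\<phi> t has_derivative ?\<phi> t) (at z)" for t z
    by (auto intro!: derivative_eq_intros)
  have "((\<lambda>z. scatter (?\<phi> t z)) has_derivative (\<lambda>h. D (?\<phi> t h))) (at z)"
    using has_derivative_compose[OF lin, where g = scatter] D(1) by blast
  from has_derivative_compose[OF this lin[of "- t"]]
  have "((\<lambda>z. ?\<phi> (- t) (scatter (?\<phi> t z))) has_derivative (\<lambda>h. ?\<phi> (- t) (D (?\<phi> t h)))) (at z)" .
  then have "(scatter has_derivative (\<lambda>h. ?\<phi> (- t) (D (?\<phi> t h)))) (at z)"
  proof (rule has_derivative_transform_within_open[OF _ open_hits z])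
    show "?\<phi> (- t) (scatter (?\<phi> t z)) = scatter z" if "z \<in> hits" for z
      using scatter_flow[of "fst z" "snd z" t] that by simp
  qed
  moreover have "volume_preserving (\<lambda>h. ?\<phi> (- t) (D (?\<phi> t h)))"
    by (rule volume_preserving_compose[OF volume_preserving_shear
          volume_preserving_compose[OF D(2) volume_preserving_shear]])
  ultimately show "\<exists>D. (scatter has_derivative D) (at z) \<and> volume_preserving D"
    by blast
qed

end

section \<open>Collisions as reflections at obstacles\<close>

text \<open>Half the gradient of the quadratic form \<open>triple_dist2 p\<close>.\<close>

definition gradient :: "'m \<times> 'm \<times> 'm \<Rightarrow> (real ^ 'd::finite) ^ 'm::finite \<Rightarrow> (real ^ 'd) ^ 'm" where
  "gradient = (\<lambda>(i, j, k) x.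
     axis i ((x $ i - x $ j) + (x $ i - x $ k)) + axis j (x $ j - x $ i) + axis k (x $ k - x $ i))"

lemma inner_axis_left: "axis i u \<bullet> (y :: ('a::real_inner) ^ 'm::finite) = u \<bullet> y $ i"
  by (simp add: inner_commute[of "axis i u"] inner_axis inner_commute)

lemma inner_gradient:
  "gradient (i, j, k) x \<bullet> y = (x $ i - x $ j) \<bullet> (y $ i - y $ j) + (x $ i - x $ k) \<bullet> (y $ i - y $ k)"
  by (simp only: gradient_def prod.case inner_add_left inner_axis_left inner_diff_left inner_diff_right)

lemma obstacle_gradient:
  assumes "0 < s"
  shows "obstacle (gradient p :: (real ^ 'd::finite) ^ 'm::finite \<Rightarrow> _) s"
proof (rule obstacle.intro)
  obtain i j k where p: "p = (i, j, k)" by (cases p)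
  show "linear (gradient p :: (real ^ 'd) ^ 'm \<Rightarrow> _)"
    unfolding p by (rule linearI) (simp_all add: vec_eq_iff gradient_def axis_def algebra_simps)
  show "gradient p x \<bullet> y = x \<bullet> gradient p y" for x y :: "(real ^ 'd) ^ 'm"
    unfolding p inner_commute[of x] inner_gradient by (simp add: inner_commute)
  show "0 \<le> gradient p x \<bullet> x" for x :: "(real ^ 'd) ^ 'm"
    unfolding p inner_gradient by simp
qed fact

text \<open>\<open>phase_type\<close> carries the dimension and the particle labels, so that
  \<open>form\<close>, \<open>rate\<close> and the notions built on them have fixed types inside the
  locale.\<close>

locale interaction =
  fixes \<sigma> :: real and phase_type :: "('d::finite, 'm::{finite,linorder}) phase itself"
  assumes sigma_pos: "0 < \<sigma>"
begin

abbreviation s :: real where "s \<equiv> 2 * \<sigma>\<^sup>2"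

sublocale obs: obstacle "gradient p :: ((real, 'd) vec, 'm) vec \<Rightarrow> ((real, 'd) vec, 'm) vec" s for p
  by (rule obstacle_gradient) (use sigma_pos in simp)

definition form :: "'m \<times> 'm \<times> 'm \<Rightarrow> ('d, 'm) phase \<Rightarrow> real" where
  "form p z = gradient p (fst z) \<bullet> fst z"

text \<open>Half the time derivative of \<open>form p\<close> along free motion. At a simple
  collision it has the sign of \<open>impact_rate\<close>, but it is a polynomial defined on all
  states.\<close>

definition rate :: "'m \<times> 'm \<times> 'm \<Rightarrow> ('d, 'm) phase \<Rightarrow> real" where
  "rate p z = gradient p (fst z) \<bullet> snd z"

definition reflect :: "'m \<times> 'm \<times> 'm \<Rightarrow> ('d, 'm) phase \<Rightarrow> ('d, 'm) phase" where
  "reflect p z = (fst z, obs.reflection p (fst z) (snd z))"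

text \<open>Membership in the phase space is not asked for. The set is thereby closed and given by
  polynomial equations, and free motions that meet it can be studied without regard to the other
  obstacles.\<close>

definition singular :: "('d, 'm) phase set" where
  "singular = {z. (\<exists>p\<in>triples. \<exists>p'\<in>triples. p \<noteq> p' \<and> form p z = s \<and> form p' z = s) \<or>
     (\<exists>p\<in>triples. form p z = s \<and> rate p z = 0)}"

lemma form_triple_dist2: "triple_dist2 p z = form p z"
  by (cases p) (simp add: triple_dist2_def form_def inner_gradient power2_norm_eq_inner)

lemma phase_space_iff: "z \<in> phase_space \<sigma> \<longleftrightarrow> (\<forall>p\<in>triples. s \<le> form p z)"
  and phase_interior_iff: "z \<in> phase_interior \<sigma> \<longleftrightarrow> (\<forall>p\<in>triples. s < form p z)"
  by (simp_all add: phase_space_def phase_interior_def form_triple_dist2)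

lemma collision_surface_iff: "z \<in> collision_surface \<sigma> p \<longleftrightarrow> z \<in> phase_space \<sigma> \<and> form p z = s"
  by (simp add: collision_surface_def form_triple_dist2)

lemma simple_collisions_iff:
  "z \<in> simple_collisions \<sigma> \<longleftrightarrow> z \<in> phase_space \<sigma> \<and> (\<exists>!p. p \<in> triples \<and> form p z = s)"
  unfolding simple_collisions_def phase_boundary_def by (auto simp: collision_surface_iff)

lemma colliding_triple_eq:
  assumes "z \<in> simple_collisions \<sigma>" "p \<in> triples" "form p z = s"
  shows "colliding_triple \<sigma> z = p"
  using assms unfolding colliding_triple_def simple_collisions_iff collision_surface_iff
  by (intro the_equality) auto

lemma impact_rate_eq:
  assumes "z \<in> simple_collisions \<sigma>" "p \<in> triples" "form p z = s"
  shows "impact_rate \<sigma> z = rate p z / (sqrt 2 * \<sigma>)"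
proof -
  obtain i j k where p: "p = (i, j, k)" by (cases p)
  have r: "rate p z = (fst z $ j - fst z $ i) \<bullet> (snd z $ j - snd z $ i) + (fst z $ k - fst z $ i) \<bullet> (snd z $ k - snd z $ i)"
    by (simp add: p rate_def inner_gradient inner_diff_left inner_diff_right)
  show ?thesis
    unfolding r using colliding_triple_eq[OF assms]
    by (simp add: impact_rate_def impact_direction1_def impact_direction2_def p add_divide_distrib)
qed

lemma impact_rate_sign:
  assumes "z \<in> simple_collisions \<sigma>" "p \<in> triples" "form p z = s"
  shows "impact_rate \<sigma> z < 0 \<longleftrightarrow> rate p z < 0" "impact_rate \<sigma> z > 0 \<longleftrightarrow> rate p z > 0"
    "impact_rate \<sigma> z = 0 \<longleftrightarrow> rate p z = 0"
  using sigma_pos unfolding impact_rate_eq[OF assms]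
  by (auto simp: divide_less_0_iff zero_less_divide_iff zero_less_mult_iff mult_less_0_iff)

text \<open>With \<open>a\<close> and \<open>b\<close> the positions of \<open>j\<close> and
  \<open>k\<close> relative to \<open>i\<close>, the gradient has components
  \<open>-(a + b)\<close>, \<open>a\<close>, \<open>b\<close>, which up to a common factor are the
  prescribed velocity changes. Only the scalar has to be matched: on the obstacle
  \<open>a \<bullet> a + b \<bullet> b = s\<close>, so the squared length of the gradient is
  \<open>2 s + 2 (a \<bullet> b)\<close>, that is, \<open>2 s\<close> times the denominator
  \<open>1 + \<omega>1 \<bullet> \<omega>2\<close> of the collision law.\<close>

lemma star_eq:
  assumes "z \<in> simple_collisions \<sigma>" "p \<in> triples" "form p z = s"
  shows "star \<sigma> z = reflect p z"
proof -
  obtain i j k where p: "p = (i, j, k)" by (cases p)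
  have ij: "i \<noteq> j" "i \<noteq> k" "j \<noteq> k"
    using assms(2) by (auto simp: p triples_def)
  define a where "a = fst z $ j - fst z $ i"
  define b where "b = fst z $ k - fst z $ i"
  define r where "r = 1 / (sqrt 2 * \<sigma>)"
  have r2: "r * r = 1 / s"
    by (simp add: r_def power2_eq_square)
  have ct: "colliding_triple \<sigma> z = (i, j, k)"
    using colliding_triple_eq[OF assms] p by simp
  have w: "impact_direction1 \<sigma> z = r *\<^sub>R a" "impact_direction2 \<sigma> z = r *\<^sub>R b"
    by (simp_all add: impact_direction1_def impact_direction2_def ct a_def b_def r_def)
  have ab: "a \<bullet> a + b \<bullet> b = s"
  proof -
    have "form p z = (- a) \<bullet> (- a) + (- b) \<bullet> (- b)"
      by (simp only: p form_def inner_gradient a_def b_def minus_diff_eq)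
    then show ?thesis using assms(3) by simp
  qed
  let ?g = "gradient p (fst z)"
  have g: "?g $ i = - (a + b)" "?g $ j = a" "?g $ k = b" "\<And>l. l \<noteq> i \<Longrightarrow> l \<noteq> j \<Longrightarrow> l \<noteq> k \<Longrightarrow> ?g $ l = 0"
    using ij by (simp_all add: p gradient_def axis_def a_def b_def)
  have "?g \<bullet> ?g = (fst z $ i - fst z $ j) \<bullet> (?g $ i - ?g $ j) + (fst z $ i - fst z $ k) \<bullet> (?g $ i - ?g $ k)"
    by (subst (1) p) (rule inner_gradient)
  also have "\<dots> = (- a) \<bullet> (- (a + b) - a) + (- b) \<bullet> (- (a + b) - b)"
    unfolding g by (simp add: a_def b_def)
  also have "\<dots> = 2 * s + 2 * (a \<bullet> b)"
    unfolding ab[symmetric]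
    by (simp only: inner_minus_left inner_minus_right inner_diff_right inner_add_right inner_commute[of b a])
      (simp only: algebra_simps)
  finally have gg: "?g \<bullet> ?g = 2 * s + 2 * (a \<bullet> b)" .
  have s0: "s > 0"
    by (rule obs.s_pos)
  have rate: "rate p z = a \<bullet> (snd z $ j - snd z $ i) + b \<bullet> (snd z $ k - snd z $ i)"
    by (simp add: p rate_def inner_gradient a_def b_def inner_diff_left inner_diff_right)
  define c where "c = (r *\<^sub>R a \<bullet> (snd z $ j - snd z $ i) + r *\<^sub>R b \<bullet> (snd z $ k - snd z $ i)) / (1 + r *\<^sub>R a \<bullet> r *\<^sub>R b)"
  have "c * r = rate p z * (r * r) / (1 + (r * r) * (a \<bullet> b))"
    by (simp add: c_def rate algebra_simps)
  also have "\<dots> = 2 * rate p z / (?g \<bullet> ?g)"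
  proof -
    have "1 + 1 / s * (a \<bullet> b) = (s + a \<bullet> b) / s"
      using s0 by (simp add: add_divide_distrib del: divide_divide_eq_left)
    then have "rate p z * (r * r) / (1 + (r * r) * (a \<bullet> b)) = rate p z * (1 / s) / ((s + a \<bullet> b) / s)"
      unfolding r2 by simp
    also have "\<dots> = rate p z / (s + a \<bullet> b)"
      using s0 by simp
    also have "\<dots> = 2 * rate p z / (?g \<bullet> ?g)"
      unfolding gg by (metis (no_types, opaque_lifting) distrib_left mult_divide_mult_cancel_left_if zero_neq_numeral)
    finally show ?thesis .
  qed
  finally have cr: "2 * rate p z / (?g \<bullet> ?g) = c * r" ..
  have "star \<sigma> z = (fst z, \<chi> l. if l = i then snd z $ i + c *\<^sub>R (r *\<^sub>R a + r *\<^sub>R b) else if l = j then snd z $ j - c *\<^sub>R r *\<^sub>R a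
      else if l = k then snd z $ k - c *\<^sub>R r *\<^sub>R b else snd z $ l)"
    unfolding star_def ct prod.case w collision_map_def Let_def c_def ..
  also have "\<dots> = (fst z, snd z - (c * r) *\<^sub>R ?g)"
  proof -
    have "(if l = i then snd z $ i + c *\<^sub>R (r *\<^sub>R a + r *\<^sub>R b) else if l = j then snd z $ j - c *\<^sub>R r *\<^sub>R a
        else if l = k then snd z $ k - c *\<^sub>R r *\<^sub>R b else snd z $ l) = snd z $ l - (c * r) *\<^sub>R ?g $ l" for l
      using ij by (auto simp: g scaleR_right_distrib scaleR_right_diff_distrib)
    then show ?thesis
      by (simp add: vec_eq_iff)
  qed
  also have "\<dots> = reflect p z"
    using cr by (simp add: reflect_def obs.reflection_def rate_def)
  finally show ?thesis .
qed

lemma nongrazing_collisions_iff: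
  "z \<in> nongrazing_collisions \<sigma> \<longleftrightarrow> z \<in> phase_space \<sigma> \<and> z \<notin> phase_interior \<sigma> \<and> z \<notin> singular"
proof -
  have "z \<in> nongrazing_collisions \<sigma> \<longleftrightarrow> z \<in> simple_collisions \<sigma> \<and> impact_rate \<sigma> z \<noteq> 0"
    by (auto simp: nongrazing_collisions_def grazing_def)
  also have "\<dots> \<longleftrightarrow> z \<in> simple_collisions \<sigma> \<and> (\<forall>p\<in>triples. form p z = s \<longrightarrow> rate p z \<noteq> 0)"
    using impact_rate_sign(3)[of z] unfolding simple_collisions_iff by blast
  also have "\<dots> \<longleftrightarrow> z \<in> phase_space \<sigma> \<and> z \<notin> phase_interior \<sigma> \<and> z \<notin> singular"
  proof -
    have "z \<in> phase_interior \<sigma> \<longleftrightarrow> \<not> (\<exists>p\<in>triples. form p z = s)" if "z \<in> phase_space \<sigma>"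
      using that unfolding phase_space_iff phase_interior_iff by (force simp: order_le_less)
    moreover have "(\<exists>!p. p \<in> triples \<and> form p z = s) \<longleftrightarrow> (\<exists>p\<in>triples. form p z = s) \<and>
        \<not> (\<exists>p\<in>triples. \<exists>p'\<in>triples. p \<noteq> p' \<and> form p z = s \<and> form p' z = s)"
      by (auto simp del: split_paired_All split_paired_Ex)
    ultimately show ?thesis
      unfolding simple_collisions_iff singular_def
      by (auto simp del: split_paired_All split_paired_Ex)
  qed
  finally show ?thesis .
qed

text \<open>Describes the refined phase space by two closed sets, the phase space and the removed
  set \<open>singular\<close>; the later arguments work with this form.\<close>

lemma refined_iff: "z \<in> refined_phase_space \<sigma> \<longleftrightarrow> z \<in> phase_space \<sigma> \<and> z \<notin> singular"
  unfolding refined_phase_space_def Un_iff nongrazing_collisions_iff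
  by (auto simp: phase_space_iff phase_interior_iff singular_def)

lemma interior_refined:
  fixes z :: "('d, 'm) phase"
  shows "z \<in> phase_interior \<sigma> \<Longrightarrow> z \<in> refined_phase_space \<sigma>"
  by (simp add: refined_phase_space_def)

lemma refined_phase_space:
  fixes z :: "('d, 'm) phase"
  shows "z \<in> refined_phase_space \<sigma> \<Longrightarrow> z \<in> phase_space \<sigma>"
  by (simp add: refined_iff)

lemma refined_unique:
  assumes "z \<in> refined_phase_space \<sigma>" "p \<in> triples" "form p z = s" "p' \<in> triples" "form p' z = s"
  shows "p' = p"
  using assms unfolding refined_iff singular_def by auto

lemma refined_simple:
  assumes "z \<in> refined_phase_space \<sigma>" "p \<in> triples" "form p z = s"
  shows "z \<in> simple_collisions \<sigma>"
  unfolding simple_collisions_iff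
proof (intro conjI ex1I[of _ p])
  show "p' = p" if "p' \<in> triples \<and> form p' z = s" for p'
    using refined_unique assms that by blast
qed (use assms refined_phase_space in auto)

lemma refined_cases:
  fixes z :: "('d, 'm) phase"
  assumes "z \<in> refined_phase_space \<sigma>"
  obtains "z \<in> phase_interior \<sigma>"
  | p where "p \<in> triples" "form p z = s" "rate p z \<noteq> 0" "z \<in> simple_collisions \<sigma>"
      "\<And>p'. p' \<in> triples \<Longrightarrow> p' \<noteq> p \<Longrightarrow> form p' z > s"
proof (cases "z \<in> phase_interior \<sigma>")
  case False
  then obtain p where p: "p \<in> triples" "form p z = s"
    using assms by (auto simp: refined_iff phase_space_iff phase_interior_iff not_less intro: antisym)
  moreover have "form p' z > s" if "p' \<in> triples" "p' \<noteq> p" for p'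
    using assms p that by (force simp: refined_iff phase_space_iff singular_def order_le_less)
  moreover have "rate p z \<noteq> 0"
    using assms p by (auto simp: refined_iff singular_def)
  moreover have "z \<in> simple_collisions \<sigma>"
    using refined_simple assms p by blast
  ultimately show ?thesis using that(2) by blast
qed (rule that(1))

lemma pre_collisional_iff:
  fixes z :: "('d, 'm) phase"
  assumes "z \<in> refined_phase_space \<sigma>"
  shows "pre_collisional \<sigma> z \<longleftrightarrow> (\<exists>p\<in>triples. form p z = s \<and> rate p z < 0)"
    "post_collisional \<sigma> z \<longleftrightarrow> (\<exists>p\<in>triples. form p z = s \<and> rate p z > 0)"
proof -
  have 1: "z \<in> simple_collisions \<sigma>" if "p \<in> triples" "form p z = s" for p
    using refined_simple assms that by blast
  have 2: "\<exists>p\<in>triples. form p z = s" if "z \<in> simple_collisions \<sigma>"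
    using that ex1_implies_ex unfolding simple_collisions_iff by fast
  show "pre_collisional \<sigma> z \<longleftrightarrow> (\<exists>p\<in>triples. form p z = s \<and> rate p z < 0)"
    using 1 2 impact_rate_sign(1)[of z] unfolding pre_collisional_def by blast
  show "post_collisional \<sigma> z \<longleftrightarrow> (\<exists>p\<in>triples. form p z = s \<and> rate p z > 0)"
    using 1 2 impact_rate_sign(2)[of z] unfolding post_collisional_def by blast
qed

lemma collisional_rate:
  assumes "z \<in> refined_phase_space \<sigma>" "p \<in> triples" "form p z = s"
  shows "pre_collisional \<sigma> z \<longleftrightarrow> rate p z < 0" "post_collisional \<sigma> z \<longleftrightarrow> rate p z > 0"
  using refined_simple[OF assms] impact_rate_sign[OF refined_simple[OF assms] assms(2,3)]
  by (simp_all add: pre_collisional_def post_collisional_def)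

lemma pre_refined:
  fixes z :: "('d, 'm) phase"
  shows "pre_collisional \<sigma> z \<Longrightarrow> z \<in> refined_phase_space \<sigma>"
  by (auto simp: pre_collisional_def refined_phase_space_def nongrazing_collisions_def grazing_def)

lemma interior_not_collisional:
  fixes z :: "('d, 'm) phase"
  assumes "z \<in> phase_interior \<sigma>"
  shows "\<not> pre_collisional \<sigma> z" "\<not> post_collisional \<sigma> z"
  using pre_collisional_iff[OF interior_refined[OF assms]] assms by (auto simp: phase_interior_iff)

lemma outgoing_interior:
  fixes z :: "('d, 'm) phase"
  shows "z \<in> phase_interior \<sigma> \<Longrightarrow> outgoing \<sigma> z = z"
  and incoming_interior: "z \<in> phase_interior \<sigma> \<Longrightarrow> incoming \<sigma> z = z"
  by (simp_all add: outgoing_def incoming_def interior_not_collisional)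

lemma outgoing_eq:
  assumes "z \<in> refined_phase_space \<sigma>" "p \<in> triples" "form p z = s"
  shows "outgoing \<sigma> z = (if rate p z < 0 then reflect p z else z)"
    "incoming \<sigma> z = (if rate p z > 0 then reflect p z else z)"
    "star \<sigma> z = reflect p z"
proof -
  have z: "z \<in> simple_collisions \<sigma>"
    by (rule refined_simple[OF assms])
  show "outgoing \<sigma> z = (if rate p z < 0 then reflect p z else z)"
    "incoming \<sigma> z = (if rate p z > 0 then reflect p z else z)"
    "star \<sigma> z = reflect p z"
    using impact_rate_sign[OF z assms(2,3)] star_eq[OF z assms(2,3)] z
    by (auto simp: outgoing_def incoming_def pre_collisional_def post_collisional_def)
qed

lemma form_reflect [simp]: "form p' (reflect p z) = form p' z"
  and rate_reflect [simp]: "rate p (reflect p z) = - rate p z"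
  and reflect_reflect [simp]: "reflect p (reflect p z) = z"
  by (simp_all add: form_def rate_def reflect_def obs.polar_reflection obs.reflection_reflection)

lemma phase_space_reflect [simp]: "reflect p z \<in> phase_space \<sigma> \<longleftrightarrow> z \<in> phase_space \<sigma>"
  by (simp add: phase_space_iff)

lemma singularI:
  "p \<in> triples \<Longrightarrow> p' \<in> triples \<Longrightarrow> p \<noteq> p' \<Longrightarrow> form p z = s \<Longrightarrow> form p' z = s \<Longrightarrow> z \<in> singular"
  "p \<in> triples \<Longrightarrow> form p z = s \<Longrightarrow> rate p z = 0 \<Longrightarrow> z \<in> singular"
  unfolding singular_def mem_Collect_eq
  by (rule disjI1, intro bexI[of _ p] bexI[of _ p'] conjI; assumption)
    (rule disjI2, intro bexI[of _ p] conjI; assumption)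

lemma singularE:
  assumes "z \<in> singular"
  obtains p p' where "p \<in> triples" "p' \<in> triples" "p \<noteq> p'" "form p z = s" "form p' z = s"
  | p where "p \<in> triples" "form p z = s" "rate p z = 0"
proof -
  have "(\<exists>p\<in>triples. \<exists>p'\<in>triples. p \<noteq> p' \<and> form p z = s \<and> form p' z = s) \<or>
     (\<exists>p\<in>triples. form p z = s \<and> rate p z = 0)"
    using assms by (simp only: singular_def mem_Collect_eq)
  then show thesis
  proof (elim disjE bexE conjE)
    fix p p'
    assume "p \<in> triples" "p' \<in> triples" "p \<noteq> p'" "form p z = s" "form p' z = s"
    then show thesis by (rule that(1))
  next
    fix p
    assume "p \<in> triples" "form p z = s" "rate p z = 0"
    then show thesis by (rule that(2))
  qed
qed

lemma refined_rate:
  assumes "z \<in> refined_phase_space \<sigma>" "p \<in> triples" "form p z = s"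
  shows "rate p z \<noteq> 0"
  using assms by (auto simp only: refined_iff singular_def mem_Collect_eq)

lemma refined_reflect:
  assumes "z \<in> refined_phase_space \<sigma>" "p \<in> triples" "form p z = s"
  shows "reflect p z \<in> refined_phase_space \<sigma>"
proof -
  have "reflect p z \<notin> singular"
  proof
    assume "reflect p z \<in> singular"
    then show False
    proof (cases rule: singularE)
      case (1 p1 p2)
      then show False
        using refined_unique[OF assms, of p1] refined_unique[OF assms, of p2] by simp
    next
      case (2 p1)
      then show False
        using refined_unique[OF assms, of p1] refined_rate[OF assms] by simp
    qed
  qed
  then show ?thesis
    using assms(1) by (simp add: refined_iff)
qed

lemma star_properties:
  fixes z :: "('d, 'm) phase"
  assumes "z \<in> nongrazing_collisions \<sigma>"
  shows "star \<sigma> z \<in> nongrazing_collisions \<sigma>" "star \<sigma> (star \<sigma> z) = z"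
    "outgoing \<sigma> (star \<sigma> z) = outgoing \<sigma> z" "incoming \<sigma> (star \<sigma> z) = incoming \<sigma> z"
proof -
  have z: "z \<in> refined_phase_space \<sigma>" "z \<notin> phase_interior \<sigma>"
    using assms by (auto simp: refined_phase_space_def nongrazing_collisions_iff)
  then obtain p where p: "p \<in> triples" "form p z = s" "rate p z \<noteq> 0"
    using refined_cases by blast
  note r = refined_reflect[OF z(1) p(1,2)]
  have eq: "star \<sigma> z = reflect p z"
    by (rule outgoing_eq(3)[OF z(1) p(1,2)])
  show "star \<sigma> z \<in> nongrazing_collisions \<sigma>"
    unfolding eq using r z(2) by (simp add: nongrazing_collisions_iff refined_iff phase_interior_iff)
  show "star \<sigma> (star \<sigma> z) = z" "outgoing \<sigma> (star \<sigma> z) = outgoing \<sigma> z" "incoming \<sigma> (star \<sigma> z) = incoming \<sigma> z"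
    unfolding eq using p by (simp_all add: outgoing_eq[OF r p(1)] outgoing_eq[OF z(1) p(1)])
qed

text \<open>\<open>incoming\<close> and \<open>outgoing\<close> pick the two representatives of one
  collision, so each is idempotent and is not affected by applying the other first.\<close>

lemma outgoing_refined:
  fixes z :: "('d, 'm) phase"
  assumes "z \<in> refined_phase_space \<sigma>"
  shows "outgoing \<sigma> z \<in> refined_phase_space \<sigma>" "\<not> pre_collisional \<sigma> (outgoing \<sigma> z)"
    "outgoing \<sigma> (outgoing \<sigma> z) = outgoing \<sigma> z" "outgoing \<sigma> (incoming \<sigma> z) = outgoing \<sigma> z"
    "incoming \<sigma> (outgoing \<sigma> z) = incoming \<sigma> z" "incoming \<sigma> z \<in> refined_phase_space \<sigma>"
    "\<not> post_collisional \<sigma> (incoming \<sigma> z)" "incoming \<sigma> (incoming \<sigma> z) = incoming \<sigma> z"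
proof -
  have *: "outgoing \<sigma> z \<in> refined_phase_space \<sigma> \<and> \<not> pre_collisional \<sigma> (outgoing \<sigma> z) \<and>
    outgoing \<sigma> (outgoing \<sigma> z) = outgoing \<sigma> z \<and> outgoing \<sigma> (incoming \<sigma> z) = outgoing \<sigma> z \<and>
    incoming \<sigma> (outgoing \<sigma> z) = incoming \<sigma> z \<and> incoming \<sigma> z \<in> refined_phase_space \<sigma> \<and>
    \<not> post_collisional \<sigma> (incoming \<sigma> z) \<and> incoming \<sigma> (incoming \<sigma> z) = incoming \<sigma> z"
    using assms
  proof (cases rule: refined_cases)
    case 1
    then show ?thesis
      using assms by (simp add: outgoing_interior incoming_interior interior_not_collisional)
  next
    case (2 p)
    note r = refined_reflect[OF assms 2(1,2)]
    from 2(3) show ?thesis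
      using assms r 2(2) outgoing_eq[OF assms 2(1,2)] outgoing_eq[OF r 2(1)]
        collisional_rate[OF assms 2(1,2)] collisional_rate[OF r 2(1)]
      by (cases "rate p z < 0") simp_all
  qed
  then show "outgoing \<sigma> z \<in> refined_phase_space \<sigma>" "\<not> pre_collisional \<sigma> (outgoing \<sigma> z)"
    "outgoing \<sigma> (outgoing \<sigma> z) = outgoing \<sigma> z" "outgoing \<sigma> (incoming \<sigma> z) = outgoing \<sigma> z"
    "incoming \<sigma> (outgoing \<sigma> z) = incoming \<sigma> z" "incoming \<sigma> z \<in> refined_phase_space \<sigma>"
    "\<not> post_collisional \<sigma> (incoming \<sigma> z)" "incoming \<sigma> (incoming \<sigma> z) = incoming \<sigma> z"
    by blast+
qed

lemma outgoing_not_pre: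
  fixes z :: "('d, 'm) phase"
  shows "\<not> pre_collisional \<sigma> z \<Longrightarrow> outgoing \<sigma> z = z"
  by (simp add: outgoing_def)

lemma incoming_not_post:
  fixes z :: "('d, 'm) phase"
  shows "\<not> post_collisional \<sigma> z \<Longrightarrow> incoming \<sigma> z = z"
  by (simp add: incoming_def)

lemma norm_outgoing:
  fixes z :: "('d, 'm) phase"
  assumes "z \<in> refined_phase_space \<sigma>"
  shows "norm (snd (outgoing \<sigma> z)) = norm (snd z)" "norm (snd (incoming \<sigma> z)) = norm (snd z)"
    "fst (outgoing \<sigma> z) = fst z" "fst (incoming \<sigma> z) = fst z"
proof -
  have "norm (snd (outgoing \<sigma> z)) = norm (snd z) \<and> norm (snd (incoming \<sigma> z)) = norm (snd z) \<and>
      fst (outgoing \<sigma> z) = fst z \<and> fst (incoming \<sigma> z) = fst z"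
    using assms
  proof (cases rule: refined_cases)
    case (2 p)
    then show ?thesis
      using outgoing_eq[OF assms 2(1,2)] by (simp add: reflect_def obs.norm_reflection)
  qed (simp add: outgoing_interior incoming_interior)
  then show "norm (snd (outgoing \<sigma> z)) = norm (snd z)" "norm (snd (incoming \<sigma> z)) = norm (snd z)"
    "fst (outgoing \<sigma> z) = fst z" "fst (incoming \<sigma> z) = fst z"
    by blast+
qed

section \<open>Time reversal and topology of the sets of states\<close>

definition reversal :: "('d, 'm) phase \<Rightarrow> ('d, 'm) phase" where
  "reversal z = (fst z, - snd z)"

lemma reversal_reversal [simp]: "reversal (reversal z) = z"
  by (simp add: reversal_def)

lemma form_reversal [simp]: "form p (reversal z) = form p z"
  and rate_reversal [simp]: "rate p (reversal z) = - rate p z"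
  by (simp_all add: form_def rate_def reversal_def)

lemma reversal_sets [simp]:
  "reversal z \<in> phase_space \<sigma> \<longleftrightarrow> z \<in> phase_space \<sigma>"
  "reversal z \<in> phase_interior \<sigma> \<longleftrightarrow> z \<in> phase_interior \<sigma>"
  "reversal z \<in> singular \<longleftrightarrow> z \<in> singular"
  "reversal z \<in> refined_phase_space \<sigma> \<longleftrightarrow> z \<in> refined_phase_space \<sigma>"
  by (simp_all add: phase_space_iff phase_interior_iff singular_def refined_iff)

lemma reversal_reflect: "reflect p (reversal z) = reversal (reflect p z)"
  using linear_neg[OF obs.linear_reflection] by (simp add: reversal_def reflect_def)

text \<open>Reversed velocities turn arrival into departure, so the two representatives of a
  collision are exchanged. Through this identity backward motion is reduced to forward
  motion.\<close>

lemma reversal_outgoing: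
  assumes "z \<in> refined_phase_space \<sigma>"
  shows "outgoing \<sigma> (reversal z) = reversal (incoming \<sigma> z)"
    "incoming \<sigma> (reversal z) = reversal (outgoing \<sigma> z)"
proof -
  have r: "reversal z \<in> refined_phase_space \<sigma>"
    using assms by simp
  have "outgoing \<sigma> (reversal z) = reversal (incoming \<sigma> z) \<and> incoming \<sigma> (reversal z) = reversal (outgoing \<sigma> z)"
    using assms
  proof (cases rule: refined_cases)
    case (2 p)
    then show ?thesis
      using outgoing_eq[OF assms 2(1,2)] outgoing_eq[OF r 2(1)] by (simp add: reversal_reflect)
  qed (simp add: outgoing_interior incoming_interior)
  then show "outgoing \<sigma> (reversal z) = reversal (incoming \<sigma> z)"
    "incoming \<sigma> (reversal z) = reversal (outgoing \<sigma> z)"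
    by blast+
qed

lemma reversal_flow: "reversal (free_flow t z) = free_flow (- t) (reversal z)"
  by (simp add: reversal_def free_flow_def)

lemma free_flow_0 [simp]: "free_flow 0 z = z"
  and free_flow_free_flow [simp]: "free_flow t (free_flow u z) = free_flow (t + u) z"
  by (simp_all add: free_flow_def algebra_simps)

lemma smooth_vp_free_flow: "smooth_vp UNIV (free_flow t :: ('d, 'm) phase \<Rightarrow> _)"
  unfolding free_flow_def[abs_def] by (rule smooth_vp_linear[OF volume_preserving_shear])

lemma smooth_vp_reversal: "smooth_vp UNIV reversal"
  unfolding reversal_def[abs_def]
  by (rule smooth_vp_linear[OF isometry_volume_preserving])
    (auto intro!: linearI simp: norm_prod_def)

lemma continuous_form [continuous_intros]: "continuous_on A f \<Longrightarrow> continuous_on A (\<lambda>z. form p (f z))"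
  and continuous_rate [continuous_intros]: "continuous_on A f \<Longrightarrow> continuous_on A (\<lambda>z. rate p (f z))"
  unfolding form_def rate_def by (auto intro!: continuous_intros)

lemma continuous_free_flow [continuous_intros]:
  "continuous_on A f \<Longrightarrow> continuous_on A g \<Longrightarrow> continuous_on A (\<lambda>z. free_flow (f z) (g z :: ('d, 'm) phase))"
  unfolding free_flow_def by (intro continuous_intros)

lemma open_interior: "open (phase_interior \<sigma> :: ('d, 'm) phase set)"
proof -
  have "phase_interior \<sigma> = (\<Inter>p\<in>triples. {z :: ('d, 'm) phase. s < form p z})"
    by (auto simp: phase_interior_iff)
  then show ?thesis
    by (auto intro!: open_INT open_Collect_less continuous_intros)
qed

lemma closed_phase_space: "closed (phase_space \<sigma> :: ('d, 'm) phase set)"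
proof -
  have "phase_space \<sigma> = (\<Inter>p\<in>triples. {z :: ('d, 'm) phase. s \<le> form p z})"
    by (auto simp: phase_space_iff)
  then show ?thesis
    by (auto intro!: closed_Collect_le continuous_intros)
qed

lemma closed_singular: "closed singular"
proof -
  let ?A = "\<lambda>r. {z. form (fst r) z = s} \<inter> {z. form (snd r) z = s}"
  let ?B = "\<lambda>p. {z. form p z = s} \<inter> {z. rate p z = 0}"
  have "singular = (\<Union>r\<in>{r \<in> triples \<times> triples. fst r \<noteq> snd r}. ?A r) \<union> (\<Union>p\<in>triples. ?B p)" (is "_ = ?R")
  proof (intro equalityI subsetI)
    fix z assume "z \<in> singular"
    then show "z \<in> ?R"
    proof (cases rule: singularE)
      case (1 p p')
      then show ?thesis by (intro UnI1 UN_I[of "(p, p')"]) simp_all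
    next
      case (2 p)
      then show ?thesis by (intro UnI2 UN_I[of p]) simp_all
    qed
  next
    fix z assume "z \<in> ?R"
    then show "z \<in> singular"
    proof (elim UnE UN_E)
      fix r assume "r \<in> {r \<in> triples \<times> triples. fst r \<noteq> snd r}" "z \<in> ?A r"
      then show ?thesis
        by (intro singularI(1)[of "fst r" "snd r"]) (simp_all add: mem_Times_iff)
    next
      fix p assume "p \<in> triples" "z \<in> ?B p"
      then show ?thesis
        by (intro singularI(2)[of p]) simp_all
    qed
  qed
  also have "closed \<dots>"
    by (intro closed_Un closed_UN ballI closed_Int closed_Collect_eq continuous_intros) auto
  finally show ?thesis .
qed

end

section \<open>Trajectories on bounded time intervals\<close>

text \<open>Consider the infimum of the failing times: if it is positive, \<open>left\<close> gives
  the property there, and \<open>right\<close> then pushes past it. At time 0 the step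
  \<open>right\<close> has no earlier times to rely on and serves as the base case. Nothing is
  claimed at 0 itself, since a motion may start at a collision.\<close>

lemma real_induction [consumes 2, case_names right left]:
  fixes T :: real
  assumes t: "0 < t" "t \<le> T"
    and right: "\<And>t. 0 \<le> t \<Longrightarrow> t < T \<Longrightarrow> (\<And>u. 0 < u \<Longrightarrow> u \<le> t \<Longrightarrow> P u) \<Longrightarrow> \<forall>\<^sub>F u in at_right 0. P (t + u)"
    and left: "\<And>t. 0 < t \<Longrightarrow> t \<le> T \<Longrightarrow> (\<And>u. 0 < u \<Longrightarrow> u < t \<Longrightarrow> P u) \<Longrightarrow> P t"
  shows "P t"
proof (rule ccontr)
  assume "\<not> P t"
  define B where "B = {t. 0 < t \<and> t \<le> T \<and> \<not> P t}"
  define m where "m = Inf B"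
  have tB: "t \<in> B"
    using t \<open>\<not> P t\<close> by (simp add: B_def)
  have bdd: "bdd_below B"
    by (rule bdd_belowI[of _ 0]) (simp add: B_def)
  have m0: "0 \<le> m"
    unfolding m_def using tB by (intro cInf_greatest) (auto simp: B_def)
  have mt: "m \<le> t"
    unfolding m_def by (rule cInf_lower[OF tB bdd])
  have below: "P u" if "0 < u" "u < m" for u
  proof (rule ccontr)
    assume "\<not> P u"
    then have "u \<in> B"
      using that mt t by (simp add: B_def)
    then have "m \<le> u"
      unfolding m_def by (rule cInf_lower[OF _ bdd])
    then show False using that by simp
  qed
  have Pm: "P u" if "0 < u" "u \<le> m" for u
    using that below left[of m] mt t by (cases "u = m") auto
  have "m < T"
  proof (rule ccontr)
    assume "\<not> m < T"
    then have "m = t" using mt t by simp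
    then show False using Pm[of t] t \<open>\<not> P t\<close> by simp
  qed
  then have "\<forall>\<^sub>F u in at_right 0. P (m + u)"
    using right[OF m0 _ Pm] by simp
  then obtain e where e: "e > 0" "\<And>u. 0 < u \<Longrightarrow> u < e \<Longrightarrow> P (m + u)"
    unfolding eventually_at_right_field by auto
  have "m + e \<le> b" if "b \<in> B" for b
  proof (rule ccontr)
    assume "\<not> m + e \<le> b"
    moreover have "m \<le> b"
      unfolding m_def by (rule cInf_lower[OF that bdd])
    moreover have "m \<noteq> b"
      using Pm[of b] that by (auto simp: B_def)
    ultimately have "P (m + (b - m))"
      by (intro e) auto
    then show False using that by (simp add: B_def)
  qed
  then have "m + e \<le> m"
    unfolding m_def using tB by (intro cInf_greatest) auto
  then show False using e by simp
qed

lemma open_tube: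
  assumes "open W" "(0::real, z) \<in> W"
  obtains e U where "e > 0" "open U" "z \<in> U" "\<And>t y. y \<in> U \<Longrightarrow> \<bar>t\<bar> \<le> e \<Longrightarrow> (t, y) \<in> W"
proof -
  obtain A U where AU: "open A" "open U" "(0, z) \<in> A \<times> U" "A \<times> U \<subseteq> W"
    using open_prod_elim[OF assms] .
  then obtain e where e: "e > 0" "cball 0 e \<subseteq> A"
    using open_contains_cball by (metis mem_Sigma_iff)
  show thesis
  proof (rule that[OF e(1) AU(2)])
    show "z \<in> U" using AU by simp
    show "(t, y) \<in> W" if "y \<in> U" "\<bar>t\<bar> \<le> e" for t y
    proof -
      have "t \<in> A" using e(2) that(2) by (auto simp: dist_norm)
      then show ?thesis using AU(4) that(1) by auto
    qed
  qed
qed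

lemma eventually_at_right_small: "0 < (c::real) \<Longrightarrow> \<forall>\<^sub>F u in at_right 0. u < c"
  and eventually_at_right_pos: "\<forall>\<^sub>F u in at_right (0::real). 0 < u"
  unfolding eventually_at_right_field by (auto intro: exI[of _ 1])

lemma eventually_at_right_witness:
  assumes "\<forall>\<^sub>F u in at_right (0::real). P u"
  shows "\<exists>u>0. P u" "0 < c \<Longrightarrow> \<exists>u>0. u < c \<and> P u"
proof -
  obtain e where e: "e > 0" "\<And>u. 0 < u \<Longrightarrow> u < e \<Longrightarrow> P u"
    using assms unfolding eventually_at_right_field by auto
  show "\<exists>u>0. P u"
    using e by (intro exI[of _ "e / 2"]) auto
  show "\<exists>u>0. u < c \<and> P u" if "0 < c"
    using e that by (intro exI[of _ "min e c / 2"]) auto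
qed

text \<open>Triples and phase points are treated as single points from here on, so quantifiers over
  them are not to be split into components.\<close>

declare split_paired_All [simp del] split_paired_Ex [simp del]

context interaction
begin

lemma form_flow: "form p (free_flow t z) = form p z + 2 * t * rate p z + t\<^sup>2 * (gradient p (snd z) \<bullet> snd z)"
  by (simp only: form_def rate_def free_flow_def fst_conv obs.form_flow)

lemma form_snd_nonneg: "0 \<le> t\<^sup>2 * (gradient p (snd z) \<bullet> snd (z :: ('d, 'm) phase))"
  by (rule mult_nonneg_nonneg[OF zero_le_power2 obs.psd])

lemma interior_tube:
  fixes z :: "('d, 'm) phase"
  assumes "z \<in> phase_interior \<sigma>"
  obtains e U where "e > 0" "open U" "z \<in> U" "\<And>t y. y \<in> U \<Longrightarrow> \<bar>t\<bar> \<le> e \<Longrightarrow> free_flow t y \<in> phase_interior \<sigma>"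
proof -
  let ?W = "{w :: real \<times> ('d, 'm) phase. free_flow (fst w) (snd w) \<in> phase_interior \<sigma>}"
  have "open ?W"
    using open_vimage[OF open_interior, of "\<lambda>w. free_flow (fst w) (snd w)"]
    by (simp add: vimage_def continuous_intros)
  moreover have "(0, z) \<in> ?W"
    using assms by simp
  ultimately show thesis
    by (rule open_tube) (rule that, auto)
qed

text \<open>For triples not in contact at \<open>z\<close> the strict inequality persists by
  continuity. For a triple in contact the rate is positive near \<open>z\<close>, and the second
  order term is nonnegative, so from any value that is at least \<open>s\<close> the form increases.
  States on the obstacle are covered too, hence the restriction to \<open>0 < t\<close> in the last
  clause.\<close>

lemma departure_tube:
  fixes z :: "('d, 'm) phase"
  assumes z: "z \<in> refined_phase_space \<sigma>" "\<not> pre_collisional \<sigma> z"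
  obtains e U where "e > 0" "open U" "z \<in> U"
    "\<And>y. y \<in> U \<Longrightarrow> y \<in> phase_space \<sigma> \<Longrightarrow> y \<in> refined_phase_space \<sigma> \<and> \<not> pre_collisional \<sigma> y"
    "\<And>t y. y \<in> U \<Longrightarrow> y \<in> phase_space \<sigma> \<Longrightarrow> 0 < t \<Longrightarrow> t \<le> e \<Longrightarrow> free_flow t y \<in> phase_interior \<sigma>"
proof -
  let ?free = "{p \<in> triples. form p z \<noteq> s}" and ?hit = "{p \<in> triples. form p z = s}"
  let ?W = "(\<Inter>p\<in>?free. {w :: real \<times> ('d, 'm) phase. s < form p (free_flow (fst w) (snd w))}) \<inter>
    (\<Inter>p\<in>?hit. {w. 0 < rate p (snd w)}) \<inter> (UNIV \<times> (- singular))"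
  have W: "open ?W"
    by (intro open_Int open_INT ballI open_Collect_less continuous_intros open_Times open_Compl closed_singular) auto
  have "(0, z) \<in> ?W"
  proof -
    have "z \<notin> singular"
      using z(1) by (simp add: refined_iff)
    moreover have "s < form p z" if "p \<in> ?free" for p
      using that z(1) by (auto simp: refined_iff phase_space_iff order_le_less)
    moreover have "0 < rate p z" if "p \<in> ?hit" for p
      using that z(2) collisional_rate(1)[OF z(1), of p] refined_rate[OF z(1), of p] by auto
    ultimately show ?thesis by simp
  qed
  from open_tube[OF W this] obtain e U where eU: "e > 0" "open U" "z \<in> U"
    "\<And>t y. y \<in> U \<Longrightarrow> \<bar>t\<bar> \<le> e \<Longrightarrow> (t, y) \<in> ?W" by blast
  have free: "s < form p (free_flow t y)" if "y \<in> U" "\<bar>t\<bar> \<le> e" "p \<in> triples" "form p z \<noteq> s" for t y p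
    using eU(4)[OF that(1,2)] that(3,4) by simp
  have hit: "0 < rate p y" if "y \<in> U" "p \<in> triples" "form p z = s" for y p
    using eU(4)[of y 0] eU(1) that by simp
  show thesis
  proof (rule that[OF eU(1-3)])
    fix y assume y: "y \<in> U" "y \<in> phase_space \<sigma>"
    have "y \<notin> singular"
      using eU(4)[of y 0] eU(1) y by simp
    then have r: "y \<in> refined_phase_space \<sigma>"
      using y by (simp add: refined_iff)
    moreover have "\<not> pre_collisional \<sigma> y"
    proof
      assume "pre_collisional \<sigma> y"
      then obtain p where p: "p \<in> triples" "form p y = s" "rate p y < 0"
        using pre_collisional_iff(1)[OF r] by auto
      show False
        using p free[of y 0 p] hit[of y p] y eU(1) by (cases "form p z = s") auto
    qed
    ultimately show "y \<in> refined_phase_space \<sigma> \<and> \<not> pre_collisional \<sigma> y" ..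
  next
    fix t y assume y: "y \<in> U" "y \<in> phase_space \<sigma>" and t: "0 < t" "t \<le> e"
    show "free_flow t y \<in> phase_interior \<sigma>"
      unfolding phase_interior_iff
    proof
      fix p :: "'m \<times> 'm \<times> 'm" assume p: "p \<in> triples"
      show "s < form p (free_flow t y)"
      proof (cases "form p z = s")
        case True
        then have "0 < t * rate p y"
          using hit y p t by simp
        moreover have "s \<le> form p y"
          using y p by (simp add: phase_space_iff)
        moreover have "0 \<le> t\<^sup>2 * (gradient p (snd y) \<bullet> snd y)"
          by (rule form_snd_nonneg)
        ultimately show ?thesis
          unfolding form_flow mult.assoc by linarith
      next
        case False
        then show ?thesis using free y p t by simp
      qed
    qed
  qed
qed

lemma departure:
  fixes z :: "('d, 'm) phase"
  assumes z: "z \<in> refined_phase_space \<sigma>" "\<not> pre_collisional \<sigma> z"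
  shows "\<forall>\<^sub>F u in at_right 0. free_flow u z \<in> phase_interior \<sigma>"
proof -
  obtain e U where "e > 0" "z \<in> U"
    "\<And>t y. y \<in> U \<Longrightarrow> y \<in> phase_space \<sigma> \<Longrightarrow> 0 < t \<Longrightarrow> t \<le> e \<Longrightarrow> free_flow t y \<in> phase_interior \<sigma>"
    using departure_tube[OF z] by metis
  then show ?thesis
    unfolding eventually_at_right_field using refined_phase_space[OF z(1)] by (intro exI[of _ e]) auto
qed

text \<open>This is \<open>departure\<close> for the reversed state, whose outgoing representative
  is the reversal of the incoming one.\<close>

lemma arrival:
  fixes z :: "('d, 'm) phase"
  assumes z: "z \<in> refined_phase_space \<sigma>"
  shows "\<forall>\<^sub>F u in at_right 0. free_flow (- u) (incoming \<sigma> z) \<in> phase_interior \<sigma>"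
proof -
  have "\<forall>\<^sub>F u in at_right 0. free_flow u (outgoing \<sigma> (reversal z)) \<in> phase_interior \<sigma>"
    using z by (intro departure outgoing_refined) auto
  then show ?thesis
  proof (rule eventually_mono)
    fix u assume "free_flow u (outgoing \<sigma> (reversal z)) \<in> phase_interior \<sigma>"
    then have "reversal (free_flow u (outgoing \<sigma> (reversal z))) \<in> phase_interior \<sigma>"
      by simp
    then show "free_flow (- u) (incoming \<sigma> z) \<in> phase_interior \<sigma>"
      unfolding reversal_flow reversal_outgoing(1)[OF z] by simp
  qed
qed

text \<open>The local law of \<open>trajectory\<close> on \<open>[0, T]\<close>, with only the inner
  side required at the endpoints. One-sided conditions are what allows segments to be cut, joined
  and reversed.\<close>

definition segment :: "real \<Rightarrow> (real \<Rightarrow> ('d, 'm) phase) \<Rightarrow> bool" where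
  "segment T z \<longleftrightarrow>
     (\<forall>t. 0 \<le> t \<longrightarrow> t \<le> T \<longrightarrow> z t \<in> refined_phase_space \<sigma> \<and> \<not> pre_collisional \<sigma> (z t)) \<and>
     (\<forall>t. 0 \<le> t \<longrightarrow> t < T \<longrightarrow> (\<forall>\<^sub>F u in at_right 0. z (t + u) = free_flow u (z t))) \<and>
     (\<forall>t. 0 < t \<longrightarrow> t \<le> T \<longrightarrow> (\<forall>\<^sub>F u in at_right 0. z (t - u) = free_flow (- u) (incoming \<sigma> (z t))))"

lemma segmentD:
  assumes "segment T z"
  shows "0 \<le> t \<Longrightarrow> t \<le> T \<Longrightarrow> z t \<in> refined_phase_space \<sigma>"
    "0 \<le> t \<Longrightarrow> t \<le> T \<Longrightarrow> \<not> pre_collisional \<sigma> (z t)"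
    "0 \<le> t \<Longrightarrow> t < T \<Longrightarrow> \<forall>\<^sub>F u in at_right 0. z (t + u) = free_flow u (z t)"
    "0 < t \<Longrightarrow> t \<le> T \<Longrightarrow> \<forall>\<^sub>F u in at_right 0. z (t - u) = free_flow (- u) (incoming \<sigma> (z t))"
  using assms unfolding segment_def by blast+

lemma segment_mono: "segment T z \<Longrightarrow> T' \<le> T \<Longrightarrow> segment T' z"
  unfolding segment_def by auto

text \<open>Real induction. To the right, both motions are free from the same state. From the left,
  free motions that agree shortly before \<open>t\<close> have the same incoming state at
  \<open>t\<close>, and \<open>outgoing\<close> recovers the values from it, as these are not
  pre-collisional.\<close>

lemma segment_unique:
  assumes z: "segment T z" and y: "segment T y" and 0: "z 0 = y 0" and t: "0 \<le> t" "t \<le> T"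
  shows "z t = y t"
proof (cases "t = 0")
  case False
  then have "0 < t" using t by simp
  from this t(2) show ?thesis
  proof (induction rule: real_induction)
    case (right t)
    have eq: "z t = y t"
      using right 0 by (cases "t = 0") auto
    show ?case
      using segmentD(3)[OF z right(1,2)] segmentD(3)[OF y right(1,2)]
      by eventually_elim (simp add: eq)
  next
    case (left t)
    have "\<forall>\<^sub>F u in at_right 0. free_flow (- u) (incoming \<sigma> (z t)) = free_flow (- u) (incoming \<sigma> (y t))"
      using segmentD(4)[OF z left(1,2)] segmentD(4)[OF y left(1,2)]
        eventually_at_right_small[OF left(1)] eventually_at_right_pos
    proof eventually_elim
      case (elim u)
      then show ?case using left(3)[of "t - u"] by simp
    qed
    then obtain u where "free_flow (- u) (incoming \<sigma> (z t)) = free_flow (- u) (incoming \<sigma> (y t))"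
      using eventually_at_right_witness(1) by blast
    then have "free_flow u (free_flow (- u) (incoming \<sigma> (z t))) = free_flow u (free_flow (- u) (incoming \<sigma> (y t)))"
      by simp
    then have "incoming \<sigma> (z t) = incoming \<sigma> (y t)"
      by simp
    moreover have "z t \<in> refined_phase_space \<sigma>" "\<not> pre_collisional \<sigma> (z t)"
        "y t \<in> refined_phase_space \<sigma>" "\<not> pre_collisional \<sigma> (y t)"
      using segmentD(1,2)[OF z, of t] segmentD(1,2)[OF y, of t] left by auto
    ultimately show ?case
      by (metis outgoing_refined(4) outgoing_not_pre)
  qed
qed (simp add: 0)

lemma segment_shift:
  assumes z: "segment T z" and a: "0 \<le> a"
  shows "segment (T - a) (\<lambda>t. z (a + t))"
proof -
  have "z (a + t) \<in> refined_phase_space \<sigma>" "\<not> pre_collisional \<sigma> (z (a + t))" if "0 \<le> t" "t \<le> T - a" for t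
    using segmentD(1,2)[OF z, of "a + t"] that a by auto
  moreover have "\<forall>\<^sub>F u in at_right 0. z (a + (t + u)) = free_flow u (z (a + t))" if "0 \<le> t" "t < T - a" for t
    using segmentD(3)[OF z, of "a + t"] that a by (simp add: add.assoc)
  moreover have "\<forall>\<^sub>F u in at_right 0. z (a + (t - u)) = free_flow (- u) (incoming \<sigma> (z (a + t)))"
    if "0 < t" "t \<le> T - a" for t
    using segmentD(4)[OF z, of "a + t"] that a by (simp add: algebra_simps)
  ultimately show ?thesis
    unfolding segment_def by blast
qed

lemma segment_join:
  assumes z: "segment T z" and y: "segment T' y" and eq: "y 0 = z T" and T: "0 \<le> T" "0 \<le> T'"
  shows "segment (T + T') (\<lambda>t. if t \<le> T then z t else y (t - T))" (is "segment _ ?w")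
  unfolding segment_def
proof (intro conjI allI impI)
  fix t assume t: "0 \<le> t" "t \<le> T + T'"
  show "?w t \<in> refined_phase_space \<sigma>" "\<not> pre_collisional \<sigma> (?w t)"
    using segmentD(1,2)[OF z, of t] segmentD(1,2)[OF y, of "t - T"] t by auto
next
  fix t assume t: "0 \<le> t" "t < T + T'"
  show "\<forall>\<^sub>F u in at_right 0. ?w (t + u) = free_flow u (?w t)"
  proof (cases "t < T")
    case True
    then have "0 < T - t" by simp
    from segmentD(3)[OF z t(1) True] eventually_at_right_small[OF this] show ?thesis
      by eventually_elim (use True in auto)
  next
    case False
    then have w: "?w t = y (t - T)"
      using eq by (cases "t = T") auto
    have "0 \<le> t - T" "t - T < T'" using False t by auto
    from segmentD(3)[OF y this] eventually_at_right_pos show ?thesis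
      unfolding w
    proof eventually_elim
      case (elim u)
      have eq: "t + u - T = t - T + u" by simp
      show ?case using elim False unfolding eq by simp
    qed
  qed
next
  fix t assume t: "0 < t" "t \<le> T + T'"
  show "\<forall>\<^sub>F u in at_right 0. ?w (t - u) = free_flow (- u) (incoming \<sigma> (?w t))"
  proof (cases "t \<le> T")
    case True
    from segmentD(4)[OF z t(1) True] eventually_at_right_pos show ?thesis
      by eventually_elim (use True in auto)
  next
    case False
    then have "0 < t - T" "t - T \<le> T'" using t by auto
    from segmentD(4)[OF y this] eventually_at_right_small[OF this(1)] show ?thesis
    proof eventually_elim
      case (elim u)
      have eq: "t - u - T = t - T - u" by simp
      show ?case using elim False unfolding eq by simp
    qed
  qed
qed

text \<open>Reversal makes post-collisional values pre-collisional; \<open>outgoing\<close> restores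
  the convention that the value at a collision time is the post-collisional state.\<close>

lemma segment_reversal:
  assumes z: "segment T z"
  shows "segment T (\<lambda>t. outgoing \<sigma> (reversal (z (T - t))))" (is "segment _ ?w")
  unfolding segment_def
proof (intro conjI allI impI)
  fix t assume t: "0 \<le> t" "t \<le> T"
  then have "reversal (z (T - t)) \<in> refined_phase_space \<sigma>"
    using segmentD(1)[OF z, of "T - t"] by simp
  from outgoing_refined(1,2)[OF this] show "?w t \<in> refined_phase_space \<sigma>" "\<not> pre_collisional \<sigma> (?w t)" .
next
  fix t assume t: "0 \<le> t" "t < T"
  then have u: "0 < T - t" "T - t \<le> T" by auto
  then have r: "z (T - t) \<in> refined_phase_space \<sigma>"
    using segmentD(1)[OF z, of "T - t"] by simp
  from segmentD(4)[OF z u] arrival[OF r]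
  show "\<forall>\<^sub>F u in at_right 0. ?w (t + u) = free_flow u (?w t)"
  proof eventually_elim
    case (elim u)
    have eq: "T - (t + u) = T - t - u" by simp
    have "?w (t + u) = outgoing \<sigma> (reversal (free_flow (- u) (incoming \<sigma> (z (T - t)))))"
      by (simp only: eq elim(1))
    also have "\<dots> = reversal (free_flow (- u) (incoming \<sigma> (z (T - t))))"
      using elim(2) by (intro outgoing_interior) simp
    also have "\<dots> = free_flow u (reversal (incoming \<sigma> (z (T - t))))"
      by (simp add: reversal_flow)
    finally show ?case
      by (simp add: reversal_outgoing(1)[OF r])
  qed
next
  fix t assume t: "0 < t" "t \<le> T"
  then have u: "0 \<le> T - t" "T - t < T" by auto
  then have r: "z (T - t) \<in> refined_phase_space \<sigma>" "\<not> pre_collisional \<sigma> (z (T - t))"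
    using segmentD(1,2)[OF z, of "T - t"] by auto
  from segmentD(3)[OF z u] departure[OF r]
  show "\<forall>\<^sub>F u in at_right 0. ?w (t - u) = free_flow (- u) (incoming \<sigma> (?w t))"
  proof eventually_elim
    case (elim u)
    have eq: "T - (t - u) = T - t + u" by simp
    have "?w (t - u) = outgoing \<sigma> (reversal (free_flow u (z (T - t))))"
      by (simp only: eq elim(1))
    also have "\<dots> = reversal (free_flow u (z (T - t)))"
      using elim(2) by (intro outgoing_interior) simp
    also have "\<dots> = free_flow (- u) (reversal (z (T - t)))"
      by (simp add: reversal_flow)
    also have "reversal (z (T - t)) = incoming \<sigma> (?w t)"
      using outgoing_refined(5)[of "reversal (z (T - t))"] r
      by (simp add: reversal_outgoing(2)[OF r(1)] outgoing_not_pre)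
    finally show ?case .
  qed
qed

text \<open>A relation, because a trajectory need not exist up to time \<open>T\<close>. The initial
  state may be either representative of a collision, whereas the final state is never
  pre-collisional.\<close>

definition flows :: "('d, 'm) phase \<Rightarrow> real \<Rightarrow> ('d, 'm) phase \<Rightarrow> bool" where
  "flows x T y \<longleftrightarrow> x \<in> refined_phase_space \<sigma> \<and> 0 \<le> T \<and> (\<exists>z. segment T z \<and> z 0 = outgoing \<sigma> x \<and> z T = y)"

lemma flowsE:
  assumes "flows x T y"
  obtains z where "segment T z" "z 0 = outgoing \<sigma> x" "z T = y" "x \<in> refined_phase_space \<sigma>" "0 \<le> T"
  using assms unfolding flows_def by blast

lemma flowsD:
  assumes "flows x T y"
  shows "x \<in> refined_phase_space \<sigma>" "0 \<le> T" "y \<in> refined_phase_space \<sigma>" "\<not> pre_collisional \<sigma> y" "outgoing \<sigma> y = y"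
proof -
  obtain z where z: "segment T z" "z T = y" "x \<in> refined_phase_space \<sigma>" "0 \<le> T"
    using assms by (rule flowsE)
  then show "x \<in> refined_phase_space \<sigma>" "0 \<le> T" "y \<in> refined_phase_space \<sigma>" "\<not> pre_collisional \<sigma> y"
    using segmentD(1,2)[OF z(1), of T] by auto
  then show "outgoing \<sigma> y = y"
    by (simp add: outgoing_not_pre)
qed

lemma flows_unique:
  assumes "flows x T y" "flows x T y'"
  shows "y = y'"
proof -
  obtain z where z: "segment T z" "z 0 = outgoing \<sigma> x" "z T = y" "0 \<le> T"
    using assms(1) by (rule flowsE)
  obtain z' where z': "segment T z'" "z' 0 = outgoing \<sigma> x" "z' T = y'"
    using assms(2) by (rule flowsE)
  show ?thesis
    using segment_unique[OF z(1) z'(1), of T] z z' by simp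
qed

lemma flows_trans:
  assumes "flows x T y" "flows y T' w"
  shows "flows x (T + T') w"
proof -
  obtain z where z: "segment T z" "z 0 = outgoing \<sigma> x" "z T = y" "x \<in> refined_phase_space \<sigma>" "0 \<le> T"
    using assms(1) by (rule flowsE)
  obtain z' where z': "segment T' z'" "z' 0 = outgoing \<sigma> y" "z' T' = w" "0 \<le> T'"
    using assms(2) by (rule flowsE)
  have eq: "z' 0 = z T"
    using z z' flowsD(5)[OF assms(1)] by simp
  let ?w = "\<lambda>t. if t \<le> T then z t else z' (t - T)"
  have "segment (T + T') ?w"
    by (rule segment_join[OF z(1) z'(1) eq z(5) z'(4)])
  moreover have "?w (T + T') = w"
    using z' eq z by (cases "T' = 0") auto
  moreover have "?w 0 = outgoing \<sigma> x"
    using z by simp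
  ultimately show ?thesis
    unfolding flows_def using z(4,5) z'(4) by (intro conjI exI[of _ ?w]) simp_all
qed

lemma flows_outgoing:
  assumes "x \<in> refined_phase_space \<sigma>"
  shows "flows (outgoing \<sigma> x) T y \<longleftrightarrow> flows x T y"
  unfolding flows_def using assms outgoing_refined(1,3)[OF assms] by simp

lemma flows_split:
  assumes "flows x T y" "0 \<le> t" "t \<le> T"
  obtains w where "flows x t w" "flows w (T - t) y"
proof -
  obtain z where z: "segment T z" "z 0 = outgoing \<sigma> x" "z T = y" "x \<in> refined_phase_space \<sigma>" "0 \<le> T"
    using assms(1) by (rule flowsE)
  have w: "z t \<in> refined_phase_space \<sigma>" "outgoing \<sigma> (z t) = z t"
    using segmentD(1,2)[OF z(1) assms(2,3)] outgoing_not_pre by auto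
  have "flows x t (z t)"
    unfolding flows_def using z assms(2) segment_mono[OF z(1) assms(3)] by blast
  moreover have "flows (z t) (T - t) y"
    unfolding flows_def using w z assms segment_shift[OF z(1) assms(2)]
    by (intro conjI exI[of _ "\<lambda>u. z (t + u)"]) simp_all
  ultimately show thesis by (rule that)
qed

lemma flows_reversal:
  assumes "flows x T y"
  shows "flows (reversal y) T (outgoing \<sigma> (reversal x))"
proof -
  obtain z where z: "segment T z" "z 0 = outgoing \<sigma> x" "z T = y" "x \<in> refined_phase_space \<sigma>" "0 \<le> T"
    using assms by (rule flowsE)
  have "outgoing \<sigma> (reversal (outgoing \<sigma> x)) = reversal (incoming \<sigma> (outgoing \<sigma> x))"
    by (rule reversal_outgoing(1)[OF outgoing_refined(1)[OF z(4)]])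
  also have "\<dots> = outgoing \<sigma> (reversal x)"
    by (simp add: reversal_outgoing(1)[OF z(4)] outgoing_refined(5)[OF z(4)])
  finally show ?thesis
    unfolding flows_def using segment_reversal[OF z(1)] z flowsD(3)[OF assms]
    by (intro conjI exI[of _ "\<lambda>t. outgoing \<sigma> (reversal (z (T - t)))"]) simp_all
qed

lemma flows_zero: "x \<in> refined_phase_space \<sigma> \<Longrightarrow> flows x 0 (outgoing \<sigma> x)"
  unfolding flows_def segment_def using outgoing_refined(1,2)[of x]
  by (intro conjI exI[of _ "\<lambda>t. outgoing \<sigma> x"]) auto

text \<open>Free motion whose first contact, if there is one, happens exactly at time
  \<open>T\<close>. The end must not be post-collisional, so that the free motion arrives at the
  incoming representative.\<close>

lemma flows_step:
  assumes x: "x \<in> refined_phase_space \<sigma>" "\<not> pre_collisional \<sigma> x" and T: "0 < T"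
    and free: "\<And>t. 0 < t \<Longrightarrow> t < T \<Longrightarrow> free_flow t x \<in> phase_interior \<sigma>"
    and y: "free_flow T x \<in> refined_phase_space \<sigma>" "\<not> post_collisional \<sigma> (free_flow T x)"
  shows "flows x T (outgoing \<sigma> (free_flow T x))"
proof -
  let ?z = "\<lambda>t. if t < T then free_flow t x else outgoing \<sigma> (free_flow T x)"
  have "segment T ?z"
    unfolding segment_def
  proof (intro conjI allI impI)
    fix t assume t: "0 \<le> t" "t \<le> T"
    consider "t = 0" | "0 < t" "t < T" | "t = T" using t by linarith
    then have "?z t \<in> refined_phase_space \<sigma> \<and> \<not> pre_collisional \<sigma> (?z t)"
    proof cases
      case 2
      then show ?thesis
        using free interior_refined interior_not_collisional(1) by simp
    qed (use x T outgoing_refined(1,2)[OF y(1)] in simp_all)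
    then show "?z t \<in> refined_phase_space \<sigma>" "\<not> pre_collisional \<sigma> (?z t)"
      by blast+
  next
    fix t assume t: "0 \<le> t" "t < T"
    then have "0 < T - t" by simp
    from eventually_at_right_small[OF this] show "\<forall>\<^sub>F u in at_right 0. ?z (t + u) = free_flow u (?z t)"
      by eventually_elim (use t in \<open>auto simp: add.commute\<close>)
  next
    fix t assume t: "0 < t" "t \<le> T"
    have "incoming \<sigma> (?z t) = free_flow t x"
    proof (cases "t < T")
      case True
      then show ?thesis using free t incoming_interior by simp
    next
      case False
      then show ?thesis using t y outgoing_refined(5)[OF y(1)] by (simp add: incoming_not_post)
    qed
    then show "\<forall>\<^sub>F u in at_right 0. ?z (t - u) = free_flow (- u) (incoming \<sigma> (?z t))"
      using eventually_at_right_pos by (auto elim!: eventually_mono simp: t intro!: less_le_trans[OF _ t(2)])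
  qed
  then show ?thesis
    unfolding flows_def using x T by (intro conjI exI[of _ ?z]) (simp_all add: outgoing_not_pre)
qed

lemma flows_free:
  assumes x: "x \<in> refined_phase_space \<sigma>" "\<not> pre_collisional \<sigma> x" and T: "0 \<le> T"
    and free: "\<And>t. 0 < t \<Longrightarrow> t \<le> T \<Longrightarrow> free_flow t x \<in> phase_interior \<sigma>"
  shows "flows x T (free_flow T x)"
proof (cases "T = 0")
  case True
  then show ?thesis using flows_zero[OF x(1)] x(2) by (simp add: outgoing_not_pre)
next
  case False
  then have "free_flow T x \<in> phase_interior \<sigma>"
    using free T by simp
  then show ?thesis
    using flows_step[OF x, of T] False T free
    by (simp add: interior_refined interior_not_collisional outgoing_interior)
qed

text \<open>Existence continues beyond any time at which it holds, and shortly afterwards the state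
  is interior. This gives access to the statements that require interior final states.\<close>

lemma flows_extend:
  assumes "flows x T y"
  shows "\<forall>\<^sub>F u in at_right 0. flows x (T + u) (free_flow u y) \<and> free_flow u y \<in> phase_interior \<sigma>"
proof -
  note y = flowsD(3,4)[OF assms]
  obtain e where e: "e > 0" "\<And>u. 0 < u \<Longrightarrow> u < e \<Longrightarrow> free_flow u y \<in> phase_interior \<sigma>"
    using departure[OF y] unfolding eventually_at_right_field by auto
  show ?thesis
    unfolding eventually_at_right_field
  proof (intro exI[of _ e] conjI allI impI e)
    fix u assume u: "u > 0" "u < e"
    then have "flows y u (free_flow u y)"
      using e(2) by (intro flows_free y) auto
    then show "flows x (T + u) (free_flow u y)"
      by (rule flows_trans[OF assms])
  qed auto
qed

end

section \<open>Stability under perturbation of the initial state\<close>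

context interaction
begin

lemma interior_outgoing_iff:
  "x \<in> refined_phase_space \<sigma> \<Longrightarrow> outgoing \<sigma> x \<in> phase_interior \<sigma> \<longleftrightarrow> (x :: ('d, 'm) phase) \<in> phase_interior \<sigma>"
  using norm_outgoing(3)[of x] by (simp add: phase_interior_iff form_def)

lemma segment_flows:
  assumes "segment T z" "z 0 = outgoing \<sigma> x" "x \<in> refined_phase_space \<sigma>" "0 \<le> t" "t \<le> T"
  shows "flows x t (z t)"
  unfolding flows_def using assms segment_mono by blast

text \<open>Near a pre-collisional contact with \<open>p\<close>, the strict inequalities for the
  other triples persist along the free and the scattered motion, so only the obstacle of
  \<open>p\<close> matters, and there the explicit quadratic polynomial decides. For the last
  conclusion: a state near \<open>w\<close> with its entry in the past would lie inside the
  obstacle.\<close>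

lemma collision_tube:
  fixes w :: "('d, 'm) phase"
  assumes w: "w \<in> refined_phase_space \<sigma>" and p: "p \<in> triples" "form p w = s" "rate p w < 0"
  obtains e U where "e > 0" "open U" "w \<in> U" "U \<subseteq> obs.hits p"
    "\<And>y a. y \<in> U \<Longrightarrow> - e \<le> a \<Longrightarrow> a \<le> e \<Longrightarrow> a < obs.entry p y \<Longrightarrow> free_flow a y \<in> phase_interior \<sigma>"
    "\<And>y b. y \<in> U \<Longrightarrow> - e \<le> b \<Longrightarrow> b \<le> e \<Longrightarrow> obs.entry p y < b \<Longrightarrow> free_flow b (obs.scatter p y) \<in> phase_interior \<sigma>"
    "\<And>y. y \<in> U \<Longrightarrow> \<bar>obs.entry p y\<bar> \<le> e \<Longrightarrow> pre_collisional \<sigma> (free_flow (obs.entry p y) y)"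
    "\<And>y. y \<in> U \<Longrightarrow> \<bar>obs.entry p y\<bar> \<le> e \<Longrightarrow>
       outgoing \<sigma> (free_flow (obs.entry p y) y) = free_flow (obs.entry p y) (obs.scatter p y)"
    "\<And>y. y \<in> U \<Longrightarrow> y \<in> phase_space \<sigma> \<Longrightarrow> 0 \<le> obs.entry p y"
proof -
  let ?others = "triples - {p}"
  obtain x v where xv: "w = (x, v)" by (cases w)
  have w_hits: "w \<in> obs.hits p" and entry_w: "obs.entry p w = 0"
    using obs.crossing[of p x 0 v] p by (simp_all add: xv form_def rate_def)
  let ?H = "UNIV \<times> obs.hits p :: (real \<times> ('d, 'm) phase) set"
  let ?f = "\<lambda>p' (r :: real \<times> ('d, 'm) phase). form p' (free_flow (fst r) (snd r))"
  let ?g = "\<lambda>p' (r :: real \<times> ('d, 'm) phase). form p' (free_flow (fst r) (obs.scatter p (snd r)))"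
  define W where "W = (\<Inter>p'\<in>?others. {r. s < ?f p' r}) \<inter> (\<Inter>p'\<in>?others. ?H \<inter> ?g p' -` {s<..}) \<inter>
    (?H \<inter> {r. rate p (snd r) < 0})"
  have openH: "open ?H"
    by (intro open_Times obs.open_hits) simp
  have cont: "continuous_on ?H (?g p')" for p'
    by (intro continuous_intros continuous_on_compose2[OF smooth_vp_continuous[OF obs.smooth_vp_scatter]]) auto
  have W: "open W"
    unfolding W_def
    by (intro open_Int open_INT ballI open_Collect_less continuous_intros openH
        continuous_open_preimage[OF cont]) auto
  have W0: "(0, w) \<in> W"
  proof -
    have o: "s < form p' w" if "p' \<in> ?others" for p'
      using w p that refined_unique[OF w p(1,2), of p'] by (force simp: refined_iff phase_space_iff order_le_less)
    have "fst (obs.scatter p w) = fst w"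
      using obs.scatter_entry(1)[of p w] entry_w by simp
    then have "form p' (obs.scatter p w) = form p' w" for p'
      by (simp add: form_def)
    then show ?thesis
      unfolding W_def using o w_hits p(3) by simp
  qed
  obtain e U where eU: "e > 0" "open U" "w \<in> U" "\<And>t y. y \<in> U \<Longrightarrow> \<bar>t\<bar> \<le> e \<Longrightarrow> (t, y) \<in> W"
    using open_tube[OF W W0] by blast
  have hits: "y \<in> obs.hits p" if "y \<in> U" for y
    using eU(4)[OF that, of 0] eU(1) by (simp add: W_def)
  have rate: "rate p y < 0" if "y \<in> U" for y
    using eU(4)[OF that, of 0] eU(1) by (simp add: W_def)
  have f: "s < form p' (free_flow t y)" if "y \<in> U" "\<bar>t\<bar> \<le> e" "p' \<in> triples" "p' \<noteq> p" for t y p'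
    using eU(4)[OF that(1,2)] that(3,4) by (simp add: W_def)
  have g: "s < form p' (free_flow t (obs.scatter p y))" if "y \<in> U" "\<bar>t\<bar> \<le> e" "p' \<in> triples" "p' \<noteq> p" for t y p'
    using eU(4)[OF that(1,2)] that(3,4) by (auto simp: W_def split: if_splits)
  have hits': "(fst y, snd y) \<in> obs.hits p" if "y \<in> U" for y
    using hits[OF that] by simp
  have formp: "form p (free_flow t y) = gradient p (fst y + t *\<^sub>R snd y) \<bullet> (fst y + t *\<^sub>R snd y)"
    and ratep: "rate p (free_flow t y) = gradient p (fst y + t *\<^sub>R snd y) \<bullet> snd y" for t y
    by (simp_all add: form_def rate_def free_flow_def)
  have refined: "free_flow (obs.entry p y) y \<in> refined_phase_space \<sigma>"
    "form p (free_flow (obs.entry p y) y) = s" "rate p (free_flow (obs.entry p y) y) < 0"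
    if y: "y \<in> U" "\<bar>obs.entry p y\<bar> \<le> e" for y
  proof -
    let ?x = "free_flow (obs.entry p y) y"
    show 1: "form p ?x = s" "rate p ?x < 0"
      unfolding formp ratep using obs.form_entry[OF hits'] obs.polar_entry[OF hits'] y by simp_all
    have "?x \<notin> singular"
    proof
      assume "?x \<in> singular"
      then show False
      proof (cases rule: singularE)
        case (1 p1 p2)
        then show False using f[OF y, of p1] f[OF y, of p2] by force
      next
        case (2 p1)
        then show False using f[OF y, of p1] \<open>rate p ?x < 0\<close> by (cases "p1 = p") auto
      qed
    qed
    moreover have "s \<le> form p' ?x" if "p' \<in> triples" for p'
      using f[OF y that] 1 by (cases "p' = p") (auto intro: less_imp_le)
    ultimately show "?x \<in> refined_phase_space \<sigma>"
      by (simp add: refined_iff phase_space_iff)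
  qed
  show thesis
  proof (rule that[OF eU(1-3)])
    show "U \<subseteq> obs.hits p" using hits by blast
  next
    fix y a assume y: "y \<in> U" and a: "- e \<le> a" "a \<le> e" "a < obs.entry p y"
    then have "\<bar>a\<bar> \<le> e" by simp
    moreover have "s < form p (free_flow a y)"
      unfolding formp using obs.form_before[OF hits'[OF y]] a(3) by simp
    ultimately show "free_flow a y \<in> phase_interior \<sigma>"
      unfolding phase_interior_iff using f y by metis
  next
    fix y b assume y: "y \<in> U" and b: "- e \<le> b" "b \<le> e" "obs.entry p y < b"
    then have "\<bar>b\<bar> \<le> e" by simp
    moreover have "s < form p (free_flow b (obs.scatter p y))"
      unfolding formp using obs.form_after[OF hits'[OF y]] b(3) by simp
    ultimately show "free_flow b (obs.scatter p y) \<in> phase_interior \<sigma>"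
      unfolding phase_interior_iff using g y by metis
  next
    fix y assume y: "y \<in> U" "\<bar>obs.entry p y\<bar> \<le> e"
    note r = refined[OF y]
    show "pre_collisional \<sigma> (free_flow (obs.entry p y) y)"
      using collisional_rate(1)[OF r(1) p(1) r(2)] r(3) by simp
    have "outgoing \<sigma> (free_flow (obs.entry p y) y) = reflect p (free_flow (obs.entry p y) y)"
      using outgoing_eq(1)[OF r(1) p(1) r(2)] r(3) by simp
    also have "\<dots> = free_flow (obs.entry p y) (obs.scatter p y)"
      by (simp add: reflect_def free_flow_def obs.scatter_entry(1)) (simp add: obs.scatter_entry(2))
    finally show "outgoing \<sigma> (free_flow (obs.entry p y) y) = free_flow (obs.entry p y) (obs.scatter p y)" .
  next
    fix y assume y: "y \<in> U" "y \<in> phase_space \<sigma>"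
    show "0 \<le> obs.entry p y"
    proof (rule ccontr)
      assume "\<not> 0 \<le> obs.entry p y"
      then have "form p y < s"
        using obs.form_inside[OF hits'[OF y(1)]] rate[OF y(1)] by (simp add: form_def rate_def)
      then show False
        using y(2) p(1) by (simp add: phase_space_iff not_less[symmetric])
    qed
  qed
qed

text \<open>\<open>U\<close> is open in the whole space, so \<open>F\<close> extends the flow
  smoothly across the boundary of the phase space; initial states that are collisions are thereby
  included. Final states are interior, where no jump can interfere.\<close>

definition stable :: "real \<Rightarrow> ('d, 'm) phase \<Rightarrow> bool" where
  "stable T x \<longleftrightarrow> (\<exists>U F. smooth_vp U F \<and> x \<in> U \<and>
     (\<forall>y\<in>U. F y \<in> phase_interior \<sigma>) \<and> (\<forall>y\<in>U \<inter> phase_space \<sigma>. flows y T (F y)))"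

lemma stableI:
  assumes "smooth_vp U F" "x \<in> U" "F x \<in> phase_interior \<sigma>"
    "\<And>y. y \<in> U \<Longrightarrow> y \<in> phase_space \<sigma> \<Longrightarrow> flows y T (F y)"
  shows "stable T x"
proof -
  have "open (U \<inter> F -` phase_interior \<sigma>)"
    using assms(1) open_interior smooth_vp_continuous by (intro continuous_open_preimage) (auto simp: smooth_vp_def)
  from smooth_vp_subset[OF assms(1) this] show ?thesis
    unfolding stable_def using assms by (intro exI[of _ "U \<inter> F -` phase_interior \<sigma>"] exI[of _ F]) auto
qed

lemma stable_trans:
  assumes "stable T x" "flows x T w" "stable T' w"
  shows "stable (T + T') x"
proof -
  obtain U F where F: "smooth_vp U F" "x \<in> U" "\<forall>y\<in>U. F y \<in> phase_interior \<sigma>" "\<forall>y\<in>U \<inter> phase_space \<sigma>. flows y T (F y)"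
    using assms(1) unfolding stable_def by blast
  obtain V H where H: "smooth_vp V H" "w \<in> V" "\<forall>y\<in>V. H y \<in> phase_interior \<sigma>" "\<forall>y\<in>V \<inter> phase_space \<sigma>. flows y T' (H y)"
    using assms(3) unfolding stable_def by blast
  have "x \<in> phase_space \<sigma>"
    using flowsD(1)[OF assms(2)] refined_phase_space by blast
  then have Fx: "F x = w"
    using F(2,4) flows_unique[OF _ assms(2)] by blast
  show ?thesis
  proof (rule stableI[OF smooth_vp_compose[OF F(1) H(1)]])
    show "x \<in> U \<inter> F -` V" "H (F x) \<in> phase_interior \<sigma>"
      using F(2) H(2,3) Fx by auto
    fix y assume y: "y \<in> U \<inter> F -` V" "y \<in> phase_space \<sigma>"
    then have "F y \<in> phase_space \<sigma>"
      using F(3) interior_refined refined_phase_space by blast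
    then show "flows y (T + T') (H (F y))"
      using y F(4) H(4) by (intro flows_trans[of y T "F y"]) auto
  qed
qed

lemma smooth_vp_shifted_free_flow: "open U \<Longrightarrow> smooth_vp U (free_flow t :: ('d, 'm) phase \<Rightarrow> _)"
  by (rule smooth_vp_subset[OF smooth_vp_free_flow]) auto

lemma stable_departure:
  fixes x :: "('d, 'm) phase"
  assumes x: "x \<in> refined_phase_space \<sigma>" "\<not> pre_collisional \<sigma> x"
  shows "\<forall>\<^sub>F u in at_right 0. stable u x"
proof -
  obtain e U where eU: "e > 0" "open U" "x \<in> U"
    "\<And>y. y \<in> U \<Longrightarrow> y \<in> phase_space \<sigma> \<Longrightarrow> y \<in> refined_phase_space \<sigma> \<and> \<not> pre_collisional \<sigma> y"
    "\<And>t y. y \<in> U \<Longrightarrow> y \<in> phase_space \<sigma> \<Longrightarrow> 0 < t \<Longrightarrow> t \<le> e \<Longrightarrow> free_flow t y \<in> phase_interior \<sigma>"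
    using departure_tube[OF x] by metis
  have "stable u x" if u: "0 < u" "u < e" for u
  proof (rule stableI[OF smooth_vp_shifted_free_flow[OF eU(2)] eU(3)])
    show "free_flow u x \<in> phase_interior \<sigma>"
      using eU refined_phase_space[OF x(1)] u by simp
    show "flows y u (free_flow u y)" if "y \<in> U" "y \<in> phase_space \<sigma>" for y
      using eU(4)[OF that] eU(5)[OF that] u by (intro flows_free) auto
  qed
  then show ?thesis
    unfolding eventually_at_right_field using eU(1) by (intro exI[of _ e]) simp
qed

lemma stable_interior:
  fixes x :: "('d, 'm) phase"
  assumes x: "x \<in> phase_interior \<sigma>"
  shows "\<forall>\<^sub>F u in at_right 0. stable u (free_flow (- u) x)" "stable 0 x"
proof -
  obtain e U where eU: "e > 0" "open U" "x \<in> U"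
    "\<And>t y. y \<in> U \<Longrightarrow> \<bar>t\<bar> \<le> e \<Longrightarrow> free_flow t y \<in> phase_interior \<sigma>"
    using interior_tube[OF x] by metis
  have "stable u (free_flow (- u) x)" if u: "0 \<le> u" "u < e" for u
  proof (rule stableI[of "free_flow u -` U" "free_flow u"])
    show "smooth_vp (free_flow u -` U) (free_flow u :: ('d, 'm) phase \<Rightarrow> _)"
      by (intro smooth_vp_shifted_free_flow open_vimage eU(2) continuous_intros)
    show "free_flow (- u) x \<in> free_flow u -` U" "free_flow u (free_flow (- u) x) \<in> phase_interior \<sigma>"
      using eU(3) x by simp_all
    show "flows y u (free_flow u y)" if "y \<in> free_flow u -` U" "y \<in> phase_space \<sigma>" for y
    proof -
      have *: "free_flow t y \<in> phase_interior \<sigma>" if "0 \<le> t" "t \<le> u" for t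
        using eU(4)[of "free_flow u y" "t - u"] \<open>y \<in> free_flow u -` U\<close> that u by simp
      from *[of 0] u(1) have "y \<in> phase_interior \<sigma>"
        by simp
      then show ?thesis
        using * u(1) by (intro flows_free) (auto simp: interior_refined interior_not_collisional)
    qed
  qed
  note * = this
  from *[of 0] eU(1) show "stable 0 x"
    by simp
  from * show "\<forall>\<^sub>F u in at_right 0. stable u (free_flow (- u) x)"
    unfolding eventually_at_right_field using eU(1) by (intro exI[of _ e]) simp
qed

text \<open>Free motion up to the entry time is joined with scattered motion after it, uniformly for
  all states near the collision. Times are relative to the collision at \<open>w\<close>, so the
  start \<open>a\<close> is usually negative.\<close>

lemma collision_flows:
  fixes w :: "('d, 'm) phase"
  assumes w: "w \<in> refined_phase_space \<sigma>" "pre_collisional \<sigma> w"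
  obtains p e U where "e > 0" "open U" "w \<in> U" "U \<subseteq> obs.hits p"
    "obs.entry p w = 0" "obs.scatter p w = outgoing \<sigma> w"
    "\<And>y a. y \<in> U \<Longrightarrow> - e \<le> a \<Longrightarrow> a \<le> e \<Longrightarrow> a < obs.entry p y \<Longrightarrow> free_flow a y \<in> phase_interior \<sigma>"
    "\<And>y b. y \<in> U \<Longrightarrow> - e \<le> b \<Longrightarrow> b \<le> e \<Longrightarrow> obs.entry p y < b \<Longrightarrow> free_flow b (obs.scatter p y) \<in> phase_interior \<sigma>"
    "\<And>y a b. y \<in> U \<Longrightarrow> - e \<le> a \<Longrightarrow> a < obs.entry p y \<Longrightarrow> obs.entry p y \<le> b \<Longrightarrow> b \<le> e \<Longrightarrow>
       flows (free_flow a y) (b - a) (free_flow b (obs.scatter p y))"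
    "\<And>y b. y \<in> U \<Longrightarrow> y \<in> phase_space \<sigma> \<Longrightarrow> obs.entry p y < b \<Longrightarrow> b \<le> e \<Longrightarrow>
       flows y b (free_flow b (obs.scatter p y))"
proof -
  obtain p where p: "p \<in> triples" "form p w = s" "rate p w < 0"
    using w pre_collisional_iff(1)[OF w(1)] by blast
  obtain e U where eU: "e > 0" "open U" "w \<in> U" "U \<subseteq> obs.hits p"
    and before: "\<And>y a. y \<in> U \<Longrightarrow> - e \<le> a \<Longrightarrow> a \<le> e \<Longrightarrow> a < obs.entry p y \<Longrightarrow> free_flow a y \<in> phase_interior \<sigma>"
    and after: "\<And>y b. y \<in> U \<Longrightarrow> - e \<le> b \<Longrightarrow> b \<le> e \<Longrightarrow> obs.entry p y < b \<Longrightarrow> free_flow b (obs.scatter p y) \<in> phase_interior \<sigma>"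
    and pre: "\<And>y. y \<in> U \<Longrightarrow> \<bar>obs.entry p y\<bar> \<le> e \<Longrightarrow> pre_collisional \<sigma> (free_flow (obs.entry p y) y)"
    and out: "\<And>y. y \<in> U \<Longrightarrow> \<bar>obs.entry p y\<bar> \<le> e \<Longrightarrow>
       outgoing \<sigma> (free_flow (obs.entry p y) y) = free_flow (obs.entry p y) (obs.scatter p y)"
    and nonneg: "\<And>y. y \<in> U \<Longrightarrow> y \<in> phase_space \<sigma> \<Longrightarrow> 0 \<le> obs.entry p y"
    by (rule collision_tube[OF w(1) p]) (rule that)
  have entry_w: "obs.entry p w = 0"
    using obs.crossing[of p "fst w" 0 "snd w"] p by (simp_all add: form_def rate_def)
  have second: "flows (free_flow (obs.entry p y) y) (b - obs.entry p y) (free_flow b (obs.scatter p y))"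
    if y: "y \<in> U" "\<bar>obs.entry p y\<bar> \<le> e" and b: "obs.entry p y \<le> b" "b \<le> e" for y b
  proof -
    let ?c = "obs.entry p y"
    let ?x = "free_flow ?c y"
    have x: "?x \<in> refined_phase_space \<sigma>"
      by (rule pre_refined[OF pre[OF y]])
    have "flows (outgoing \<sigma> ?x) (b - ?c) (free_flow (b - ?c) (outgoing \<sigma> ?x))"
    proof (rule flows_free[OF outgoing_refined(1,2)[OF x]])
      show "free_flow t (outgoing \<sigma> ?x) \<in> phase_interior \<sigma>" if "0 < t" "t \<le> b - ?c" for t
        unfolding out[OF y] using after[OF y(1), of "t + ?c"] that b y(2) by simp
    qed (use b in simp)
    then show ?thesis
      unfolding flows_outgoing[OF x] unfolding out[OF y] by simp
  qed
  have first: "flows (free_flow a y) (obs.entry p y - a) (outgoing \<sigma> (free_flow (obs.entry p y) y))"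
    if y: "y \<in> U" "\<bar>obs.entry p y\<bar> \<le> e" and a: "- e \<le> a" "a < obs.entry p y" for y a
  proof -
    let ?c = "obs.entry p y"
    have x: "free_flow a y \<in> phase_interior \<sigma>"
      using before[OF y(1) a(1)] a y(2) by simp
    have eq: "free_flow (?c - a) (free_flow a y) = free_flow ?c y"
      by simp
    have "flows (free_flow a y) (?c - a) (outgoing \<sigma> (free_flow (?c - a) (free_flow a y)))"
    proof (rule flows_step[OF interior_refined[OF x] interior_not_collisional(1)[OF x]])
      show "0 < ?c - a" using a by simp
      show "free_flow t (free_flow a y) \<in> phase_interior \<sigma>" if "0 < t" "t < ?c - a" for t
        using before[OF y(1), of "t + a"] that a y(2) by simp
      show "free_flow (?c - a) (free_flow a y) \<in> refined_phase_space \<sigma>"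
        unfolding eq by (rule pre_refined[OF pre[OF y]])
      show "\<not> post_collisional \<sigma> (free_flow (?c - a) (free_flow a y))"
        unfolding eq using pre[OF y] by (auto simp: pre_collisional_def post_collisional_def)
    qed
    then show ?thesis unfolding eq .
  qed
  have cross: "flows (free_flow a y) (b - a) (free_flow b (obs.scatter p y))"
    if y: "y \<in> U" and ab: "- e \<le> a" "a < obs.entry p y" "obs.entry p y \<le> b" "b \<le> e" for y a b
  proof -
    let ?x = "free_flow (obs.entry p y) y"
    have c: "\<bar>obs.entry p y\<bar> \<le> e" using ab by simp
    have "flows (outgoing \<sigma> ?x) (b - obs.entry p y) (free_flow b (obs.scatter p y))"
      unfolding flows_outgoing[OF pre_refined[OF pre[OF y c]]] by (rule second[OF y c ab(3,4)])
    from flows_trans[OF first[OF y c ab(1,2)] this] show ?thesis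
      by simp
  qed
  have zero: "flows y b (free_flow b (obs.scatter p y))"
    if y: "y \<in> U" "y \<in> phase_space \<sigma>" and b: "obs.entry p y < b" "b \<le> e" for y b
  proof -
    \<comment> \<open>A start in the phase space has no entry in the past: either it is itself the
      collision, or the collision is still ahead.\<close>
    have "0 \<le> obs.entry p y" by (rule nonneg[OF y])
    then consider "obs.entry p y = 0" | "0 < obs.entry p y" by linarith
    then show ?thesis
    proof cases
      case 1
      then show ?thesis using second[OF y(1), of b] b eU(1) by simp
    next
      case 2
      then show ?thesis using cross[OF y(1), of 0 b] b eU(1) by simp
    qed
  qed
  have "obs.scatter p w = outgoing \<sigma> w"
    using out[OF eU(3)] entry_w eU(1) by simp
  from that[OF eU entry_w this before after cross zero] show thesis
    by blast
qed

text \<open>Across the collision the flow is the composition of free motion, scattering map and free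
  motion. The neighbourhood is cut down by a condition on the entry time, so that every nearby
  motion has completed its collision when the time is up.\<close>

lemma stable_collision:
  fixes w :: "('d, 'm) phase"
  assumes w: "w \<in> refined_phase_space \<sigma>" "pre_collisional \<sigma> w"
  shows "\<forall>\<^sub>F b in at_right 0. stable b w"
    and "\<forall>\<^sub>F a in at_right 0. \<forall>\<^sub>F b in at_right 0. stable (a + b) (free_flow (- a) w)"
proof -
  obtain p e U where eU: "e > 0" "open U" "w \<in> U" "U \<subseteq> obs.hits p"
    and entry_w: "obs.entry p w = 0" and "obs.scatter p w = outgoing \<sigma> w"
    and before: "\<And>y a. y \<in> U \<Longrightarrow> - e \<le> a \<Longrightarrow> a \<le> e \<Longrightarrow> a < obs.entry p y \<Longrightarrow> free_flow a y \<in> phase_interior \<sigma>"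
    and after: "\<And>y b. y \<in> U \<Longrightarrow> - e \<le> b \<Longrightarrow> b \<le> e \<Longrightarrow> obs.entry p y < b \<Longrightarrow> free_flow b (obs.scatter p y) \<in> phase_interior \<sigma>"
    and cross: "\<And>y a b. y \<in> U \<Longrightarrow> - e \<le> a \<Longrightarrow> a < obs.entry p y \<Longrightarrow> obs.entry p y \<le> b \<Longrightarrow> b \<le> e \<Longrightarrow>
       flows (free_flow a y) (b - a) (free_flow b (obs.scatter p y))"
    and zero: "\<And>y b. y \<in> U \<Longrightarrow> y \<in> phase_space \<sigma> \<Longrightarrow> obs.entry p y < b \<Longrightarrow> b \<le> e \<Longrightarrow>
       flows y b (free_flow b (obs.scatter p y))"
    by (rule collision_flows[OF w]) (rule that)
  have entry_cont: "continuous_on U (obs.entry p)"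
    by (rule continuous_on_subset[OF smooth_on_imp_continuous_on[OF obs.smooth_entry] eU(4)])
  have scatter_vp: "smooth_vp V (\<lambda>y. free_flow b (obs.scatter p y))" if "open V" "V \<subseteq> U" for V b
    using smooth_vp_subset[OF smooth_vp_compose[OF obs.smooth_vp_scatter smooth_vp_free_flow] that(1)] that(2) eU(4)
    by blast
  have "stable b w" if b: "0 < b" "b < e" for b
  proof (rule stableI[of "U \<inter> obs.entry p -` {..<b}" "\<lambda>y. free_flow b (obs.scatter p y)"])
    have "open (U \<inter> obs.entry p -` {..<b})"
      by (rule continuous_open_preimage[OF entry_cont eU(2)]) simp
    then show "smooth_vp (U \<inter> obs.entry p -` {..<b}) (\<lambda>y. free_flow b (obs.scatter p y))"
      by (rule scatter_vp) blast
    show "w \<in> U \<inter> obs.entry p -` {..<b}"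
      using eU(3) entry_w b by simp
    show "free_flow b (obs.scatter p w) \<in> phase_interior \<sigma>"
      using after[OF eU(3)] entry_w b by simp
    fix y assume "y \<in> U \<inter> obs.entry p -` {..<b}" and y': "y \<in> phase_space \<sigma>"
    then have y: "y \<in> U" "obs.entry p y < b" by auto
    show "flows y b (free_flow b (obs.scatter p y))"
      by (rule zero[OF y(1) y' y(2)]) (use b in simp)
  qed
  then show "\<forall>\<^sub>F b in at_right 0. stable b w"
    unfolding eventually_at_right_field using eU(1) by (intro exI[of _ e]) simp
  have "stable (a + b) (free_flow (- a) w)" if a: "0 < a" "a < e" and b: "0 < b" "b < e" for a b
  proof (rule stableI)
    let ?V = "U \<inter> obs.entry p -` {-a<..<b}"
    have V: "open ?V"
      by (rule continuous_open_preimage[OF entry_cont eU(2)]) simp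
    have "smooth_vp ?V (\<lambda>y. free_flow b (obs.scatter p y))"
      by (rule scatter_vp[OF V]) blast
    from smooth_vp_compose[OF smooth_vp_free_flow this, of a]
    show "smooth_vp (free_flow a -` ?V) (\<lambda>y. free_flow b (obs.scatter p (free_flow a y)))"
      by simp
    show "free_flow (- a) w \<in> free_flow a -` ?V"
      using eU(3) entry_w a b by simp
    show "free_flow b (obs.scatter p (free_flow a (free_flow (- a) w))) \<in> phase_interior \<sigma>"
      using after[OF eU(3)] entry_w b by simp
    show "flows y (a + b) (free_flow b (obs.scatter p (free_flow a y)))"
      if "y \<in> free_flow a -` ?V" "y \<in> phase_space \<sigma>" for y
      using cross[of "free_flow a y" "- a" b] that(1) a b by (simp add: add.commute)
  qed
  then have "\<forall>\<^sub>F b in at_right 0. stable (a + b) (free_flow (- a) w)" if "0 < a" "a < e" for a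
    using that eU(1) unfolding eventually_at_right_field by (intro exI[of _ e]) simp
  then show "\<forall>\<^sub>F a in at_right 0. \<forall>\<^sub>F b in at_right 0. stable (a + b) (free_flow (- a) w)"
    using eU(1) unfolding eventually_at_right_field[of _ 0] by (intro exI[of _ e]) simp
qed

text \<open>Real induction on time, chaining local models. Models compose only at interior
  intermediate states, so the inductive claim is conditional on an interior state. At a collision
  the chain is resumed at an interior time shortly before it and carried across in one step.\<close>

theorem flows_stable:
  assumes xy: "flows x T y" and y: "y \<in> phase_interior \<sigma>"
  shows "stable T x"
proof -
  obtain z where z: "segment T z" "z 0 = outgoing \<sigma> x" "z T = y" "x \<in> refined_phase_space \<sigma>" "0 \<le> T"
    using xy by (rule flowsE)
  note flow = segment_flows[OF z(1,2,4)]
  show ?thesis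
  proof (cases "T = 0")
    case True
    then have "x \<in> phase_interior \<sigma>"
      using interior_outgoing_iff[OF z(4)] z y by simp
    then show ?thesis using stable_interior(2) True by simp
  next
    case False
    then have "0 < T" using z by simp
    from this order_refl have "z T \<in> phase_interior \<sigma> \<longrightarrow> stable T x"
    proof (induction rule: real_induction)
      case (right t)
      note zt = segmentD(1,2)[OF z(1), of t]
      consider "t = 0" "pre_collisional \<sigma> x" | "t = 0" "\<not> pre_collisional \<sigma> x"
        | "0 < t" "z t \<in> phase_interior \<sigma>" | "0 < t" "z t \<notin> phase_interior \<sigma>"
        using right by linarith
      then have "\<forall>\<^sub>F u in at_right 0. stable (t + u) x"
      proof cases
        case 1
        then show ?thesis using stable_collision(1)[OF z(4)] by simp
      next
        case 2
        then show ?thesis using stable_departure[OF z(4)] by simp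
      next
        case 3
        then have "stable t x" using right by simp
        from stable_departure[OF zt] right show ?thesis
          by (auto elim!: eventually_mono intro: stable_trans[OF \<open>stable t x\<close> flow])
      next
        case 4
        let ?w = "incoming \<sigma> (z t)"
        have zt: "z t \<in> refined_phase_space \<sigma>" "\<not> pre_collisional \<sigma> (z t)"
          using zt right by auto
        have w: "?w \<in> refined_phase_space \<sigma>"
          by (rule outgoing_refined(6)[OF zt(1)])
        have "pre_collisional \<sigma> ?w"
          using zt(1)
        proof (cases rule: refined_cases)
          case (2 p)
          then have "rate p (z t) > 0"
            using collisional_rate(1)[OF zt(1) 2(1,2)] zt(2) by linarith
          then show ?thesis
            using outgoing_eq(2)[OF zt(1) 2(1,2)] refined_reflect[OF zt(1) 2(1,2)] 2
            by (simp add: collisional_rate(1)[of _ p])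
        qed (use 4 in simp)
        from stable_collision(2)[OF w this] arrival[OF zt(1)]
          segmentD(4)[OF z(1) 4(1) less_imp_le[OF right(2)]] eventually_at_right_small[OF 4(1)] eventually_at_right_pos
        have "\<forall>\<^sub>F a in at_right 0. (\<forall>\<^sub>F b in at_right 0. stable (a + b) (z (t - a))) \<and>
            z (t - a) \<in> phase_interior \<sigma> \<and> a < t \<and> 0 < a"
          by eventually_elim auto
        then obtain a where a: "\<forall>\<^sub>F b in at_right 0. stable (a + b) (z (t - a))"
          "z (t - a) \<in> phase_interior \<sigma>" "a < t" "0 < a"
          using eventually_at_right_witness(1) by blast
        have "stable (t - a) x"
          using right(3)[of "t - a"] a by simp
        moreover have "flows x (t - a) (z (t - a))"
          using flow a right(2) by simp
        ultimately show ?thesis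
          using a(1) by (auto elim!: eventually_mono dest!: stable_trans[of "t - a" x "z (t - a)"])
      qed
      then show ?case by (rule eventually_mono) simp
    next
      case (left t)
      show ?case
      proof
        assume zt: "z t \<in> phase_interior \<sigma>"
        have "\<forall>\<^sub>F u in at_right 0. stable u (z (t - u)) \<and> z (t - u) \<in> phase_interior \<sigma> \<and> u < t \<and> 0 < u"
          using stable_interior(1)[OF zt] arrival[OF interior_refined[OF zt]] segmentD(4)[OF z(1) left(1,2)]
            eventually_at_right_small[OF left(1)] eventually_at_right_pos
          by eventually_elim (simp add: incoming_interior[OF zt])
        then obtain u where u: "stable u (z (t - u))" "z (t - u) \<in> phase_interior \<sigma>" "u < t" "0 < u"
          using eventually_at_right_witness(1) by blast
        have "stable (t - u) x"
          using left(3)[of "t - u"] u by simp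
        from stable_trans[OF this flow u(1)] u left(2) show "stable t x"
          by simp
      qed
    qed
    then show ?thesis using z y by simp
  qed
qed

end

section \<open>Collisions do not accumulate\<close>

text \<open>Takes the place of integration along a trajectory: \<open>h\<close> may jump at
  collisions as long as it does not drop, and the collisions need not be counted.\<close>

lemma local_monotone:
  fixes h :: "real \<Rightarrow> real"
  assumes ab: "a \<le> b"
    and right: "\<And>t. a \<le> t \<Longrightarrow> t < b \<Longrightarrow> \<forall>\<^sub>F u in at_right 0. h t \<le> h (t + u)"
    and left: "\<And>t. a < t \<Longrightarrow> t \<le> b \<Longrightarrow> \<forall>\<^sub>F u in at_right 0. h (t - u) \<le> h t"
  shows "h a \<le> h b"
proof (cases "a = b")
  case False
  then have "0 < b - a" using ab by simp
  from this order_refl have "h a \<le> h (a + (b - a))"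
  proof (induction rule: real_induction)
    case (right t)
    have "h a \<le> h (a + t)"
      using right by (cases "t = 0") auto
    moreover have "\<forall>\<^sub>F u in at_right 0. h (a + t) \<le> h (a + t + u)"
      using right by (intro assms(2)) auto
    ultimately show ?case
      by (auto elim!: eventually_mono simp: add.assoc)
  next
    case (left t)
    have "\<forall>\<^sub>F u in at_right 0. h (a + t - u) \<le> h (a + t) \<and> 0 < u \<and> u < t"
      using assms(3)[of "a + t"] left eventually_at_right_small[OF left(1)] eventually_at_right_pos
      by (auto intro!: eventually_conj)
    then obtain u where u: "h (a + t - u) \<le> h (a + t)" "0 < u" "u < t"
      using eventually_at_right_witness(1) by blast
    have "h a \<le> h (a + (t - u))"
      using left(3)[of "t - u"] u by simp
    also have "\<dots> \<le> h (a + t)"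
      using u by (simp add: algebra_simps)
    finally show ?case .
  qed
  then show ?thesis by simp
qed simp

context interaction
begin

text \<open>The rate is positive because the value of a trajectory at a collision time is the
  post-collisional state.\<close>

definition hit :: "'m \<times> 'm \<times> 'm \<Rightarrow> ('d, 'm) phase \<Rightarrow> bool" where
  "hit p z \<longleftrightarrow> p \<in> triples \<and> form p z = s \<and> rate p z > 0"

text \<open>The velocity jump points along the outward normal of the obstacle, with the impulse
  \<open>c\<close> as factor; later only the positivity of \<open>c\<close> matters.\<close>

lemma kick:
  assumes z: "z \<in> refined_phase_space \<sigma>" "\<not> pre_collisional \<sigma> z"
  shows "incoming \<sigma> z = z \<or> (\<exists>p c. hit p z \<and> 0 < c \<and> incoming \<sigma> z = (fst z, snd z - c *\<^sub>R gradient p (fst z)))"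
  using z(1)
proof (cases rule: refined_cases)
  case 1
  then show ?thesis by (simp add: incoming_interior)
next
  case (2 p)
  have r: "rate p z > 0"
    using collisional_rate(1)[OF z(1) 2(1,2)] z(2) 2(3) by simp
  let ?g = "gradient p (fst z)"
  have "?g \<noteq> 0"
    using r by (auto simp: rate_def)
  then have "0 < 2 * rate p z / (?g \<bullet> ?g)"
    using r by simp
  moreover have "incoming \<sigma> z = (fst z, snd z - (2 * rate p z / (?g \<bullet> ?g)) *\<^sub>R ?g)"
    using outgoing_eq(2)[OF z(1) 2(1,2)] r by (simp add: reflect_def obs.reflection_def rate_def)
  ultimately show ?thesis
    using 2(1,2) r unfolding hit_def by blast
qed

lemma fst_incoming: "z \<in> refined_phase_space \<sigma> \<Longrightarrow> fst (incoming \<sigma> z) = fst (z :: ('d, 'm) phase)"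
  by (rule norm_outgoing(4))

text \<open>On a segment the speed is constant, so \<open>fst z \<bullet> snd z\<close> grows at a constant rate during free
  motion. By homogeneity of the quadratic forms, it increases by \<open>c * s\<close> when the velocity
  changes by \<open>c\<close> times the gradient. Hence \<open>moment\<close> measures the total impulse.\<close>

context
  fixes z :: "real \<Rightarrow> ('d, 'm) phase" and T :: real
  assumes T: "0 < T" and seg: "\<And>T'. T' < T \<Longrightarrow> segment T' z"
begin

definition speed :: real where
  "speed = norm (snd (z 0))"

definition moment :: "real \<Rightarrow> real" where
  "moment t = fst (z t) \<bullet> snd (z t) - t * speed\<^sup>2"

lemma state:
  assumes "0 \<le> t" "t < T"
  shows "z t \<in> refined_phase_space \<sigma>" "\<not> pre_collisional \<sigma> (z t)"
    "\<forall>\<^sub>F u in at_right 0. z (t + u) = free_flow u (z t)"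
    "0 < t \<Longrightarrow> \<forall>\<^sub>F u in at_right 0. z (t - u) = free_flow (- u) (incoming \<sigma> (z t))"
proof -
  obtain T' where T': "t < T'" "T' < T" using dense[OF assms(2)] by blast
  note s = segmentD[OF seg[OF T'(2)], of t]
  show "z t \<in> refined_phase_space \<sigma>" "\<not> pre_collisional \<sigma> (z t)"
    "\<forall>\<^sub>F u in at_right 0. z (t + u) = free_flow u (z t)"
    "0 < t \<Longrightarrow> \<forall>\<^sub>F u in at_right 0. z (t - u) = free_flow (- u) (incoming \<sigma> (z t))"
    using s T' assms by simp_all
qed

lemma norm_velocity:
  assumes "0 \<le> t" "t < T"
  shows "norm (snd (z t)) = speed"
proof (rule antisym)
  have right: "\<forall>\<^sub>F u in at_right 0. norm (snd (z (r + u))) = norm (snd (z r))" if "0 \<le> r" "r < t" for r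
    using state(3)[of r] that assms by (auto elim!: eventually_mono simp: free_flow_def)
  have left: "\<forall>\<^sub>F u in at_right 0. norm (snd (z (r - u))) = norm (snd (z r))" if "0 < r" "r \<le> t" for r
    using state(4)[of r] norm_outgoing(2)[OF state(1)[of r]] that assms
    by (auto elim!: eventually_mono simp: free_flow_def)
  show "speed \<le> norm (snd (z t))" unfolding speed_def
  proof (rule local_monotone[OF assms(1)])
    show "\<forall>\<^sub>F u in at_right 0. norm (snd (z r)) \<le> norm (snd (z (r + u)))" if "0 \<le> r" "r < t" for r
      using right[OF that] by (rule eventually_mono) simp
    show "\<forall>\<^sub>F u in at_right 0. norm (snd (z (r - u))) \<le> norm (snd (z r))" if "0 < r" "r \<le> t" for r
      using left[OF that] by (rule eventually_mono) simp
  qed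
  have "- norm (snd (z 0)) \<le> - norm (snd (z t))"
  proof (rule local_monotone[OF assms(1)])
    show "\<forall>\<^sub>F u in at_right 0. - norm (snd (z r)) \<le> - norm (snd (z (r + u)))" if "0 \<le> r" "r < t" for r
      using right[OF that] by (rule eventually_mono) simp
    show "\<forall>\<^sub>F u in at_right 0. - norm (snd (z (r - u))) \<le> - norm (snd (z r))" if "0 < r" "r \<le> t" for r
      using left[OF that] by (rule eventually_mono) simp
  qed
  then show "norm (snd (z t)) \<le> speed" unfolding speed_def by simp
qed

text \<open>A collision with impulse \<open>c\<close> raises \<open>moment\<close> by exactly
  \<open>c * s\<close>, since at the contact the gradient has inner product \<open>s\<close> with
  the position, and it raises the velocity component along \<open>w\<close> by at most
  \<open>c * k\<close>. Hence \<open>k / s * moment t - snd (z t) \<bullet> w\<close> never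
  decreases. The constant \<open>k\<close> may be negative, which turns the statement into a lower
  bound.\<close>

lemma impulse_bound:
  assumes ab: "0 \<le> a" "a \<le> b" "b < T"
    and hits: "\<And>p t. a < t \<Longrightarrow> t \<le> b \<Longrightarrow> hit p (z t) \<Longrightarrow> gradient p (fst (z t)) \<bullet> w \<le> k"
  shows "(snd (z b) - snd (z a)) \<bullet> w \<le> k / s * (moment b - moment a)"
proof -
  define h where "h t = k / s * moment t - snd (z t) \<bullet> w" for t
  have "h a \<le> h b"
  proof (rule local_monotone[OF ab(2)])
    fix t assume t: "a \<le> t" "t < b"
    then have "norm (snd (z t)) = speed" and free: "\<forall>\<^sub>F u in at_right 0. z (t + u) = free_flow u (z t)"
      using norm_velocity[of t] state(3)[of t] ab by auto
    then have speed: "snd (z t) \<bullet> snd (z t) = speed\<^sup>2"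
      by (simp add: power2_norm_eq_inner[symmetric])
    have "moment (t + u) = moment t" if "z (t + u) = free_flow u (z t)" for u
      unfolding moment_def that by (simp add: free_flow_def inner_add_left speed algebra_simps)
    then have "h (t + u) = h t" if "z (t + u) = free_flow u (z t)" for u
      using that by (simp add: h_def free_flow_def)
    then show "\<forall>\<^sub>F u in at_right 0. h t \<le> h (t + u)"
      using free by (auto elim!: eventually_mono)
  next
    fix t assume t: "a < t" "t \<le> b"
    then have t': "0 < t" "0 \<le> t" "t < T" using ab by auto
    note zt = state[OF t'(2,3)]
    let ?y = "incoming \<sigma> (z t)"
    have fst_y: "fst ?y = fst (z t)" by (rule fst_incoming[OF zt(1)])
    have "norm (snd ?y) = speed"
      using norm_outgoing(2)[OF zt(1)] norm_velocity[OF t'(2,3)] by simp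
    then have speed: "snd ?y \<bullet> snd ?y = speed\<^sup>2"
      by (simp add: power2_norm_eq_inner[symmetric])
    have "k / s * (fst ?y \<bullet> snd ?y - t * speed\<^sup>2) - snd ?y \<bullet> w \<le> h t"
      using kick[OF zt(1,2)]
    proof (elim disjE exE conjE)
      assume "incoming \<sigma> (z t) = z t"
      then show ?thesis by (simp add: h_def moment_def)
    next
      fix p c assume p: "hit p (z t)" and c: "0 < c"
        and y: "?y = (fst (z t), snd (z t) - c *\<^sub>R gradient p (fst (z t)))"
      have "gradient p (fst (z t)) \<bullet> fst (z t) = s"
        using p by (simp add: hit_def form_def)
      then have "fst ?y \<bullet> snd ?y = fst (z t) \<bullet> snd (z t) - c * s"
        by (simp add: y inner_diff_right inner_commute)
      then have "k / s * (fst ?y \<bullet> snd ?y - t * speed\<^sup>2) = k / s * moment t - k * c"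
        using obs.s_pos by (simp add: moment_def right_diff_distrib)
      moreover have "snd ?y \<bullet> w = snd (z t) \<bullet> w - c * (gradient p (fst (z t)) \<bullet> w)"
        by (simp add: y inner_diff_left)
      moreover have "c * (gradient p (fst (z t)) \<bullet> w) \<le> c * k"
        using hits[OF t p] c by (intro mult_left_mono) auto
      ultimately show ?thesis
        by (simp add: h_def mult.commute)
    qed
    moreover have "moment (t - u) = fst ?y \<bullet> snd ?y - t * speed\<^sup>2" if "z (t - u) = free_flow (- u) ?y" for u
      unfolding moment_def that by (simp add: free_flow_def inner_diff_left speed algebra_simps)
    then have "h (t - u) = k / s * (fst ?y \<bullet> snd ?y - t * speed\<^sup>2) - snd ?y \<bullet> w"
      if "z (t - u) = free_flow (- u) ?y" for u
      unfolding h_def using that by (simp add: free_flow_def)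
    ultimately show "\<forall>\<^sub>F u in at_right 0. h (t - u) \<le> h t"
      using zt(4)[OF t'(1)] by (auto elim!: eventually_mono)
  qed
  then show ?thesis
    by (simp add: h_def inner_diff_left right_diff_distrib)
qed

text \<open>A mean value inequality without derivatives: testing against the error vector
  \<open>w\<close> itself reduces it to monotonicity of a real function.\<close>

lemma displacement_bound:
  assumes ab: "0 \<le> a" "a \<le> b" "b < T" and k: "\<And>t. a \<le> t \<Longrightarrow> t \<le> b \<Longrightarrow> norm (snd (z t) - y) \<le> k"
  shows "norm (fst (z b) - fst (z a) - (b - a) *\<^sub>R y) \<le> k * (b - a)"
proof -
  define w where "w = fst (z b) - fst (z a) - (b - a) *\<^sub>R y"
  define h where "h t = norm w * k * t - (fst (z t) - t *\<^sub>R y) \<bullet> w" for t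
  have *: "u * ((snd (z t) - y) \<bullet> w) \<le> norm w * k * u" if "a \<le> t" "t \<le> b" "0 < u" for t u
  proof -
    have "(snd (z t) - y) \<bullet> w \<le> norm (snd (z t) - y) * norm w"
      by (rule norm_cauchy_schwarz)
    also have "\<dots> \<le> k * norm w"
      using k that by (intro mult_right_mono) auto
    finally show ?thesis using that(3) by (simp add: mult.commute)
  qed
  have "h a \<le> h b"
  proof (rule local_monotone[OF ab(2)])
    fix t assume t: "a \<le> t" "t < b"
    have "\<forall>\<^sub>F u in at_right 0. z (t + u) = free_flow u (z t)"
      using state(3)[of t] t ab by simp
    then show "\<forall>\<^sub>F u in at_right 0. h t \<le> h (t + u)"
      using eventually_at_right_pos
    proof eventually_elim
      case (elim u)
      then have "h (t + u) - h t = norm w * k * u - u * ((snd (z t) - y) \<bullet> w)"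
        by (simp add: h_def free_flow_def inner_add_left inner_diff_left algebra_simps)
      moreover have "u * ((snd (z t) - y) \<bullet> w) \<le> norm w * k * u"
        using t elim by (intro *) auto
      ultimately show ?case by linarith
    qed
  next
    fix t assume t: "a < t" "t \<le> b"
    then have backward: "\<forall>\<^sub>F u in at_right 0. z (t - u) = free_flow (- u) (incoming \<sigma> (z t))"
      using state(4)[of t] ab by simp
    have "0 < t - a" using t by simp
    from backward eventually_at_right_pos eventually_at_right_small[OF this]
    show "\<forall>\<^sub>F u in at_right 0. h (t - u) \<le> h t"
    proof (eventually_elim)
      case (elim u)
      have "fst (z (t - u)) = fst (z t) - u *\<^sub>R snd (z (t - u))"
        unfolding elim(1) using fst_incoming[OF state(1)[of t]] t ab by (simp add: free_flow_def)
      then have "fst (z t) = fst (z (t - u)) + u *\<^sub>R snd (z (t - u))"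
        by simp
      then have "h t - h (t - u) = norm w * k * u - u * ((snd (z (t - u)) - y) \<bullet> w)"
        by (simp add: h_def inner_add_left inner_diff_left algebra_simps)
      moreover have "u * ((snd (z (t - u)) - y) \<bullet> w) \<le> norm w * k * u"
        using t elim by (intro *) auto
      ultimately show ?case by linarith
    qed
  qed
  then have "w \<bullet> w \<le> norm w * k * (b - a)"
    by (simp add: h_def w_def inner_diff_left algebra_simps)
  then have "norm w * norm w \<le> norm w * (k * (b - a))"
    by (simp add: power2_norm_eq_inner[symmetric] power2_eq_square)
  moreover have "0 \<le> k * (b - a)"
  proof -
    have "0 \<le> k"
      using order_trans[OF norm_ge_zero k[OF order_refl ab(2)]] .
    then show ?thesis using ab(2) by simp
  qed
  ultimately show ?thesis
    unfolding w_def[symmetric] by (cases "norm w = 0") auto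
qed

lemma gradient_bound:
  obtains C where "C > 0" "\<And>p (x :: ((real, 'd) vec, 'm) vec). norm (gradient p x) \<le> C * norm x"
proof -
  have "\<forall>p. \<exists>K>0. \<forall>x :: ((real, 'd) vec, 'm) vec. norm (gradient p x) \<le> norm x * K"
    using bounded_linear.pos_bounded[OF obs.bounded_linear_G] by blast
  then obtain K where K: "\<And>p. K p > 0"
      "\<And>p (x :: ((real, 'd) vec, 'm) vec). norm (gradient p x) \<le> norm x * K p"
    by metis
  show thesis
  proof (rule that)
    show "(\<Sum>p\<in>UNIV. K p) > 0"
      using K by (intro sum_pos) auto
    fix p and x :: "((real, 'd) vec, 'm) vec"
    have "K p \<le> (\<Sum>p\<in>UNIV. K p)"
      using K(1) by (intro member_le_sum) (auto intro: less_imp_le)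
    then have "norm x * K p \<le> norm x * (\<Sum>p\<in>UNIV. K p)"
      by (intro mult_left_mono) auto
    then show "norm (gradient p x) \<le> (\<Sum>p\<in>UNIV. K p) * norm x"
      using K(2)[of p x] by (simp add: mult.commute)
  qed
qed

lemma speed_nonneg: "0 \<le> speed"
  by (simp add: speed_def)

lemma position_lipschitz:
  assumes "0 \<le> a" "a \<le> b" "b < T"
  shows "norm (fst (z b) - fst (z a)) \<le> speed * (b - a)"
  using displacement_bound[OF assms, of 0 speed] norm_velocity assms by simp

lemma position_bound:
  assumes "0 \<le> t" "t < T"
  shows "norm (fst (z t)) \<le> norm (fst (z 0)) + speed * T"
proof -
  have "norm (fst (z t)) \<le> norm (fst (z 0)) + norm (fst (z t) - fst (z 0))"
    by (rule norm_triangle_sub)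
  moreover have "norm (fst (z t) - fst (z 0)) \<le> speed * t"
    using position_lipschitz[of 0 t] assms by simp
  moreover have "speed * t \<le> speed * T"
    using assms speed_nonneg by (intro mult_left_mono) auto
  ultimately show ?thesis by linarith
qed

text \<open>The impulse bound with test vector 0 and \<open>k = s\<close>.\<close>

lemma moment_mono:
  assumes "0 \<le> a" "a \<le> b" "b < T"
  shows "moment a \<le> moment b"
  using impulse_bound[OF assms, of 0 s] obs.s_pos by simp

text \<open>Tested against the velocity difference itself; the normals are bounded because the
  positions stay bounded up to time \<open>T\<close>.\<close>

lemma velocity_bound:
  assumes C: "0 < C" "\<And>p (x :: ((real, 'd) vec, 'm) vec). norm (gradient p x) \<le> C * norm x"
    and ab: "0 \<le> a" "a \<le> b" "b < T"
  shows "norm (snd (z b) - snd (z a)) \<le> C * (norm (fst (z 0)) + speed * T) / s * (moment b - moment a)"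
proof -
  define R where "R = norm (fst (z 0)) + speed * T"
  define w where "w = snd (z b) - snd (z a)"
  have R: "0 \<le> R"
    unfolding R_def using speed_nonneg T by simp
  have "w \<bullet> w \<le> C * R * norm w / s * (moment b - moment a)"
    unfolding w_def
  proof (rule impulse_bound[OF ab], fold w_def)
    fix p t assume "a < t" "t \<le> b"
    then have "norm (fst (z t)) \<le> R"
      unfolding R_def using ab by (intro position_bound) auto
    then have "norm (gradient p (fst (z t))) \<le> C * R"
      using C by (meson order.strict_implies_order mult_left_mono order_trans)
    then have "norm (gradient p (fst (z t))) * norm w \<le> C * R * norm w"
      by (intro mult_right_mono) auto
    then show "gradient p (fst (z t)) \<bullet> w \<le> C * R * norm w"
      using norm_cauchy_schwarz[of "gradient p (fst (z t))" w] by linarith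
  qed
  then have le: "norm w * norm w \<le> norm w * (C * R / s * (moment b - moment a))"
    by (simp add: power2_norm_eq_inner[symmetric] power2_eq_square mult_ac)
  have ge: "0 \<le> C * R / s * (moment b - moment a)"
    using C(1) R obs.s_pos moment_mono[OF ab] by (intro mult_nonneg_nonneg divide_nonneg_pos) auto
  have "norm w \<le> C * R / s * (moment b - moment a)"
  proof (cases "norm w = 0")
    case True
    then show ?thesis using ge by (simp only:)
  next
    case False
    then have "0 < norm w" by simp
    from mult_left_le_imp_le[OF le this] show ?thesis .
  qed
  then show ?thesis
    unfolding w_def R_def .
qed

text \<open>\<open>d t\<close> is what \<open>moment\<close> still gains after time
  \<open>t\<close>, so it is the mass \<open>M\<close> of the remaining impulses up to the factor
  \<open>s\<close>. The limit state is taken along one sequence of times only; the estimates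
  \<open>V\<close>, \<open>X\<close> and \<open>E\<close> derived from it hold at every time before
  \<open>T\<close> and so control the whole trajectory.\<close>

theorem eventually_free:
  obtains t1 where "0 \<le> t1" "t1 < T" "\<And>t. t1 \<le> t \<Longrightarrow> t < T \<Longrightarrow> z t = free_flow (t - t1) (z t1)"
proof -
  obtain C where C: "C > 0" "\<And>p (x :: ((real, 'd) vec, 'm) vec). norm (gradient p x) \<le> C * norm x"
    using gradient_bound by blast
  define R where "R = norm (fst (z 0)) + speed * T"
  define K where "K = C * R / s"
  note s_pos = obs.s_pos
  have R: "0 \<le> R"
    unfolding R_def using speed_nonneg T by simp
  have K: "0 \<le> K"
    unfolding K_def using C R s_pos by simp
  \<comment> \<open>Any sequence in \<open>[0, T)\<close> that tends to \<open>T\<close> would do;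
    the index 0 gives time 0.\<close>
  define \<tau> where "\<tau> n = T - T / (real n + 1)" for n
  have \<tau>: "0 \<le> \<tau> n" "\<tau> n < T" for n
    using T by (auto simp: \<tau>_def field_simps)
  have \<tau>_lim: "\<tau> \<longlonglongrightarrow> T"
    unfolding \<tau>_def using LIMSEQ_inverse_real_of_nat tendsto_diff[OF tendsto_const tendsto_mult[OF tendsto_const LIMSEQ_inverse_real_of_nat], of T T]
    by (simp add: divide_inverse add.commute)
  have bdd: "bounded (range (\<lambda>n. z (\<tau> n)))"
  proof (rule boundedI)
    fix y assume "y \<in> range (\<lambda>n. z (\<tau> n))"
    then obtain n where y: "y = z (\<tau> n)" by blast
    have "norm y \<le> norm (fst y) + norm (snd y)"
      by (metis norm_Pair_le prod.collapse)
    then show "norm y \<le> R + speed"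
      using position_bound[OF \<tau>, of n] norm_velocity[OF \<tau>, of n] by (simp add: y R_def)
  qed
  obtain l r where lr: "strict_mono (r :: nat \<Rightarrow> nat)" "((\<lambda>n. z (\<tau> n)) \<circ> r) \<longlonglongrightarrow> l"
    using bounded_imp_convergent_subsequence[OF bdd] by metis
  define \<rho> where "\<rho> n = \<tau> (r n)" for n
  have \<rho>: "0 \<le> \<rho> n" "\<rho> n < T" for n
    using \<tau> by (auto simp: \<rho>_def)
  have \<rho>_lim: "\<rho> \<longlonglongrightarrow> T"
    using LIMSEQ_subseq_LIMSEQ[OF \<tau>_lim lr(1)] by (simp add: \<rho>_def[abs_def] o_def)
  define xs where "xs = fst l"
  define vs where "vs = snd l"
  have x_lim: "(\<lambda>n. fst (z (\<rho> n))) \<longlonglongrightarrow> xs" and v_lim: "(\<lambda>n. snd (z (\<rho> n))) \<longlonglongrightarrow> vs"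
    using tendsto_fst[OF lr(2)] tendsto_snd[OF lr(2)] by (simp_all add: o_def \<rho>_def xs_def vs_def)
  define d where "d t = (xs \<bullet> vs - T * speed\<^sup>2) - moment t" for t
  have m_lim: "(\<lambda>n. moment (\<rho> n) - moment t) \<longlonglongrightarrow> d t" for t
    unfolding moment_def[of "\<rho> _"] d_def by (intro tendsto_intros x_lim v_lim \<rho>_lim)
  have limit_le: "a \<le> b"
    if "f \<longlonglongrightarrow> a" "g \<longlonglongrightarrow> b" "t < T" "\<And>n. t \<le> \<rho> n \<Longrightarrow> f n \<le> g n" for f g :: "nat \<Rightarrow> real" and a b t
  proof (rule tendsto_le[OF trivial_limit_sequentially that(2,1)])
    show "\<forall>\<^sub>F n in sequentially. f n \<le> g n"
      using order_tendstoD(1)[OF \<rho>_lim that(3)] by (rule eventually_mono) (use that(4) in auto)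
  qed
  have d_nonneg: "0 \<le> d t" if "0 \<le> t" "t < T" for t
    by (rule limit_le[OF tendsto_const m_lim that(2)]) (use moment_mono that \<rho> in auto)
  have d_anti: "d b \<le> d a" if "0 \<le> a" "a \<le> b" "b < T" for a b
    using moment_mono[OF that] by (simp add: d_def)
  have d_lim: "(\<lambda>n. d (\<rho> n)) \<longlonglongrightarrow> 0"
  proof -
    have "(\<lambda>n. d 0 - (moment (\<rho> n) - moment 0)) \<longlonglongrightarrow> d 0 - d 0"
      by (intro tendsto_diff tendsto_const m_lim)
    moreover have "d (\<rho> n) = d 0 - (moment (\<rho> n) - moment 0)" for n
      by (simp add: d_def)
    ultimately show ?thesis by simp
  qed
  have V: "norm (vs - snd (z t)) \<le> K * d t" if t: "0 \<le> t" "t < T" for t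
  proof (rule limit_le[OF _ _ t(2)])
    show "(\<lambda>n. norm (snd (z (\<rho> n)) - snd (z t))) \<longlonglongrightarrow> norm (vs - snd (z t))"
      by (intro tendsto_intros v_lim)
    show "(\<lambda>n. K * (moment (\<rho> n) - moment t)) \<longlonglongrightarrow> K * d t"
      by (intro tendsto_mult tendsto_const m_lim)
    show "norm (snd (z (\<rho> n)) - snd (z t)) \<le> K * (moment (\<rho> n) - moment t)" if "t \<le> \<rho> n" for n
      unfolding K_def R_def by (rule velocity_bound[OF C t(1) that \<rho>(2)])
  qed
  have X: "norm (xs - fst (z t)) \<le> speed * (T - t)" if t: "0 \<le> t" "t < T" for t
  proof (rule limit_le[OF _ _ t(2)])
    show "(\<lambda>n. norm (fst (z (\<rho> n)) - fst (z t))) \<longlonglongrightarrow> norm (xs - fst (z t))"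
      by (intro tendsto_intros x_lim)
    show "(\<lambda>n. speed * (\<rho> n - t)) \<longlonglongrightarrow> speed * (T - t)"
      by (intro tendsto_intros \<rho>_lim)
    show "norm (fst (z (\<rho> n)) - fst (z t)) \<le> speed * (\<rho> n - t)" if "t \<le> \<rho> n" for n
      by (rule position_lipschitz[OF t(1) that \<rho>(2)])
  qed
  \<comment> \<open>Of second order: the position deviates from the straight line into the limit
    state by at most the velocity error times the remaining time.\<close>
  have E: "norm (xs - fst (z t) - (T - t) *\<^sub>R vs) \<le> K * d t * (T - t)" if t: "0 \<le> t" "t < T" for t
  proof (rule limit_le[OF _ _ t(2)])
    show "(\<lambda>n. norm (fst (z (\<rho> n)) - fst (z t) - (\<rho> n - t) *\<^sub>R vs)) \<longlonglongrightarrow> norm (xs - fst (z t) - (T - t) *\<^sub>R vs)"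
      by (intro tendsto_intros x_lim \<rho>_lim)
    show "(\<lambda>n. K * d t * (\<rho> n - t)) \<longlonglongrightarrow> K * d t * (T - t)"
      by (intro tendsto_intros \<rho>_lim)
    show "norm (fst (z (\<rho> n)) - fst (z t) - (\<rho> n - t) *\<^sub>R vs) \<le> K * d t * (\<rho> n - t)" if "t \<le> \<rho> n" for n
    proof (rule displacement_bound[OF t(1) that \<rho>(2)])
      fix u assume u: "t \<le> u" "u \<le> \<rho> n"
      then have u': "0 \<le> u" "u < T" using t \<rho>(2)[of n] by auto
      have "norm (snd (z u) - vs) \<le> K * d u"
        using V[OF u'] by (simp add: norm_minus_commute)
      also have "\<dots> \<le> K * d t"
        using d_anti[OF t(1) u(1) u'(2)] K by (rule mult_left_mono)
      finally show "norm (snd (z u) - vs) \<le> K * d t" .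
    qed
  qed
  have norm_vs: "norm vs = speed"
  proof (rule LIMSEQ_unique[OF tendsto_norm[OF v_lim]])
    show "(\<lambda>n. norm (snd (z (\<rho> n)))) \<longlonglongrightarrow> speed"
      using norm_velocity[OF \<rho>] by simp
  qed
  have norm_xs: "norm xs \<le> R"
    by (rule tendsto_upperbound[OF tendsto_norm[OF x_lim]]) (use position_bound[OF \<rho>] in \<open>auto simp: R_def\<close>)
  \<comment> \<open>If \<open>p\<close> is hit arbitrarily close to \<open>T\<close>, the rates at
    these hits are positive, while those formed with the velocities just before are negative. Both
    converge to \<open>gradient p xs \<bullet> vs\<close>, which is therefore 0. If the hits of
    \<open>p\<close> stop earlier, the claim is vacuous for a suitable \<open>r\<close>.\<close>
  have limit_hit: "\<exists>r. 0 \<le> r \<and> r < T \<and> (\<forall>u. r < u \<longrightarrow> u < T \<longrightarrow> hit p (z u) \<longrightarrow>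
      gradient p xs \<bullet> xs = s \<and> gradient p xs \<bullet> vs = 0)" for p
  proof (cases "\<exists>r. 0 \<le> r \<and> r < T \<and> (\<forall>u. r < u \<longrightarrow> u < T \<longrightarrow> \<not> hit p (z u))")
    case False
    have "\<exists>u r. \<rho> n < r \<and> r < u \<and> u < T \<and> hit p (z u) \<and> snd (z r) = snd (incoming \<sigma> (z u))" for n
    proof -
      obtain u where u: "\<rho> n < u" "u < T" "hit p (z u)"
        using False \<rho>[of n] by blast
      have "0 < u" "0 \<le> u" "0 < u - \<rho> n" using u \<rho>(1)[of n] by auto
      then have "\<forall>\<^sub>F r in at_right 0. z (u - r) = free_flow (- r) (incoming \<sigma> (z u)) \<and> 0 < r \<and> r < u - \<rho> n"
        using state(4)[of u] u eventually_at_right_small[of "u - \<rho> n"] eventually_at_right_pos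
        by (intro eventually_conj) auto
      then obtain r where "z (u - r) = free_flow (- r) (incoming \<sigma> (z u))" "0 < r" "r < u - \<rho> n"
        using eventually_at_right_witness(1) by blast
      then show ?thesis
        using u by (intro exI[of _ u] exI[of _ "u - r"]) (auto simp: free_flow_def)
    qed
    then obtain u r where ur: "\<And>n. \<rho> n < r n" "\<And>n. r n < u n" "\<And>n. u n < T" "\<And>n. hit p (z (u n))"
      "\<And>n. snd (z (r n)) = snd (incoming \<sigma> (z (u n)))"
      by metis
    have u_pos: "0 \<le> u n" and r_pos: "0 \<le> r n" and r_T: "r n < T" for n
      using ur(1-3)[of n] \<rho>(1)[of n] by auto
    have ux: "(\<lambda>n. fst (z (u n))) \<longlonglongrightarrow> xs"
    proof (rule Lim_null_comparison[THEN LIM_zero_cancel])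
      show "\<forall>\<^sub>F n in sequentially. norm (fst (z (u n)) - xs) \<le> speed * (T - \<rho> n)"
      proof (intro always_eventually allI)
        fix n
        have "norm (fst (z (u n)) - xs) \<le> speed * (T - u n)"
          using X[OF u_pos ur(3)] by (simp add: norm_minus_commute)
        also have "\<dots> \<le> speed * (T - \<rho> n)"
          using ur(1,2)[of n] speed_nonneg by (intro mult_left_mono) auto
        finally show "norm (fst (z (u n)) - xs) \<le> speed * (T - \<rho> n)" .
      qed
      show "(\<lambda>n. speed * (T - \<rho> n)) \<longlonglongrightarrow> 0"
        using tendsto_mult[OF tendsto_const tendsto_diff[OF tendsto_const \<rho>_lim], of speed T] by simp
    qed
    have vel: "(\<lambda>n. snd (z (y n))) \<longlonglongrightarrow> vs" if y: "\<And>n. \<rho> n < y n" "\<And>n. y n < T" for y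
    proof (rule Lim_null_comparison[THEN LIM_zero_cancel])
      show "\<forall>\<^sub>F n in sequentially. norm (snd (z (y n)) - vs) \<le> K * d (\<rho> n)"
      proof (intro always_eventually allI)
        fix n
        have "0 \<le> y n" using y(1)[of n] \<rho>(1)[of n] by simp
        then have "norm (snd (z (y n)) - vs) \<le> K * d (y n)"
          using V[OF _ y(2)] by (simp add: norm_minus_commute)
        also have "\<dots> \<le> K * d (\<rho> n)"
          using d_anti[OF \<rho>(1) less_imp_le[OF y(1)] y(2)] K by (rule mult_left_mono)
        finally show "norm (snd (z (y n)) - vs) \<le> K * d (\<rho> n)" .
      qed
      show "(\<lambda>n. K * d (\<rho> n)) \<longlonglongrightarrow> 0"
        using tendsto_mult[OF tendsto_const d_lim, of K] by simp
    qed
    have uv: "(\<lambda>n. snd (z (u n))) \<longlonglongrightarrow> vs"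
    proof (rule vel)
      show "\<rho> n < u n" for n using ur(1,2)[of n] by simp
    qed (rule ur(3))
    have rv: "(\<lambda>n. snd (z (r n))) \<longlonglongrightarrow> vs"
      by (rule vel[OF ur(1) r_T])
    have gx: "(\<lambda>n. gradient p (fst (z (u n)))) \<longlonglongrightarrow> gradient p xs"
      by (rule bounded_linear.tendsto[OF obs.bounded_linear_G ux])
    have form_u: "gradient p (fst (z (u n))) \<bullet> fst (z (u n)) = s" and rate_u: "0 \<le> gradient p (fst (z (u n))) \<bullet> snd (z (u n))" for n
      using ur(4)[of n] by (auto simp: hit_def form_def rate_def)
    have rate_r: "gradient p (fst (z (u n))) \<bullet> snd (z (r n)) \<le> 0" for n
    proof -
      have zu: "z (u n) \<in> refined_phase_space \<sigma>"
        by (rule state(1)[OF u_pos ur(3)])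
      have h: "p \<in> triples" "form p (z (u n)) = s" "rate p (z (u n)) > 0"
        using ur(4)[of n] by (auto simp: hit_def)
      have "incoming \<sigma> (z (u n)) = reflect p (z (u n))"
        using outgoing_eq(2)[OF zu h(1,2)] h(3) by simp
      then have "gradient p (fst (z (u n))) \<bullet> snd (z (r n)) = rate p (reflect p (z (u n)))"
        unfolding ur(5) by (simp add: rate_def reflect_def)
      then show ?thesis using h(3) by simp
    qed
    have "gradient p xs \<bullet> xs = s"
      using tendsto_inner[OF gx ux] unfolding form_u by (simp add: LIMSEQ_const_iff)
    moreover have "0 \<le> gradient p xs \<bullet> vs"
      by (rule tendsto_lowerbound[OF tendsto_inner[OF gx uv]]) (use rate_u in auto)
    moreover have "gradient p xs \<bullet> vs \<le> 0"
      by (rule tendsto_upperbound[OF tendsto_inner[OF gx rv]]) (use rate_r in auto)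
    ultimately show ?thesis using T by (intro exI[of _ 0]) auto
  qed blast
  then obtain r0 where r0: "\<And>p. 0 \<le> r0 p" "\<And>p. r0 p < T"
      "\<And>p u. r0 p < u \<Longrightarrow> u < T \<Longrightarrow> hit p (z u) \<Longrightarrow> gradient p xs \<bullet> xs = s \<and> gradient p xs \<bullet> vs = 0"
    by metis
  \<comment> \<open>\<open>A * \<delta>\<close> bounds how far
    \<open>gradient p (fst (z u)) \<bullet> xs\<close> can fall below \<open>s\<close> within time
    \<open>\<delta>\<close> of \<open>T\<close>, and \<open>L\<close> is the constant of the final
    quadratic estimate for \<open>d t1\<close>. The choice of \<open>\<delta>\<close> makes the
    former at most \<open>s / 2\<close> and \<open>L * \<delta>\<close> less than 1; the summands 1
    in it avoid division by zero.\<close>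
  define L where "L = 8 * (norm xs)\<^sup>2 * (C * speed * K) / s"
  define A where "A = speed * C * R"
  have L: "0 \<le> L" and A: "0 \<le> A"
    unfolding L_def A_def using C K R s_pos speed_nonneg by simp_all
  define \<delta> where "\<delta> = min (s / (2 * (A + 1))) (1 / (L + 1))"
  have \<delta>: "0 < \<delta>" "A * \<delta> \<le> s / 2" "L * \<delta> < 1"
  proof -
    show "0 < \<delta>"
      unfolding \<delta>_def using s_pos A L by simp
    have "A * \<delta> \<le> A * (s / (2 * (A + 1)))"
      unfolding \<delta>_def using A by (intro mult_left_mono) auto
    also have "\<dots> = A / (A + 1) * (s / 2)"
      unfolding times_divide_times_eq unfolding times_divide_eq_right mult.commute[of "A + 1" 2] ..
    also have "\<dots> \<le> 1 * (s / 2)"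
      using A s_pos by (intro mult_right_mono) auto
    finally show "A * \<delta> \<le> s / 2" by simp
    have "L * \<delta> \<le> L * (1 / (L + 1))"
      unfolding \<delta>_def using L by (intro mult_left_mono) auto
    also have "\<dots> < 1"
      using L by simp
    finally show "L * \<delta> < 1" .
  qed
  define t1 where "t1 = max (Max (range r0)) (T - \<delta>)"
  have r0_t1: "r0 p \<le> t1" for p
  proof -
    have "r0 p \<le> Max (range r0)"
      by (rule Max_ge) auto
    then show ?thesis unfolding t1_def by (rule max.coboundedI1)
  qed
  have t1: "0 \<le> t1" "t1 < T" "T - t1 \<le> \<delta>"
  proof -
    show "0 \<le> t1"
      using r0(1) r0_t1 order_trans by blast
    have "Max (range r0) < T"
      using r0(2) by (subst Max_less_iff) auto
    then show "t1 < T" using \<delta>(1) by (simp add: t1_def)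
    show "T - t1 \<le> \<delta>" by (simp add: t1_def)
  qed
  have hits: "gradient p xs \<bullet> xs = s" "gradient p xs \<bullet> vs = 0" if "t1 < u" "u < T" "hit p (z u)" for p u
    using r0(3)[of p u] r0_t1[of p] that by auto
  define w where "w = vs - snd (z t1)"
  \<comment> \<open>A lower bound for the impulse along \<open>xs\<close>, obtained from
    \<open>impulse_bound\<close> with test vector \<open>- xs\<close> and the negative constant
    \<open>- (s / 2)\<close>.\<close>
  have w_xs: "d t1 / 2 \<le> w \<bullet> xs"
  proof -
    have "(vs - snd (z t1)) \<bullet> (- xs) \<le> (- (s / 2)) / s * d t1"
    proof (rule limit_le[OF _ _ t1(2)])
      show "(\<lambda>n. (snd (z (\<rho> n)) - snd (z t1)) \<bullet> (- xs)) \<longlonglongrightarrow> (vs - snd (z t1)) \<bullet> (- xs)"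
        by (intro tendsto_intros v_lim)
      show "(\<lambda>n. (- (s / 2)) / s * (moment (\<rho> n) - moment t1)) \<longlonglongrightarrow> (- (s / 2)) / s * d t1"
        by (intro tendsto_mult tendsto_const m_lim)
      show "(snd (z (\<rho> n)) - snd (z t1)) \<bullet> (- xs) \<le> (- (s / 2)) / s * (moment (\<rho> n) - moment t1)"
        if "t1 \<le> \<rho> n" for n
      proof (rule impulse_bound[OF t1(1) that \<rho>(2)])
        fix p u assume u: "t1 < u" "u \<le> \<rho> n" "hit p (z u)"
        then have u': "0 \<le> u" "u < T" using t1(1) \<rho>(2)[of n] by auto
        have "gradient p (fst (z u)) \<bullet> xs = gradient p xs \<bullet> fst (z u)"
          by (rule obs.sym')
        also have "\<dots> = s - gradient p xs \<bullet> (xs - fst (z u))"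
          using hits(1)[OF u(1) u'(2) u(3)] by (simp add: inner_diff_right)
        finally have eq: "gradient p (fst (z u)) \<bullet> xs = s - gradient p xs \<bullet> (xs - fst (z u))" .
        have "gradient p xs \<bullet> (xs - fst (z u)) \<le> norm (gradient p xs) * norm (xs - fst (z u))"
          by (rule norm_cauchy_schwarz)
        also have "\<dots> \<le> (C * R) * (speed * \<delta>)"
        proof (rule mult_mono)
          show "norm (gradient p xs) \<le> C * R"
            using C(2)[of p xs] mult_left_mono[OF norm_xs, of C] C(1) by linarith
          have "norm (xs - fst (z u)) \<le> speed * (T - u)"
            by (rule X[OF u'])
          also have "\<dots> \<le> speed * \<delta>"
            using u(1) t1(3) speed_nonneg by (intro mult_left_mono) auto
          finally show "norm (xs - fst (z u)) \<le> speed * \<delta>" .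
        qed (use C R in auto)
        also have "\<dots> = A * \<delta>"
          by (simp add: A_def)
        finally show "gradient p (fst (z u)) \<bullet> (- xs) \<le> - (s / 2)"
          using eq \<delta>(2) by simp
      qed
    qed
    then show ?thesis
      using s_pos by (simp add: w_def)
  qed
  have w_vs: "w \<bullet> vs \<le> (C * speed * (K * d t1 * (T - t1))) / s * d t1"
    unfolding w_def
  proof (rule limit_le[OF _ _ t1(2)])
    let ?k = "C * speed * (K * d t1 * (T - t1))"
    show "(\<lambda>n. (snd (z (\<rho> n)) - snd (z t1)) \<bullet> vs) \<longlonglongrightarrow> (vs - snd (z t1)) \<bullet> vs"
      by (intro tendsto_intros v_lim)
    show "(\<lambda>n. ?k / s * (moment (\<rho> n) - moment t1)) \<longlonglongrightarrow> ?k / s * d t1"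
      by (intro tendsto_mult tendsto_const m_lim)
    show "(snd (z (\<rho> n)) - snd (z t1)) \<bullet> vs \<le> ?k / s * (moment (\<rho> n) - moment t1)" if "t1 \<le> \<rho> n" for n
    proof (rule impulse_bound[OF t1(1) that \<rho>(2)])
      fix p u assume u: "t1 < u" "u \<le> \<rho> n" "hit p (z u)"
      then have u': "0 \<le> u" "u < T" using t1(1) \<rho>(2)[of n] by auto
      let ?e = "xs - fst (z u) - (T - u) *\<^sub>R vs"
      have "gradient p vs \<bullet> xs = 0"
        using hits(2)[OF u(1) u'(2) u(3)] by (simp add: obs.sym'[of p vs xs])
      moreover have "fst (z u) = xs - (T - u) *\<^sub>R vs - ?e"
        by simp
      \<comment> \<open>Tangency has removed the term with \<open>xs\<close>. The term with
        \<open>vs\<close> is nonpositive since the form is semidefinite, and the error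
        \<open>?e\<close> is itself of order \<open>d t1 * (T - t1)\<close>; this extra factor
        \<open>d t1\<close> makes the bound quadratic.\<close>
      ultimately have eq: "gradient p vs \<bullet> fst (z u) = - ((T - u) * (gradient p vs \<bullet> vs)) - gradient p vs \<bullet> ?e"
        by (simp add: inner_diff_right)
      have "- (gradient p vs \<bullet> ?e) \<le> norm (gradient p vs) * norm ?e"
        using Cauchy_Schwarz_ineq2[of "gradient p vs" ?e] by linarith
      also have "\<dots> \<le> (C * speed) * (K * d t1 * (T - t1))"
      proof (rule mult_mono)
        show "norm (gradient p vs) \<le> C * speed"
          using C(2)[of p vs] by (simp add: norm_vs)
        have "norm ?e \<le> K * d u * (T - u)"
          by (rule E[OF u'])
        also have "\<dots> \<le> K * d t1 * (T - t1)"
          using d_anti[OF t1(1) less_imp_le[OF u(1)] u'(2)] d_nonneg[OF t1(1,2)] d_nonneg[OF u'] K u(1) u'(2)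
          by (intro mult_mono mult_left_mono mult_nonneg_nonneg) auto
        finally show "norm ?e \<le> K * d t1 * (T - t1)" .
      qed (use C speed_nonneg in auto)
      finally have "- (gradient p vs \<bullet> ?e) \<le> ?k" by (simp add: mult.assoc)
      moreover have "0 \<le> (T - u) * (gradient p vs \<bullet> vs)"
        using u'(2) obs.psd[of p vs] by simp
      ultimately have "gradient p vs \<bullet> fst (z u) \<le> ?k"
        unfolding eq by linarith
      then show "gradient p (fst (z u)) \<bullet> vs \<le> ?k"
        by (simp add: obs.sym'[of p "fst (z u)" vs])
    qed
  qed
  have w_sq: "(norm w)\<^sup>2 = 2 * (w \<bullet> vs)"
  proof -
    have "snd (z t1) = vs - w"
      by (simp add: w_def)
    then have "(norm (vs - w))\<^sup>2 = (norm vs)\<^sup>2"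
      using norm_velocity[OF t1(1,2)] norm_vs by simp
    then show ?thesis
      by (simp add: power2_norm_eq_inner inner_diff_left inner_diff_right inner_commute)
  qed
  \<comment> \<open>\<open>w_xs\<close> bounds \<open>d t1\<close> by a multiple of
    \<open>norm w\<close>, while \<open>w_sq\<close> and \<open>w_vs\<close> bound
    \<open>(norm w)\<^sup>2\<close> by a multiple of \<open>(T - t1) * (d t1)\<^sup>2\<close>.
    Squaring the former contradicts \<open>L * \<delta> < 1\<close> unless \<open>d t1\<close>
    vanishes, and then no impulse is left and the velocity is constant.\<close>
  have "d t1 = 0"
  proof (rule ccontr)
    assume "d t1 \<noteq> 0"
    then have d: "0 < d t1"
      using d_nonneg[OF t1(1,2)] by simp
    have "d t1 \<le> 2 * (norm w * norm xs)"
      using w_xs norm_cauchy_schwarz[of w xs] by linarith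
    then have "(d t1)\<^sup>2 \<le> (2 * (norm w * norm xs))\<^sup>2"
      using d by (intro power_mono) auto
    also have "\<dots> = 4 * (norm xs)\<^sup>2 * (norm w)\<^sup>2"
      by (simp add: power_mult_distrib)
    also have "\<dots> \<le> 4 * (norm xs)\<^sup>2 * (2 * ((C * speed * (K * d t1 * (T - t1))) / s * d t1))"
      unfolding w_sq using w_vs by (intro mult_left_mono) auto
    also have "\<dots> = L * (T - t1) * (d t1)\<^sup>2"
      by (simp add: L_def power2_eq_square)
    also have "\<dots> \<le> L * \<delta> * (d t1)\<^sup>2"
      using t1(3) L by (intro mult_right_mono mult_left_mono) auto
    also have "\<dots> < 1 * (d t1)\<^sup>2"
      using \<delta>(3) d by (intro mult_strict_right_mono) auto
    finally show False by simp
  qed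
  then have v_const: "snd (z t) = snd (z t1)" if "t1 \<le> t" "t < T" for t
  proof -
    have "0 \<le> t" using that t1(1) by simp
    then have "d t = 0"
      using d_anti[OF t1(1) that] d_nonneg[OF _ that(2)] \<open>d t1 = 0\<close> by simp
    then show ?thesis
      using V[OF \<open>0 \<le> t\<close> that(2)] V[OF t1(1,2)] \<open>d t1 = 0\<close> by simp
  qed
  show thesis
  proof (rule that[OF t1(1,2)])
    fix t assume t: "t1 \<le> t" "t < T"
    have "norm (fst (z t) - fst (z t1) - (t - t1) *\<^sub>R snd (z t1)) \<le> 0 * (t - t1)"
    proof (rule displacement_bound[OF t1(1) t])
      show "norm (snd (z u) - snd (z t1)) \<le> 0" if "t1 \<le> u" "u \<le> t" for u
        using v_const[of u] that t(2) by simp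
    qed
    then have "fst (z t) = fst (z t1) + (t - t1) *\<^sub>R snd (z t1)"
      by (simp add: algebra_simps)
    then show "z t = free_flow (t - t1) (z t1)"
      using v_const[OF t] by (simp add: free_flow_def prod_eq_iff)
  qed
qed

end

end

section \<open>Almost all trajectories are global\<close>

lemma finite_quadratic_roots:
  fixes a b c :: real
  assumes "a \<noteq> 0"
  shows "finite {r. a * r\<^sup>2 + b * r + c = 0}"
proof -
  have "finite {r. poly [:c, b, a:] r = 0}"
    by (rule poly_roots_finite) (use assms in simp)
  then show ?thesis
    by (simp add: power2_eq_square algebra_simps)
qed

lemma negligible_lines:
  fixes S :: "'a::euclidean_space set"
  assumes "S \<in> sets borel" "\<And>x. countable {t. x + t *\<^sub>R a \<in> S}"
  shows "negligible S"
  using null_set_lines[OF assms] by (simp add: negligible_iff_null_sets null_sets_completionI)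

context interaction
begin

text \<open>Free motion is followed through all obstacles and in both directions of time. This
  enlarges the set, but reduces it to counting roots of quadratic polynomials.\<close>

definition reaching_singular :: "('d, 'm) phase set" where
  "reaching_singular = {z. \<exists>t. free_flow t z \<in> singular}"

text \<open>The directions of the lines on which the exceptional sets are shown to have finite
  sections.\<close>

definition unit_displacement :: "'m \<Rightarrow> ((real, 'd) vec, 'm) vec" where
  "unit_displacement l = axis l (SOME e. norm e = 1)"

lemma norm_some_unit: "norm (SOME e :: (real, 'd) vec. norm e = 1) = 1"
  by (rule someI_ex) (metis norm_axis_1)

lemma unit_displacement_nth: "unit_displacement l $ l' = (if l' = l then SOME e. norm e = 1 else 0)"
  by (simp add: unit_displacement_def axis_def)

lemma inner_some_unit: "(SOME e :: (real, 'd) vec. norm e = 1) \<bullet> (SOME e. norm e = 1) = 1"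
  using norm_some_unit by (simp add: norm_eq_1)

text \<open>The form couples \<open>i\<close> to \<open>j\<close> and \<open>i\<close> to
  \<open>k\<close>, but not \<open>j\<close> to \<open>k\<close>. So displacements of
  \<open>j\<close> and of \<open>k\<close> are orthogonal for it, each with value 1.\<close>

lemma gradient_unit_displacement:
  assumes "i < j" "j < (k :: 'm)"
  shows "l \<in> {i, j, k} \<Longrightarrow> 0 < gradient (i, j, k) (unit_displacement l) \<bullet> unit_displacement l"
    and "l \<notin> {i, j, k} \<Longrightarrow> gradient (i, j, k) (unit_displacement l) = 0"
    and "gradient (i, j, k) (unit_displacement k) \<bullet> unit_displacement j = 0"
    and "gradient (i, j, k) (unit_displacement k) \<bullet> unit_displacement k = 1"
    and "gradient (i, j, k) (unit_displacement j) \<bullet> unit_displacement j = 1"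
proof -
  have ne: "i \<noteq> j" "i \<noteq> k" "j \<noteq> k" using assms by auto
  have ne0: "(SOME e :: (real, 'd) vec. norm e = 1) \<noteq> 0"
    using norm_some_unit by (metis norm_zero zero_neq_one)
  show "l \<in> {i, j, k} \<Longrightarrow> 0 < gradient (i, j, k) (unit_displacement l) \<bullet> unit_displacement l"
    using ne ne0 unfolding inner_gradient by (auto simp: unit_displacement_nth)
  show "l \<notin> {i, j, k} \<Longrightarrow> gradient (i, j, k) (unit_displacement l) = 0"
  proof -
    assume "l \<notin> {i, j, k}"
    then have "unit_displacement l $ i = 0" "unit_displacement l $ j = 0" "unit_displacement l $ k = 0"
      by (auto simp: unit_displacement_nth)
    then show ?thesis
      by (simp add: gradient_def vec_eq_iff axis_def)
  qed
  show "gradient (i, j, k) (unit_displacement k) \<bullet> unit_displacement j = 0"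
    "gradient (i, j, k) (unit_displacement k) \<bullet> unit_displacement k = 1"
    "gradient (i, j, k) (unit_displacement j) \<bullet> unit_displacement j = 1"
    using ne unfolding inner_gradient by (auto simp: unit_displacement_nth inner_some_unit)
qed

text \<open>An increasing triple is determined by its set of entries, so two different triples have
  different sets of size 3 and neither contains the other. Moving a particle of \<open>p\<close>
  that is not in \<open>p'\<close> leaves the form of \<open>p'\<close> alone.\<close>

lemma private_particle:
  assumes "p \<in> (triples :: ('m \<times> 'm \<times> 'm) set)" "p' \<in> triples" "p \<noteq> p'"
  obtains l where "0 < gradient p (unit_displacement l) \<bullet> unit_displacement l" "gradient p' (unit_displacement l) = 0"
proof -
  obtain i j k where p: "p = (i, j, k)" "i < j" "j < k"
    using assms(1) by (auto simp: triples_def)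
  obtain i' j' k' where p': "p' = (i', j', k')" "i' < j'" "j' < k'"
    using assms(2) by (auto simp: triples_def)
  have "\<not> {i, j, k} \<subseteq> {i', j', k'}"
  proof
    assume sub: "{i, j, k} \<subseteq> {i', j', k'}"
    have "i \<noteq> j" "i \<noteq> k" "j \<noteq> k" "i' \<noteq> j'" "i' \<noteq> k'" "j' \<noteq> k'"
      using p(2,3) p'(2,3) by auto
    then have "card {i, j, k} = 3" "card {i', j', k'} = 3"
      by simp_all
    then have eq: "{i, j, k} = {i', j', k'}"
      using card_subset_eq[OF _ sub] by simp
    have "Min {i, j, k} = i" "Min {i', j', k'} = i'" "Max {i, j, k} = k" "Max {i', j', k'} = k'"
      using p(2,3) p'(2,3) by (auto simp: min_def max_def)
    then have "i = i'" "k = k'"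
      unfolding eq by simp_all
    moreover have "j \<in> {i', j', k'}"
      using sub by simp
    ultimately show False
      using assms(3) p p' by auto
  qed
  then obtain l where l: "l \<in> {i, j, k}" "l \<notin> {i', j', k'}"
    by blast
  show thesis
    using that[of l] gradient_unit_displacement(1)[OF p(2,3) l(1)] gradient_unit_displacement(2)[OF p'(2,3) l(2)]
    by (simp add: p p')
qed

section \<open>Exceptional sets meeting lines in finitely many points\<close>

lemma form_line: "form p (z + r *\<^sub>R (\<xi>, 0)) = (gradient p \<xi> \<bullet> \<xi>) * r\<^sup>2 + 2 * (gradient p (fst z) \<bullet> \<xi>) * r + form p z"
proof -
  have eq: "fst (z + r *\<^sub>R (\<xi>, 0)) = fst z + r *\<^sub>R \<xi>" by simp
  show ?thesis
    unfolding form_def eq obs.form_flow by (simp only: ac_simps)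
qed

lemma velocity_form_line:
  "gradient p (snd (z + r *\<^sub>R (0, \<eta>))) \<bullet> snd (z + r *\<^sub>R (0, \<eta>)) =
    (gradient p \<eta> \<bullet> \<eta>) * r\<^sup>2 + 2 * (gradient p (snd (z :: ('d, 'm) phase)) \<bullet> \<eta>) * r + gradient p (snd z) \<bullet> snd z"
proof -
  have eq: "snd (z + r *\<^sub>R (0, \<eta>)) = snd z + r *\<^sub>R \<eta>" by simp
  show ?thesis
    unfolding eq obs.form_flow by (simp only: ac_simps)
qed

lemma negligible_velocity_form:
  assumes "p \<in> triples"
  shows "negligible {z :: ('d, 'm) phase. gradient p (snd z) \<bullet> snd z = 0}"
proof -
  obtain i j k where p: "p = (i, j, k)" "i < j" "j < k"
    using assms by (auto simp: triples_def)
  note g = gradient_unit_displacement(4)[OF p(2,3), folded p(1)]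
  show ?thesis
  proof (rule negligible_lines[where a = "(0, unit_displacement k)"])
    show "{z :: ('d, 'm) phase. gradient p (snd z) \<bullet> snd z = 0} \<in> sets borel"
      by (intro borel_closed closed_Collect_eq continuous_intros)
    fix z :: "('d, 'm) phase"
    have eq: "{t. z + t *\<^sub>R (0, unit_displacement k) \<in> {z. gradient p (snd z) \<bullet> snd z = 0}} = {t. 1 * t\<^sup>2 + 2 * (gradient p (snd z) \<bullet> unit_displacement k) * t + gradient p (snd z) \<bullet> snd z = 0}"
      by (simp only: mem_Collect_eq velocity_form_line g)
    show "countable {t. z + t *\<^sub>R (0, unit_displacement k) \<in> {z. gradient p (snd z) \<bullet> snd z = 0}}"
      unfolding eq by (rule countable_finite[OF finite_quadratic_roots]) simp
  qed
qed

text \<open>Moving particle \<open>k\<close> alone makes the form a monic quadratic polynomial in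
  the displacement.\<close>

lemma negligible_surface:
  assumes "p \<in> triples"
  shows "negligible {z :: ('d, 'm) phase. form p z = s}"
proof -
  obtain i j k where p: "p = (i, j, k)" "i < j" "j < k"
    using assms by (auto simp: triples_def)
  note g = gradient_unit_displacement(4)[OF p(2,3), folded p(1)]
  show ?thesis
  proof (rule negligible_lines[where a = "(unit_displacement k, 0)"])
    show "{z :: ('d, 'm) phase. form p z = s} \<in> sets borel"
      by (intro borel_closed closed_Collect_eq continuous_intros)
    fix z :: "('d, 'm) phase"
    have eq: "{t. z + t *\<^sub>R (unit_displacement k, 0) \<in> {z. form p z = s}} = {t. 1 * t\<^sup>2 + 2 * (gradient p (fst z) \<bullet> unit_displacement k) * t + (form p z - s) = 0}"
      by (simp only: mem_Collect_eq form_line g) (rule Collect_cong, linarith)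
    show "countable {t. z + t *\<^sub>R (unit_displacement k, 0) \<in> {z. form p z = s}}"
      unfolding eq by (rule countable_finite[OF finite_quadratic_roots]) simp
  qed
qed

lemma negligible_boundary: "negligible (phase_space \<sigma> - phase_interior \<sigma> :: ('d, 'm) phase set)"
proof (rule negligible_subset)
  show "negligible (\<Union>p\<in>triples. {z :: ('d, 'm) phase. form p z = s})"
    by (rule negligible_Union) (auto simp: negligible_surface)
  show "phase_space \<sigma> - phase_interior \<sigma> \<subseteq> (\<Union>p\<in>triples. {z :: ('d, 'm) phase. form p z = s})"
    by (force simp: phase_space_iff phase_interior_iff order_le_less)
qed

text \<open>Moving particle \<open>k\<close> makes the discriminant a polynomial of degree at most 2
  whose leading coefficient depends on the velocities only. The set \<open>Y\<close> where that
  coefficient vanishes is handled by varying the velocity of \<open>j\<close>: this does not change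
  the pairing with the displacement of \<open>k\<close>, while the velocity form is a monic
  quadratic in it.\<close>

lemma negligible_discr:
  assumes "p \<in> triples"
  shows "negligible {z :: ('d, 'm) phase. obs.discr p z = 0}"
proof -
  obtain i j k where p: "p = (i, j, k)" "i < j" "j < k"
    using assms by (auto simp: triples_def)
  let ?\<xi> = "unit_displacement k" and ?\<eta> = "unit_displacement j"
  note g = gradient_unit_displacement(3-5)[OF p(2,3), folded p(1)]
  define Y where "Y = {z :: ('d, 'm) phase. (gradient p (snd z) \<bullet> ?\<xi>)\<^sup>2 = gradient p (snd z) \<bullet> snd z}"
  define S where "S = {z :: ('d, 'm) phase. obs.discr p z = 0}"
  have closed_Y: "closed Y"
    unfolding Y_def by (intro closed_Collect_eq continuous_intros)
  have closed_S: "closed S"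
    unfolding S_def obs.discr_def by (intro closed_Collect_eq continuous_intros)
  have "negligible Y"
  proof (rule negligible_lines)
    show "Y \<in> sets borel" by (rule borel_closed[OF closed_Y])
    fix z :: "('d, 'm) phase"
    have "gradient p ?\<eta> \<bullet> ?\<xi> = 0"
      using g(1) by (simp add: obs.sym'[of p ?\<eta>])
    then have *: "gradient p (snd (z + t *\<^sub>R (0, ?\<eta>))) \<bullet> ?\<xi> = gradient p (snd z) \<bullet> ?\<xi>" for t
      by (simp add: obs.G_lin inner_add_left)
    have eq: "{t. z + t *\<^sub>R (0, ?\<eta>) \<in> Y} =
      {t. (-1) * t\<^sup>2 + (- 2 * (gradient p (snd z) \<bullet> ?\<eta>)) * t + ((gradient p (snd z) \<bullet> ?\<xi>)\<^sup>2 - gradient p (snd z) \<bullet> snd z) = 0}"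
      by (simp only: Y_def mem_Collect_eq * velocity_form_line g(3)) (rule Collect_cong, linarith)
    show "countable {t. z + t *\<^sub>R (0, ?\<eta>) \<in> Y}"
      unfolding eq by (rule countable_finite[OF finite_quadratic_roots]) simp
  qed
  moreover have "negligible (S - Y)"
  proof (rule negligible_lines)
    show "S - Y \<in> sets borel"
      by (intro sets.Diff borel_closed closed_Y closed_S)
    fix z :: "('d, 'm) phase"
    obtain x v where z: "z = (x, v)" by (cases z)
    show "countable {t. z + t *\<^sub>R (?\<xi>, 0) \<in> S - Y}"
    proof (cases "z \<in> Y")
      case True
      then have "{t. z + t *\<^sub>R (?\<xi>, 0) \<in> S - Y} = {}"
        by (auto simp: Y_def)
      then show ?thesis by (simp only: countable_empty)
    next
      case False
      let ?b = "gradient p v \<bullet> ?\<xi>" and ?q = "gradient p v \<bullet> v"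
      have "obs.discr p (z + t *\<^sub>R (?\<xi>, 0)) = (?b\<^sup>2 - ?q) * t\<^sup>2 +
          (2 * (gradient p x \<bullet> v) * ?b - 2 * ?q * (gradient p x \<bullet> ?\<xi>)) * t +
          ((gradient p x \<bullet> v)\<^sup>2 - ?q * (gradient p x \<bullet> x - s))" for t
      proof -
        have e1: "fst ((x, v) + t *\<^sub>R (?\<xi>, 0)) = x + t *\<^sub>R ?\<xi>" "snd ((x, v) + t *\<^sub>R (?\<xi>, 0)) = v"
          by simp_all
        have e2: "gradient p (x + t *\<^sub>R ?\<xi>) \<bullet> v = gradient p x \<bullet> v + t * ?b"
          by (simp add: obs.G_lin inner_add_left obs.sym'[of p ?\<xi> v])
        show ?thesis
          unfolding z obs.discr_def e1 e2 obs.form_flow g(2)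
          by (simp add: power2_eq_square algebra_simps)
      qed
      moreover have "?b\<^sup>2 - ?q \<noteq> 0"
        using False by (simp add: Y_def z)
      ultimately have "finite {t. obs.discr p (z + t *\<^sub>R (?\<xi>, 0)) = 0}"
        using finite_quadratic_roots by presburger
      then have "finite {t. z + t *\<^sub>R (?\<xi>, 0) \<in> S - Y}"
        by (rule rev_finite_subset) (auto simp: S_def)
      then show ?thesis by (rule countable_finite)
    qed
  qed
  ultimately have "negligible (Y \<union> (S - Y))"
    by (rule negligible_Un)
  then show ?thesis
    unfolding S_def[symmetric] by (rule negligible_subset) auto
qed

text \<open>Displacing a particle of \<open>p\<close> that \<open>p'\<close> does not contain leaves
  the contact times with \<open>p'\<close> unchanged. Away from the null set \<open>Y\<close> these
  are finite in number, and at each of them contact with \<open>p\<close> occurs for finitely many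
  displacements only.\<close>

lemma negligible_double_collision:
  assumes p: "p \<in> triples" "p' \<in> triples" "p \<noteq> p'"
  shows "negligible {z :: ('d, 'm) phase. \<exists>t. form p (free_flow t z) = s \<and> form p' (free_flow t z) = s}"
proof -
  obtain l where l: "0 < gradient p (unit_displacement l) \<bullet> unit_displacement l" "gradient p' (unit_displacement l) = 0"
    by (rule private_particle[OF p])
  let ?\<xi> = "unit_displacement l"
  define Y where "Y = {z :: ('d, 'm) phase. gradient p' (snd z) \<bullet> snd z = 0}"
  define C where "C = {w :: real \<times> ('d, 'm) phase. form p (free_flow (fst w) (snd w)) = s}
      \<inter> {w. form p' (free_flow (fst w) (snd w)) = s}"
  define S where "S = {z. \<exists>t. (t, z) \<in> C}"
  have closed_C: "closed C"
    unfolding C_def by (intro closed_Int closed_Collect_eq continuous_intros)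
  have closed_Y: "closed Y"
    unfolding Y_def by (intro closed_Collect_eq continuous_intros)
  \<comment> \<open>Measurability in spite of the existential time: over a compact range of times
    the projection of a closed set is closed.\<close>
  have "S = (\<Union>n. {z. \<exists>t. t \<in> {- real n..real n} \<and> (t, z) \<in> C})"
  proof (intro equalityI subsetI)
    fix z assume "z \<in> S"
    then obtain t where t: "(t, z) \<in> C" by (auto simp: S_def)
    obtain n where "\<bar>t\<bar> \<le> real n" using real_arch_simple by blast
    then have "t \<in> {- real n..real n}" by auto
    then show "z \<in> (\<Union>n. {z. \<exists>t. t \<in> {- real n..real n} \<and> (t, z) \<in> C})"
      using t by blast
  qed (auto simp: S_def)
  also have "\<dots> \<in> sets borel"
    by (intro sets.countable_UN image_subsetI borel_closed closed_compact_projection closed_C) auto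
  finally have S: "S \<in> sets borel" .
  have "negligible Y"
    unfolding Y_def by (rule negligible_velocity_form[OF p(2)])
  moreover have "negligible (S - Y)"
  proof (rule negligible_lines)
    show "S - Y \<in> sets borel"
      by (intro sets.Diff S borel_closed closed_Y)
    fix z :: "('d, 'm) phase"
    show "countable {r. z + r *\<^sub>R (?\<xi>, 0) \<in> S - Y}"
    proof (cases "z \<in> Y")
      case True
      then have "{r. z + r *\<^sub>R (?\<xi>, 0) \<in> S - Y} = {}"
        by (auto simp: Y_def)
      then show ?thesis by (simp only: countable_empty)
    next
      case False
      have shift: "free_flow t (z + r *\<^sub>R (?\<xi>, 0)) = free_flow t z + r *\<^sub>R (?\<xi>, 0)" for t r
        by (simp add: free_flow_def prod_eq_iff)
      have p'_const: "form p' (free_flow t z + r *\<^sub>R (?\<xi>, 0)) = form p' (free_flow t z)" for t r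
        unfolding form_line using l(2) obs.sym'[of p' "fst (free_flow t z)" ?\<xi>] by simp
      define A where "A = {t. form p' (free_flow t z) = s}"
      have "A = {t. (gradient p' (snd z) \<bullet> snd z) * t\<^sup>2 + 2 * rate p' z * t + (form p' z - s) = 0}"
        by (auto simp: A_def form_flow algebra_simps)
      then have "finite A"
        using False finite_quadratic_roots by (simp add: Y_def)
      moreover have "finite {r. form p (free_flow t z + r *\<^sub>R (?\<xi>, 0)) = s}" for t
      proof -
        have "{r. form p (free_flow t z + r *\<^sub>R (?\<xi>, 0)) = s} = {r. (gradient p ?\<xi> \<bullet> ?\<xi>) * r\<^sup>2 +
            2 * (gradient p (fst (free_flow t z)) \<bullet> ?\<xi>) * r + (form p (free_flow t z) - s) = 0}"
          by (simp only: form_line) (rule Collect_cong, linarith)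
        then show ?thesis using l(1) finite_quadratic_roots by simp
      qed
      ultimately have "finite (\<Union>t\<in>A. {r. form p (free_flow t z + r *\<^sub>R (?\<xi>, 0)) = s})"
        by simp
      then have "finite {r. z + r *\<^sub>R (?\<xi>, 0) \<in> S - Y}"
      proof (rule rev_finite_subset, intro subsetI)
        fix r assume "r \<in> {r. z + r *\<^sub>R (?\<xi>, 0) \<in> S - Y}"
        then obtain t where "form p (free_flow t (z + r *\<^sub>R (?\<xi>, 0))) = s"
            "form p' (free_flow t (z + r *\<^sub>R (?\<xi>, 0))) = s"
          unfolding S_def C_def mem_Collect_eq Diff_iff Int_iff fst_conv snd_conv by blast
        then show "r \<in> (\<Union>t\<in>A. {r. form p (free_flow t z + r *\<^sub>R (?\<xi>, 0)) = s})"
          unfolding shift p'_const A_def by blast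
      qed
      then show ?thesis by (rule countable_finite)
    qed
  qed
  ultimately have "negligible (Y \<union> (S - Y))"
    by (rule negligible_Un)
  then show ?thesis
    by (rule negligible_subset) (auto simp: S_def C_def)
qed

text \<open>A grazing contact makes the discriminant vanish, and the discriminant is constant along
  free motion. So grazing at any time whatsoever is a single equation for the initial state.\<close>

lemma negligible_reaching_singular: "negligible reaching_singular"
proof (rule negligible_subset)
  let ?D = "\<lambda>r. {z :: ('d, 'm) phase. \<exists>t. form (fst r) (free_flow t z) = s \<and> form (snd r) (free_flow t z) = s}"
  let ?B = "(\<Union>r\<in>{r \<in> triples \<times> triples. fst r \<noteq> snd r}. ?D r) \<union> (\<Union>p\<in>triples. {z :: ('d, 'm) phase. obs.discr p z = 0})"
  have D: "negligible (?D r)" if "r \<in> {r \<in> triples \<times> triples. fst r \<noteq> snd r}" for r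
    using that by (intro negligible_double_collision) auto
  have E: "negligible {z :: ('d, 'm) phase. obs.discr p z = 0}" if "p \<in> triples" for p
    by (rule negligible_discr[OF that])
  show "negligible ?B"
  proof (intro negligible_Un negligible_Union)
    show "negligible S" if "S \<in> ?D ` {r \<in> triples \<times> triples. fst r \<noteq> snd r}" for S
      using that D by blast
    show "negligible S" if "S \<in> (\<lambda>p. {z :: ('d, 'm) phase. obs.discr p z = 0}) ` triples" for S
      using that E by blast
  qed auto
  show "reaching_singular \<subseteq> ?B"
  proof
    fix z assume "z \<in> reaching_singular"
    then obtain t where "free_flow t z \<in> singular" by (auto simp: reaching_singular_def)
    then show "z \<in> ?B"
    proof (cases rule: singularE)
      case (1 p p')
      then show ?thesis by (intro UnI1 UN_I[of "(p, p')"]) auto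
    next
      case (2 p)
      have "obs.discr p (free_flow t z) = 0"
        using 2 by (simp add: obs.discr_def form_def rate_def)
      then have "obs.discr p z = 0"
        using obs.discr_flow[of p "fst z" t "snd z"] by (simp add: free_flow_def)
      then show ?thesis using 2(1) by (intro UnI2 UN_I[of p]) auto
    qed
  qed
qed

subsection \<open>The flow between interior states\<close>

text \<open>With both endpoints interior the set is open, and following the flow and then reversing
  velocities leads back into it.\<close>

definition flow_domain :: "real \<Rightarrow> ('d, 'm) phase set" where
  "flow_domain t = {x \<in> phase_interior \<sigma>. \<exists>y\<in>phase_interior \<sigma>. flows x t y}"

definition flow_map :: "real \<Rightarrow> ('d, 'm) phase \<Rightarrow> ('d, 'm) phase" where
  "flow_map t x = (THE y. flows x t y)"

lemma flow_map_eq: "flows x t y \<Longrightarrow> flow_map t x = y"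
  unfolding flow_map_def using flows_unique by blast

lemma flow_domainI: "x \<in> phase_interior \<sigma> \<Longrightarrow> y \<in> phase_interior \<sigma> \<Longrightarrow> flows x t y \<Longrightarrow> x \<in> flow_domain t"
  unfolding flow_domain_def by blast

lemma flow_domainD:
  assumes "x \<in> flow_domain t"
  shows "flows x t (flow_map t x)" "flow_map t x \<in> phase_interior \<sigma>" "x \<in> phase_interior \<sigma>"
proof -
  obtain y where y: "x \<in> phase_interior \<sigma>" "y \<in> phase_interior \<sigma>" "flows x t y"
    using assms unfolding flow_domain_def by blast
  then show "flows x t (flow_map t x)" "flow_map t x \<in> phase_interior \<sigma>" "x \<in> phase_interior \<sigma>"
    using flow_map_eq[OF y(3)] by simp_all
qed

lemma flow_map_local:
  assumes "x \<in> flow_domain t"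
  obtains U F where "smooth_vp U F" "x \<in> U" "U \<subseteq> flow_domain t" "\<And>y. y \<in> U \<Longrightarrow> flow_map t y = F y"
proof -
  obtain U F where F: "smooth_vp U F" "x \<in> U" "\<forall>y\<in>U. F y \<in> phase_interior \<sigma>" "\<forall>y\<in>U \<inter> phase_space \<sigma>. flows y t (F y)"
    using flows_stable[OF flow_domainD(1,2)[OF assms]] unfolding stable_def by blast
  have int: "y \<in> phase_space \<sigma>" if "y \<in> phase_interior \<sigma>" for y :: "('d, 'm) phase"
    using that interior_refined refined_phase_space by blast
  show thesis
  proof (rule that[of "U \<inter> phase_interior \<sigma>" F])
    show "smooth_vp (U \<inter> phase_interior \<sigma>) F"
      by (rule smooth_vp_subset[OF F(1)]) (use F(1) open_interior in \<open>auto simp: smooth_vp_def\<close>)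
    show "x \<in> U \<inter> phase_interior \<sigma>"
      using F(2) flow_domainD(3)[OF assms] by blast
    show "U \<inter> phase_interior \<sigma> \<subseteq> flow_domain t"
      using F(3,4) int flow_domainI by blast
    show "flow_map t y = F y" if "y \<in> U \<inter> phase_interior \<sigma>" for y
      using F(4) int flow_map_eq that by blast
  qed
qed

lemma flow_map_derivative:
  assumes "x \<in> flow_domain t"
  shows "\<exists>D. (flow_map t has_derivative D) (at x) \<and> volume_preserving D"
proof -
  obtain U F where F: "smooth_vp U F" "x \<in> U" "\<And>y. y \<in> U \<Longrightarrow> flow_map t y = F y"
    by (rule flow_map_local[OF assms]) (rule that)
  obtain D where D: "(F has_derivative D) (at x)" "volume_preserving D" and "open U"
    using F(1,2) unfolding smooth_vp_def by blast
  have "(flow_map t has_derivative D) (at x)"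
    by (rule has_derivative_transform_within_open[OF D(1) \<open>open U\<close> F(2)]) (simp add: F(3))
  then show ?thesis using D(2) by blast
qed

text \<open>Running the reversed final state forward for the same time returns the reversed initial
  state.\<close>

lemma inj_on_flow_map: "inj_on (flow_map t) (flow_domain t)"
proof (rule inj_onI)
  fix x y assume x: "x \<in> flow_domain t" and y: "y \<in> flow_domain t" and eq: "flow_map t x = flow_map t y"
  have "outgoing \<sigma> (reversal x) = outgoing \<sigma> (reversal y)"
    using flows_unique[OF flows_reversal[OF flow_domainD(1)[OF x]]] flows_reversal[OF flow_domainD(1)[OF y]]
    by (simp add: eq)
  then have "reversal x = reversal y"
    using flow_domainD(3)[OF x] flow_domainD(3)[OF y] by (simp add: outgoing_interior)
  then have "reversal (reversal x) = reversal (reversal y)" by simp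
  then show "x = y" by simp
qed

lemma flow_map_volume:
  assumes "S \<in> sets lebesgue" "S \<subseteq> flow_domain t"
  shows "flow_map t ` S \<in> sets lebesgue" "emeasure lebesgue (flow_map t ` S) = emeasure lebesgue S"
proof -
  have "\<forall>x\<in>S. \<exists>D. (flow_map t has_derivative D) (at x) \<and> volume_preserving D"
    using flow_map_derivative assms(2) by blast
  from bchoice[OF this] obtain D
    where D: "\<forall>x\<in>S. (flow_map t has_derivative D x) (at x) \<and> volume_preserving (D x)" ..
  note image = volume_preserving_image[OF assms(1) inj_on_subset[OF inj_on_flow_map assms(2)], of D]
  show "flow_map t ` S \<in> sets lebesgue"
    by (rule image(1)) (simp_all add: D)
  show "emeasure lebesgue (flow_map t ` S) = emeasure lebesgue S"
    by (rule image(2)) (simp_all add: D)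
qed

lemma reversal_flow_domain:
  assumes "x \<in> flow_domain t"
  shows "reversal (flow_map t x) \<in> flow_domain t" "flow_map t (reversal (flow_map t x)) = reversal x"
proof -
  have "flows (reversal (flow_map t x)) t (reversal x)"
    using flows_reversal[OF flow_domainD(1)[OF assms]] flow_domainD(3)[OF assms] by (simp add: outgoing_interior)
  note * = this
  show "reversal (flow_map t x) \<in> flow_domain t"
    by (rule flow_domainI[OF _ _ *]) (simp_all add: flow_domainD(2,3)[OF assms])
  show "flow_map t (reversal (flow_map t x)) = reversal x"
    by (rule flow_map_eq[OF *])
qed

lemma negligible_reversal: "negligible A \<Longrightarrow> negligible (reversal ` A)"
  using smooth_vp_reversal unfolding smooth_vp_def
  by (intro negligible_differentiable_image_negligible)
    (auto simp: differentiable_on_def differentiable_def intro: has_derivative_at_withinI)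

text \<open>By reversibility a preimage under the flow map is contained in an image under it, up to
  reversing velocities before and after, and differentiable maps send null sets to null
  sets.\<close>

lemma negligible_flow_preimage:
  assumes "negligible A"
  shows "negligible {x \<in> flow_domain t. flow_map t x \<in> A}"
proof (rule negligible_subset)
  let ?B = "flow_domain t \<inter> reversal ` A"
  have "negligible ?B"
    by (rule negligible_subset[OF negligible_reversal[OF assms]]) auto
  moreover have "flow_map t differentiable_on ?B"
    unfolding differentiable_on_def differentiable_def
    using flow_map_derivative has_derivative_at_withinI by blast
  ultimately have "negligible (flow_map t ` ?B)"
    by (intro negligible_differentiable_image_negligible) auto
  then show "negligible (reversal ` flow_map t ` ?B)"
    by (rule negligible_reversal)
  show "{x \<in> flow_domain t. flow_map t x \<in> A} \<subseteq> reversal ` flow_map t ` ?B"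
  proof
    fix x assume "x \<in> {x \<in> flow_domain t. flow_map t x \<in> A}"
    then have x: "x \<in> flow_domain t" "flow_map t x \<in> A" by auto
    then have "reversal (flow_map t x) \<in> ?B"
      using reversal_flow_domain(1) by blast
    moreover have "x = reversal (flow_map t (reversal (flow_map t x)))"
      using reversal_flow_domain(2)[OF x(1)] by simp
    ultimately show "x \<in> reversal ` flow_map t ` ?B" by blast
  qed
qed

section \<open>Trajectories that break down after a finite time\<close>

lemma segment_cong:
  assumes "segment T z" "\<And>t. 0 \<le> t \<Longrightarrow> t \<le> T \<Longrightarrow> y t = z t"
  shows "segment T y"
  unfolding segment_def
proof (intro conjI allI impI)
  fix t assume t: "0 \<le> t" "t \<le> T"
  show "y t \<in> refined_phase_space \<sigma>" "\<not> pre_collisional \<sigma> (y t)"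
    using segmentD(1,2)[OF assms(1) t] assms(2)[OF t] by auto
next
  fix t assume t: "0 \<le> t" "t < T"
  then have "0 < T - t" by simp
  from segmentD(3)[OF assms(1) t] eventually_at_right_small[OF this] eventually_at_right_pos
  show "\<forall>\<^sub>F u in at_right 0. y (t + u) = free_flow u (y t)"
    by eventually_elim (use t assms(2) in auto)
next
  fix t assume t: "0 < t" "t \<le> T"
  from segmentD(4)[OF assms(1) t] eventually_at_right_small[OF t(1)] eventually_at_right_pos
  show "\<forall>\<^sub>F u in at_right 0. y (t - u) = free_flow (- u) (incoming \<sigma> (y t))"
    by eventually_elim (use t assms(2) in auto)
qed

definition forward_global :: "('d, 'm) phase \<Rightarrow> bool" where
  "forward_global x \<longleftrightarrow> (\<forall>T\<ge>0. \<exists>y. flows x T y)"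

text \<open>Free motion traced back from a departing state enters the obstacle, because for short
  times the linear term dominates the quadratic one.\<close>

lemma backward_phase_space:
  assumes p: "p \<in> triples" "form p w = s" "0 < rate p w"
  shows "\<forall>\<^sub>F u in at_right 0. free_flow (- u) w \<notin> phase_space \<sigma>"
proof -
  let ?q = "gradient p (snd w) \<bullet> snd w"
  have q: "0 \<le> ?q" by (rule obs.psd)
  \<comment> \<open>The summand 1 keeps the denominator positive when the velocity form
    \<open>?q\<close> vanishes.\<close>
  have "0 < rate p w / (?q + 1)"
    using p(3) q by simp
  from eventually_at_right_small[OF this] eventually_at_right_pos show ?thesis
  proof eventually_elim
    case (elim u)
    have "u * (?q + 1) < rate p w"
      using elim q by (simp add: pos_less_divide_eq)
    then have "u * (u * (?q + 1)) < u * rate p w"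
      using elim(2) by (intro mult_strict_left_mono)
    moreover have "0 < u * u" "0 < u * rate p w"
      using elim(2) p(3) by auto
    ultimately have "u * (u * ?q) < 2 * (u * rate p w)"
      by (simp add: distrib_left)
    then have "form p (free_flow (- u) w) < s"
      unfolding form_flow p(2) by (simp add: power2_eq_square mult.assoc)
    then show ?case
      using p(1) by (auto simp: phase_space_iff not_le)
  qed
qed

text \<open>The last stretch before \<open>T\<close> is free and ends at a limit state
  \<open>w\<close> in the closed phase space. Were \<open>w\<close> not singular,
  \<open>flows_step\<close> would carry the motion to time \<open>T\<close>. So \<open>w\<close> is
  singular, and every state on the stretch reaches it by free motion.\<close>

lemma continuation:
  assumes T: "0 < T" and ex: "\<And>T'. 0 \<le> T' \<Longrightarrow> T' < T \<Longrightarrow> \<exists>y. flows x T' y" and no: "\<nexists>y. flows x T y"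
  obtains t1 where "0 \<le> t1" "t1 < T"
    "\<And>t. t1 < t \<Longrightarrow> t < T \<Longrightarrow> flow_map t x \<in> phase_interior \<sigma> \<inter> reaching_singular"
proof -
  define z where "z t = flow_map t x" for t
  have fl: "flows x t (z t)" if "0 \<le> t" "t < T" for t
    using ex[OF that] flow_map_eq unfolding z_def by blast
  have seg: "segment T' z" if T': "T' < T" for T'
  proof (cases "0 \<le> T'")
    case True
    obtain y where y: "segment T' y" "y 0 = outgoing \<sigma> x" "x \<in> refined_phase_space \<sigma>"
      using fl[OF True T'] by (rule flowsE) (rule that)
    show ?thesis
    proof (rule segment_cong[OF y(1)])
      show "z t = y t" if "0 \<le> t" "t \<le> T'" for t
        unfolding z_def by (rule flow_map_eq[OF segment_flows[OF y that]])
    qed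
  next
    case False
    then show ?thesis by (simp add: segment_def)
  qed
  obtain t1 where t1: "0 \<le> t1" "t1 < T" and free: "\<And>t. t1 \<le> t \<Longrightarrow> t < T \<Longrightarrow> z t = free_flow (t - t1) (z t1)"
    by (rule eventually_free[OF T seg]) (assumption | rule that)+
  have z_shift: "z t' = free_flow (t' - t) (z t)" if "t1 \<le> t" "t < T" "t1 \<le> t'" "t' < T" for t t'
    using free[OF that(1,2)] free[OF that(3,4)] by simp
  have zt: "z t \<in> refined_phase_space \<sigma>" "\<not> pre_collisional \<sigma> (z t)" "z t \<in> phase_space \<sigma>" if "t1 \<le> t" "t < T" for t
    using flowsD(3,4)[OF fl[of t]] refined_phase_space that t1 by auto
  \<comment> \<open>A contact after \<open>t1\<close> would be post-collisional, and the free motion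
    leading to it would have come out of the obstacle.\<close>
  have z_int: "z t \<in> phase_interior \<sigma>" if t: "t1 < t" "t < T" for t
    using zt(1)[OF less_imp_le[OF t(1)] t(2)]
  proof (cases rule: refined_cases)
    case (2 p)
    note zt' = zt[OF less_imp_le[OF t(1)] t(2)]
    have "0 < rate p (z t)"
      using collisional_rate(1)[OF zt'(1) 2(1,2)] zt'(2) 2(3) by simp
    from backward_phase_space[OF 2(1,2) this] have "\<exists>u>0. u < t - t1 \<and> free_flow (- u) (z t) \<notin> phase_space \<sigma>"
      using eventually_at_right_witness(2)[of _ "t - t1"] t(1) by simp
    then obtain u where u: "0 < u" "u < t - t1" "free_flow (- u) (z t) \<notin> phase_space \<sigma>"
      by blast
    have "z (t - u) = free_flow (- u) (z t)"
      using z_shift[of t "t - u"] t u by simp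
    then show ?thesis
      using zt(3)[of "t - u"] u t by simp
  qed
  define w where "w = free_flow (T - t1) (z t1)"
  have w_back: "z t = free_flow (t - T) w" if "t1 \<le> t" "t < T" for t
    using free[OF that] by (simp add: w_def)
  have w_ps: "w \<in> phase_space \<sigma>"
  proof (rule closed_sequentially[OF closed_phase_space])
    define a where "a n = T - (T - t1) * inverse (real (Suc n))" for n
    have a: "t1 \<le> a n" "a n < T" for n
    proof -
      have "(T - t1) * inverse (real (Suc n)) \<le> (T - t1) * 1"
        using t1(2) by (intro mult_left_mono) (auto simp: field_simps)
      moreover have "0 < (T - t1) * inverse (real (Suc n))"
        using t1(2) by simp
      ultimately show "t1 \<le> a n" "a n < T"
        unfolding a_def by simp_all
    qed
    show "z (a n) \<in> phase_space \<sigma>" for n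
      by (rule zt(3)[OF a])
    have "a \<longlonglongrightarrow> T"
      using tendsto_diff[OF tendsto_const tendsto_mult[OF tendsto_const LIMSEQ_inverse_real_of_nat], of T "T - t1"]
      by (simp add: a_def[abs_def])
    then have "(\<lambda>n. free_flow (a n - T) w) \<longlonglongrightarrow> free_flow (T - T) w"
      unfolding free_flow_def by (intro tendsto_intros)
    then show "(\<lambda>n. z (a n)) \<longlonglongrightarrow> w"
      using w_back[OF a] by simp
  qed
  have "w \<in> singular"
  proof (rule ccontr)
    assume "w \<notin> singular"
    then have w: "w \<in> refined_phase_space \<sigma>"
      using w_ps by (simp add: refined_iff)
    \<comment> \<open>Free motion traced back from \<open>w\<close> is the trajectory itself, which
      stays out of the obstacles before \<open>T\<close>.\<close>
    have not_post: "\<not> post_collisional \<sigma> w"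
    proof
      assume "post_collisional \<sigma> w"
      then obtain p where "p \<in> triples" "form p w = s" "0 < rate p w"
        using pre_collisional_iff(2)[OF w] by blast
      from backward_phase_space[OF this] have "\<exists>u>0. u < T - t1 \<and> free_flow (- u) w \<notin> phase_space \<sigma>"
        using eventually_at_right_witness(2)[of _ "T - t1"] t1(2) by simp
      then obtain u where u: "0 < u" "u < T - t1" "free_flow (- u) w \<notin> phase_space \<sigma>"
        by blast
      then show False
        using w_back[of "T - u"] zt(3)[of "T - u"] by simp
    qed
    define t where "t = (t1 + T) / 2"
    have t: "t1 < t" "t < T" "0 \<le> t" using t1 by (auto simp: t_def)
    have eq: "free_flow (T - t) (z t) = w"
      using w_back[OF less_imp_le[OF t(1)] t(2)] by simp
    have "flows (z t) (T - t) (outgoing \<sigma> (free_flow (T - t) (z t)))"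
    proof (rule flows_step)
      show "free_flow u (z t) \<in> phase_interior \<sigma>" if "0 < u" "u < T - t" for u
        using z_shift[of t "t + u"] z_int[of "t + u"] t that by simp
      show "z t \<in> refined_phase_space \<sigma>" "\<not> pre_collisional \<sigma> (z t)"
        using zt t by auto
    qed (use t w not_post eq in auto)
    from flows_trans[OF fl[OF t(3,2)] this] have "flows x T (outgoing \<sigma> w)"
      by (simp add: eq)
    then show False using no by blast
  qed
  then have "z t \<in> reaching_singular" if "t1 < t" "t < T" for t
    unfolding reaching_singular_def using w_back[of t] that by (auto intro!: exI[of _ "T - t"])
  then show thesis
    using that[OF t1] z_int unfolding z_def by blast
qed

text \<open>The first time \<open>T\<close> of failure is attained, since existence always continues
  a little further. All states on a stretch just before \<open>T\<close> aim at a singular contact;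
  choosing a rational time there makes the union over all failures countable.\<close>

lemma not_forward_global:
  assumes x: "x \<in> phase_interior \<sigma>" and not: "\<not> forward_global x"
  obtains t where "t \<in> \<rat>" "x \<in> flow_domain t" "flow_map t x \<in> reaching_singular"
proof -
  define A where "A = {T. 0 \<le> T \<and> (\<nexists>y. flows x T y)}"
  define T where "T = Inf A"
  have ne: "A \<noteq> {}"
    using not by (auto simp: A_def forward_global_def)
  have bdd: "bdd_below A"
    by (rule bdd_belowI[of _ 0]) (simp add: A_def)
  have T0: "0 \<le> T"
    unfolding T_def using ne by (rule cInf_greatest) (simp add: A_def)
  have ex: "\<exists>y. flows x T' y" if "0 \<le> T'" "T' < T" for T'
  proof (rule ccontr)
    assume "\<nexists>y. flows x T' y"
    then have "T \<le> T'"
      unfolding T_def using that by (intro cInf_lower[OF _ bdd]) (simp add: A_def)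
    then show False using that by simp
  qed
  have no: "\<nexists>y. flows x T y"
  proof
    assume "\<exists>y. flows x T y"
    then obtain y where y: "flows x T y" by blast
    obtain e where e: "e > 0" "\<And>u. 0 < u \<Longrightarrow> u < e \<Longrightarrow> flows x (T + u) (free_flow u y)"
      using flows_extend[OF y] unfolding eventually_at_right_field by auto
    have "T + e \<le> T"
      unfolding T_def
    proof (rule cInf_greatest[OF ne], fold T_def, rule ccontr)
      fix T' assume T': "T' \<in> A" "\<not> T + e \<le> T'"
      have "T \<le> T'"
        unfolding T_def using T'(1) bdd by (rule cInf_lower)
      moreover have "T \<noteq> T'"
        using y T'(1) by (auto simp: A_def)
      ultimately have "flows x (T + (T' - T)) (free_flow (T' - T) y)"
        using T'(2) by (intro e(2)) auto
      then show False using T'(1) by (auto simp: A_def)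
    qed
    then show False using e(1) by simp
  qed
  have "T \<noteq> 0"
    using no flows_zero[OF interior_refined[OF x]] by auto
  then have "0 < T" using T0 by simp
  obtain t1 where t1: "0 \<le> t1" "t1 < T"
    "\<And>t. t1 < t \<Longrightarrow> t < T \<Longrightarrow> flow_map t x \<in> phase_interior \<sigma> \<inter> reaching_singular"
    by (rule continuation[OF \<open>0 < T\<close> ex no]) (assumption | rule that)+
  obtain t where t: "t \<in> \<rat>" "t1 < t" "t < T"
    using Rats_dense_in_real[OF t1(2)] by blast
  have "\<exists>y. flows x t y" using ex[of t] t t1 by simp
  then have "flows x t (flow_map t x)" using flow_map_eq by blast
  then have "x \<in> flow_domain t"
    using flow_domainI[OF x] t1(3)[OF t(2,3)] by blast
  then show thesis using that t t1(3)[OF t(2,3)] by blast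
qed

lemma negligible_not_forward_global: "negligible {x \<in> phase_interior \<sigma>. \<not> forward_global x}"
proof (rule negligible_subset)
  show "negligible (\<Union>t\<in>\<rat>. {x \<in> flow_domain t. flow_map t x \<in> reaching_singular})"
    by (intro negligible_countable_Union countable_image countable_rat)
      (auto intro!: negligible_flow_preimage negligible_reaching_singular)
  show "{x \<in> phase_interior \<sigma>. \<not> forward_global x} \<subseteq> (\<Union>t\<in>\<rat>. {x \<in> flow_domain t. flow_map t x \<in> reaching_singular})"
    using not_forward_global by blast
qed

end

section \<open>The flow\<close>

context interaction
begin

text \<open>Serves as \<open>\<Gamma>\<close>. It contains both representatives of a collision or
  neither, since global existence depends on the outgoing one alone.\<close>

definition global_states :: "('d, 'm) phase set" where
  "global_states = {x \<in> refined_phase_space \<sigma>. forward_global x \<and> forward_global (reversal x)}"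

text \<open>Negative times are defined by conjugation with velocity reversal; the final
  \<open>outgoing\<close> keeps the convention that values are not pre-collisional.\<close>

definition flow :: "real \<Rightarrow> ('d, 'm) phase \<Rightarrow> ('d, 'm) phase" where
  "flow t x = (if 0 \<le> t then flow_map t x else outgoing \<sigma> (reversal (flow_map (- t) (reversal x))))"

lemma forward_flows: "forward_global x \<Longrightarrow> 0 \<le> t \<Longrightarrow> flows x t (flow_map t x)"
  unfolding forward_global_def using flow_map_eq by metis

lemma global_statesD:
  assumes "x \<in> global_states"
  shows "x \<in> refined_phase_space \<sigma>" "forward_global x" "forward_global (reversal x)"
  using assms unfolding global_states_def by auto

lemma flows_same_outgoing:
  assumes "x \<in> refined_phase_space \<sigma>" "y \<in> refined_phase_space \<sigma>" "outgoing \<sigma> x = outgoing \<sigma> y"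
  shows "flows x t w \<longleftrightarrow> flows y t w" "flow_map t x = flow_map t y" "forward_global x \<longleftrightarrow> forward_global y"
    "outgoing \<sigma> (reversal x) = outgoing \<sigma> (reversal y)"
proof -
  show *: "flows x t w \<longleftrightarrow> flows y t w" for t w
    using flows_outgoing[OF assms(1), of t w] flows_outgoing[OF assms(2), of t w] assms(3) by simp
  show "flow_map t x = flow_map t y" "forward_global x \<longleftrightarrow> forward_global y"
    unfolding flow_map_def forward_global_def * by simp_all
  have "incoming \<sigma> x = incoming \<sigma> y"
    using outgoing_refined(5)[OF assms(1)] outgoing_refined(5)[OF assms(2)] assms(3) by metis
  then show "outgoing \<sigma> (reversal x) = outgoing \<sigma> (reversal y)"
    by (simp add: reversal_outgoing(1) assms(1,2))
qed

lemma flow_same_outgoing: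
  assumes "x \<in> global_states" "y \<in> refined_phase_space \<sigma>" "outgoing \<sigma> x = outgoing \<sigma> y"
  shows "y \<in> global_states" "flow t x = flow t y"
proof -
  note x = global_statesD[OF assms(1)]
  note * = flows_same_outgoing[OF x(1) assms(2,3)]
  have r: "reversal x \<in> refined_phase_space \<sigma>" "reversal y \<in> refined_phase_space \<sigma>"
    using x(1) assms(2) by simp_all
  note ** = flows_same_outgoing[OF r *(4)]
  show "y \<in> global_states"
    using x assms(2) *(3) **(3) by (simp add: global_states_def)
  show "flow t x = flow t y"
    unfolding flow_def *(2) **(2) ..
qed

section \<open>Group property of the flow\<close>

lemma reversal_global_states: "reversal x \<in> global_states \<longleftrightarrow> x \<in> global_states"
  by (auto simp: global_states_def)

lemma flow_zero:
  assumes "x \<in> refined_phase_space \<sigma>"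
  shows "flow 0 x = outgoing \<sigma> x"
  using flow_map_eq[OF flows_zero[OF assms]] by (simp add: flow_def)

lemma flow_nonpos:
  assumes x: "x \<in> global_states" and t: "0 \<le> t"
  shows "flow (- t) x = outgoing \<sigma> (reversal (flow_map t (reversal x)))"
proof (cases "t = 0")
  case True
  note r = global_statesD(1)[OF x]
  have "flow_map 0 (reversal x) = reversal (incoming \<sigma> x)"
    using flow_map_eq[OF flows_zero] r by (simp add: reversal_outgoing(1))
  then show ?thesis
    using True flow_zero[OF r] outgoing_refined(4)[OF r] by simp
next
  case False
  then show ?thesis using t by (simp add: flow_def)
qed

text \<open>Seen from a time \<open>- t\<close> that precedes 0 and \<open>u\<close>, the motion is
  purely forward: it is the reversed past motion, either cut off at \<open>u\<close> or continued by
  the forward motion.\<close>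

lemma flow_from_past:
  assumes x: "x \<in> global_states" and t: "0 \<le> t" and u: "- t \<le> u"
  shows "flows (flow (- t) x) (u + t) (flow u x)"
proof -
  note xg = global_statesD[OF x]
  let ?y = "\<lambda>t. flow_map t (reversal x)"
  have y: "flows (reversal x) t (?y t)" if "0 \<le> t" for t
    by (rule forward_flows[OF xg(3) that])
  have yr: "reversal (?y t) \<in> refined_phase_space \<sigma>" if "0 \<le> t" for t
    using flowsD(3)[OF y[OF that]] by simp
  show ?thesis
  proof (cases "0 \<le> u")
    case True
    have "flows (reversal (?y t)) t (outgoing \<sigma> x)"
      using flows_reversal[OF y[OF t]] by simp
    then have "flows (flow (- t) x) t (outgoing \<sigma> x)"
      unfolding flow_nonpos[OF x t] using flows_outgoing[OF yr[OF t]] by simp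
    moreover have "flows (outgoing \<sigma> x) u (flow u x)"
      using forward_flows[OF xg(2) True] True flows_outgoing[OF xg(1)] by (simp add: flow_def)
    ultimately show ?thesis
      using flows_trans by (metis add.commute)
  next
    case False
    then have u': "0 \<le> - u" "- u \<le> t" using u by auto
    obtain w where w: "flows (reversal x) (- u) w" "flows w (t - - u) (?y t)"
      using flows_split[OF y[OF t] u'] by blast
    have "w = ?y (- u)"
      using flow_map_eq[OF w(1)] by simp
    then have "flows (reversal (?y t)) (t + u) (outgoing \<sigma> (reversal (?y (- u))))"
      using flows_reversal[OF w(2)] by simp
    then have "flows (flow (- t) x) (t + u) (outgoing \<sigma> (reversal (?y (- u))))"
      unfolding flow_nonpos[OF x t] using flows_outgoing[OF yr[OF t]] by simp
    then show ?thesis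
      using False by (simp add: flow_def add.commute)
  qed
qed

text \<open>Both times are measured from a common past time \<open>- n\<close>, which avoids a
  distinction by signs; uniqueness identifies the intermediate state.\<close>

lemma flow_flows:
  assumes x: "x \<in> global_states" and ab: "a \<le> b"
  shows "flows (flow a x) (b - a) (flow b x)"
proof -
  define n where "n = max 0 (- a)"
  have n: "0 \<le> n" "- n \<le> a" "- n \<le> b" using ab by (auto simp: n_def)
  have le: "0 \<le> a + n" "a + n \<le> b + n" using n ab by auto
  obtain w where w: "flows (flow (- n) x) (a + n) w" "flows w (b + n - (a + n)) (flow b x)"
    using flows_split[OF flow_from_past[OF x n(1,3)] le] by blast
  have "w = flow a x"
    by (rule flows_unique[OF w(1) flow_from_past[OF x n(1,2)]])
  then show ?thesis using w(2) by simp
qed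

lemma flow_global_states:
  assumes x: "x \<in> global_states"
  shows "flow a x \<in> global_states" "\<not> pre_collisional \<sigma> (flow a x)"
proof -
  have self: "flow a x \<in> refined_phase_space \<sigma>" "\<not> pre_collisional \<sigma> (flow a x)"
    using flowsD(3,4)[OF flow_flows[OF x order_refl[of a]]] by auto
  show "\<not> pre_collisional \<sigma> (flow a x)" by (rule self(2))
  have "forward_global (flow a x)"
    unfolding forward_global_def using flow_flows[OF x, of a "a + _"] by (metis add_diff_cancel_left' le_add_same_cancel1)
  moreover have "\<exists>y. flows (reversal (flow a x)) T y" if "0 \<le> T" for T
    using flows_reversal[OF flow_flows[OF x, of "a - T" a]] that by auto
  ultimately show "flow a x \<in> global_states"
    using self by (simp add: global_states_def forward_global_def)
qed

lemma flow_outgoing: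
  assumes "x \<in> global_states"
  shows "outgoing \<sigma> (flow t x) = flow t x"
  by (rule outgoing_not_pre[OF flow_global_states(2)[OF assms]])

lemma flow_flow:
  assumes x: "x \<in> global_states"
  shows "flow t (flow a x) = flow (t + a) x"
proof (cases "0 \<le> t")
  case True
  have "flows (flow a x) t (flow (t + a) x)"
    using flow_flows[OF x, of a "t + a"] True by simp
  then show ?thesis
    using True flow_map_eq by (simp add: flow_def)
next
  case False
  let ?w = "flow (t + a) x"
  note w = global_statesD(1)[OF flow_global_states(1)[OF x, of "t + a"]]
  have "flows ?w (- t) (flow a x)"
    using flow_flows[OF x, of "t + a" a] False by simp
  from flow_map_eq[OF flows_reversal[OF this]]
  have "flow_map (- t) (reversal (flow a x)) = reversal (incoming \<sigma> ?w)"
    by (simp add: reversal_outgoing(1)[OF w])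
  then have "flow t (flow a x) = outgoing \<sigma> (incoming \<sigma> ?w)"
    using False by (simp add: flow_def)
  then show ?thesis
    using outgoing_refined(4)[OF w] flow_outgoing[OF x] by simp
qed

lemma flow_local:
  assumes x: "x \<in> global_states"
  shows "\<forall>\<^sub>F u in at_right 0. flow (t + u) x = free_flow u (flow t x)"
    "\<forall>\<^sub>F u in at_right 0. flow (t - u) x = free_flow (- u) (incoming \<sigma> (flow t x))"
proof -
  \<comment> \<open>On a window around \<open>t\<close> the point \<open>t\<close> is an inner one,
    where a segment satisfies the conditions on both sides.\<close>
  have "flows (flow (t - 1) x) 2 (flow (t + 1) x)"
    using flow_flows[OF x, of "t - 1" "t + 1"] by simp
  then obtain z where z: "segment 2 z" "z 0 = outgoing \<sigma> (flow (t - 1) x)" "flow (t - 1) x \<in> refined_phase_space \<sigma>"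
    by (rule flowsE) (rule that)
  have eq: "z r = flow (t - 1 + r) x" if "0 \<le> r" "r \<le> 2" for r
    using flows_unique[OF segment_flows[OF z that]] flow_flows[OF x, of "t - 1" "t - 1 + r"] that by simp
  have "\<forall>\<^sub>F u in at_right 0. z (1 + u) = free_flow u (z 1)"
    by (rule segmentD(3)[OF z(1)]) auto
  then show "\<forall>\<^sub>F u in at_right 0. flow (t + u) x = free_flow u (flow t x)"
    using eventually_at_right_small[of 1, simplified] eventually_at_right_pos
    by eventually_elim (use eq[of "1 + _"] eq[of 1] in simp)
  have "\<forall>\<^sub>F u in at_right 0. z (1 - u) = free_flow (- u) (incoming \<sigma> (z 1))"
    by (rule segmentD(4)[OF z(1)]) auto
  then show "\<forall>\<^sub>F u in at_right 0. flow (t - u) x = free_flow (- u) (incoming \<sigma> (flow t x))"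
    using eventually_at_right_small[of 1, simplified] eventually_at_right_pos
    by eventually_elim (use eq[of "1 - _"] eq[of 1] in simp)
qed

section \<open>Law of motion and conservation of energy\<close>

lemma trajectory_flow:
  assumes x: "x \<in> global_states"
  shows "trajectory \<sigma> x (\<lambda>t. flow t x)"
  unfolding trajectory_def
proof (intro conjI allI)
  show "flow 0 x = outgoing \<sigma> x"
    by (rule flow_zero[OF global_statesD(1)[OF x]])
  fix t
  show "flow t x \<in> refined_phase_space \<sigma>" "\<not> pre_collisional \<sigma> (flow t x)"
    using flow_global_states[OF x] global_statesD(1) by auto
  have "\<forall>\<^sub>F u in at_right 0. flow (t + u) x = free_flow u (flow t x) \<and>
      flow (t - u) x = free_flow (- u) (incoming \<sigma> (flow t x))"
    by (rule eventually_conj[OF flow_local[OF x]])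
  then show "\<exists>\<epsilon>>0. \<forall>u. 0 < u \<and> u < \<epsilon> \<longrightarrow> flow (t + u) x = free_flow u (flow t x) \<and>
      flow (t - u) x = free_flow (- u) (incoming \<sigma> (flow t x))"
    unfolding eventually_at_right_field by blast
qed

lemma flows_norm_velocity:
  assumes "flows x t y"
  shows "norm (snd y) = norm (snd x)"
proof -
  \<comment> \<open>\<open>norm_velocity\<close> concerns times strictly before the end, so the
    motion is first prolonged a little.\<close>
  obtain u where u: "0 < u" "flows x (t + u) (free_flow u y)"
    using eventually_at_right_witness(2)[OF flows_extend[OF assms], of 1] by auto
  obtain z where z: "segment (t + u) z" "z 0 = outgoing \<sigma> x" "x \<in> refined_phase_space \<sigma>"
    using u(2) by (rule flowsE) (rule that)
  note t = flowsD(2)[OF assms]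
  have "z t = y"
    by (rule flows_unique[OF segment_flows[OF z] assms]) (use t u in auto)
  moreover have "norm (snd (z t)) = speed z"
    by (rule norm_velocity[of "t + u" z t]) (use t u segment_mono[OF z(1)] in auto)
  moreover have "norm (snd (z 0)) = speed z"
    by (rule norm_velocity[of "t + u" z 0]) (use t u segment_mono[OF z(1)] in auto)
  ultimately show ?thesis
    using z(2) norm_outgoing(1)[OF z(3)] by simp
qed

lemma kinetic_energy_eq: "kinetic_energy (z :: ('d, 'm) phase) = (norm (snd z))\<^sup>2 / 2"
  by (simp add: kinetic_energy_def power2_norm_eq_inner inner_vec_def)

lemma kinetic_energy_flow:
  assumes x: "x \<in> global_states"
  shows "kinetic_energy (flow t x) = kinetic_energy x"
proof -
  have "norm (snd (flow t x)) = norm (snd (flow 0 x))"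
  proof (cases "t \<le> 0")
    case True
    from flows_norm_velocity[OF flow_flows[OF x this]] show ?thesis ..
  next
    case False
    then have "0 \<le> t" by simp
    from flows_norm_velocity[OF flow_flows[OF x this]] show ?thesis .
  qed
  then show ?thesis
    using flow_zero norm_outgoing(1) global_statesD(1)[OF x] by (simp add: kinetic_energy_eq)
qed

subsection \<open>Full measure and the \<open>G\<^sub>\<delta>\<close> property\<close>

lemma negligible_not_global: "negligible (refined_phase_space \<sigma> - global_states)"
proof (rule negligible_subset)
  let ?N = "{x \<in> phase_interior \<sigma>. \<not> forward_global x}"
  show "negligible ((phase_space \<sigma> - phase_interior \<sigma>) \<union> (?N \<union> reversal ` ?N))"
    by (intro negligible_Un negligible_boundary negligible_not_forward_global negligible_reversal)
  show "refined_phase_space \<sigma> - global_states \<subseteq> (phase_space \<sigma> - phase_interior \<sigma>) \<union> (?N \<union> reversal ` ?N)"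
  proof
    fix x assume "x \<in> refined_phase_space \<sigma> - global_states"
    then have x: "x \<in> refined_phase_space \<sigma>" "\<not> forward_global x \<or> \<not> forward_global (reversal x)"
      by (auto simp: global_states_def)
    show "x \<in> (phase_space \<sigma> - phase_interior \<sigma>) \<union> (?N \<union> reversal ` ?N)"
    proof (cases "x \<in> phase_interior \<sigma>")
      case True
      then have "x \<in> ?N \<or> reversal x \<in> ?N" using x(2) by simp
      moreover have "x = reversal (reversal x)" by simp
      ultimately show ?thesis by blast
    next
      case False
      then show ?thesis using refined_phase_space[OF x(1)] by blast
    qed
  qed
qed

text \<open>\<open>R n\<close> asks for an interior state at some time from \<open>n\<close> on,
  because time \<open>n\<close> itself may be a collision time. By stability \<open>R n\<close> is
  open relative to the phase space, so global existence in both directions is a countable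
  intersection of open sets within a closed set, and closed sets are G-delta in a metrizable
  space.\<close>

lemma gdelta_global_states: "gdelta_in euclidean global_states"
proof -
  define R where "R n = {x \<in> refined_phase_space \<sigma>. \<exists>T\<ge>real n. \<exists>y\<in>phase_interior \<sigma>. flows x T y}" for n
  define V where "V n = \<Union>{U. open U \<and> U \<inter> phase_space \<sigma> \<subseteq> R n}" for n
  have open_V: "open (V n)" for n
    unfolding V_def by (rule open_Union) blast
  have R_eq: "R n = V n \<inter> phase_space \<sigma>" for n
  proof (intro equalityI subsetI)
    fix x assume x: "x \<in> R n"
    then obtain T y where Ty: "T \<ge> real n" "y \<in> phase_interior \<sigma>" "flows x T y"
      unfolding R_def by blast
    obtain U F where F: "smooth_vp U F" "x \<in> U" "\<forall>y\<in>U. F y \<in> phase_interior \<sigma>" "\<forall>y\<in>U \<inter> phase_space \<sigma>. flows y T (F y)"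
      using flows_stable[OF Ty(3,2)] unfolding stable_def by blast
    have "U \<inter> phase_space \<sigma> \<subseteq> R n"
    proof
      fix y assume y: "y \<in> U \<inter> phase_space \<sigma>"
      then have "flows y T (F y)" "F y \<in> phase_interior \<sigma>" using F by auto
      then show "y \<in> R n"
        unfolding R_def using flowsD(1) Ty(1) by blast
    qed
    then have "x \<in> V n"
      unfolding V_def using F(1,2) by (auto simp: smooth_vp_def)
    moreover have "x \<in> phase_space \<sigma>"
      using x refined_phase_space unfolding R_def by blast
    ultimately show "x \<in> V n \<inter> phase_space \<sigma>" by blast
  qed (auto simp: V_def)
  have forward: "x \<in> refined_phase_space \<sigma> \<and> forward_global x \<longleftrightarrow> (\<forall>n. x \<in> R n)" for x
  proof
    assume x: "x \<in> refined_phase_space \<sigma> \<and> forward_global x"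
    show "\<forall>n. x \<in> R n"
    proof
      fix n
      have "flows x (real n) (flow_map (real n) x)"
        using x by (intro forward_flows) auto
      from eventually_at_right_witness(1)[OF flows_extend[OF this]]
      obtain u where u: "0 < u" "flows x (real n + u) (free_flow u (flow_map (real n) x))"
          "free_flow u (flow_map (real n) x) \<in> phase_interior \<sigma>" by blast
      have "real n \<le> real n + u" using u(1) by simp
      then show "x \<in> R n"
        unfolding R_def using x u(2,3) by blast
    qed
  next
    assume x: "\<forall>n. x \<in> R n"
    have "\<exists>y. flows x T y" if T: "0 \<le> T" for T
    proof -
      obtain n where n: "T \<le> real n" using real_arch_simple by blast
      have "x \<in> R n" using x by blast
      then obtain T' y where T': "real n \<le> T'" "flows x T' y"
        unfolding R_def by blast
      have "T \<le> T'" using n T'(1) by simp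
      from flows_split[OF T'(2) T this] show ?thesis by blast
    qed
    then show "x \<in> refined_phase_space \<sigma> \<and> forward_global x"
      using x by (auto simp: forward_global_def R_def)
  qed
  have eq: "global_states = phase_space \<sigma> \<inter> (\<Inter>n. V n \<inter> reversal -` V n)"
  proof (intro equalityI subsetI)
    fix x assume "x \<in> global_states"
    then have "x \<in> refined_phase_space \<sigma>" "\<forall>n. x \<in> R n" "\<forall>n. reversal x \<in> R n"
      using forward[of x] forward[of "reversal x"] global_statesD by simp_all
    then show "x \<in> phase_space \<sigma> \<inter> (\<Inter>n. V n \<inter> reversal -` V n)"
      using R_eq refined_phase_space by blast
  next
    fix x assume "x \<in> phase_space \<sigma> \<inter> (\<Inter>n. V n \<inter> reversal -` V n)"
    then have "\<forall>n. x \<in> R n" "\<forall>n. reversal x \<in> R n"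
      using R_eq by auto
    then show "x \<in> global_states"
      using forward[of x] forward[of "reversal x"] by (simp add: global_states_def)
  qed
  have "open (V n \<inter> reversal -` V n)" for n
    using open_V smooth_vp_continuous[OF smooth_vp_reversal] by (intro open_Int open_vimage) auto
  then have "gdelta_in euclidean (\<Inter>n. V n \<inter> reversal -` V n)"
    by (intro gdelta_in_Inter) (auto intro: open_imp_gdelta_in)
  moreover have "gdelta_in euclidean (phase_space \<sigma> :: ('d, 'm) phase set)"
    by (rule closed_imp_gdelta_in[OF metrizable_space_euclidean]) (simp add: closed_phase_space)
  ultimately show ?thesis
    unfolding eq by (intro gdelta_in_Int)
qed

lemma borel_global_states: "global_states \<in> sets borel"
proof -
  have "(countable intersection_of open) global_states"
    using gdelta_global_states by (simp add: gdelta_in_alt)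
  then obtain \<T> where "countable \<T>" "\<T> \<subseteq> Collect open" "global_states = \<Inter>\<T>"
    by (auto simp: intersection_of_def)
  then show ?thesis
    using sets.countable_INT'[of \<T> "\<lambda>S. S" borel] by (cases "\<T> = {}") (auto intro: borel_open)
qed

lemma lebesgue_global_states: "global_states \<in> sets lebesgue"
  using borel_global_states by simp

subsection \<open>Smoothness and continuity\<close>

text \<open>The local model of \<open>stable\<close> gives the flow on global states; for negative
  times it is conjugated by the reversal.\<close>

lemma flow_stable:
  assumes x: "x \<in> global_states" and y: "flow t x \<in> phase_interior \<sigma>"
  obtains U F where "smooth_vp U F" "x \<in> U" "\<And>w. w \<in> U \<Longrightarrow> w \<in> global_states \<Longrightarrow> flow t w = F w"
proof -
  have *: "\<exists>U F. smooth_vp U F \<and> x \<in> U \<and> (\<forall>w\<in>U. F w \<in> phase_interior \<sigma>) \<and> (\<forall>w\<in>U. w \<in> global_states \<longrightarrow> flow_map t w = F w)"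
    if x: "x \<in> global_states" and t: "0 \<le> t" and y: "flow_map t x \<in> phase_interior \<sigma>" for t x
  proof -
    have "flows x t (flow_map t x)"
      by (rule forward_flows[OF global_statesD(2)[OF x] t])
    from flows_stable[OF this y]
    obtain U F where F: "smooth_vp U F" "x \<in> U" "\<forall>y\<in>U. F y \<in> phase_interior \<sigma>" "\<forall>y\<in>U \<inter> phase_space \<sigma>. flows y t (F y)"
      unfolding stable_def by blast
    have "flow_map t w = F w" if "w \<in> U" "w \<in> global_states" for w
      using F(4) that flow_map_eq refined_phase_space[OF global_statesD(1)[OF that(2)]] by blast
    then show ?thesis using F(1-3) by blast
  qed
  show thesis
  proof (cases "0 \<le> t")
    case True
    then have "flow_map t x \<in> phase_interior \<sigma>" using y by (simp add: flow_def)
    from *[OF x True this] obtain U F where "smooth_vp U F" "x \<in> U"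
        "\<forall>w\<in>U. w \<in> global_states \<longrightarrow> flow_map t w = F w" by blast
    then show thesis
      using True by (intro that[of U F]) (simp_all add: flow_def)
  next
    case False
    then have t: "0 \<le> - t" by simp
    have rx: "reversal x \<in> global_states"
      using x by (simp add: reversal_global_states)
    let ?y = "flow_map (- t) (reversal x)"
    have yr: "reversal ?y \<in> refined_phase_space \<sigma>"
      using flowsD(3)[OF forward_flows[OF global_statesD(2)[OF rx] t]] by simp
    have "outgoing \<sigma> (reversal ?y) \<in> phase_interior \<sigma>"
      using y False by (simp add: flow_def)
    then have "?y \<in> phase_interior \<sigma>"
      unfolding interior_outgoing_iff[OF yr] by simp
    from *[OF rx t this] obtain U F where F: "smooth_vp U F" "reversal x \<in> U" "\<forall>w\<in>U. F w \<in> phase_interior \<sigma>"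
        "\<forall>w\<in>U. w \<in> global_states \<longrightarrow> flow_map (- t) w = F w" by blast
    have "smooth_vp (UNIV \<inter> reversal -` U) (\<lambda>w. F (reversal w))"
      by (rule smooth_vp_compose[OF smooth_vp_reversal F(1)])
    from smooth_vp_compose[OF this smooth_vp_reversal]
    have "smooth_vp (reversal -` U) (\<lambda>w. reversal (F (reversal w)))" by simp
    moreover have "flow t w = reversal (F (reversal w))" if "w \<in> reversal -` U" "w \<in> global_states" for w
      using F(3,4) that False by (simp add: flow_def reversal_global_states outgoing_interior)
    ultimately show thesis
      using F(2) by (intro that[of "reversal -` U" "\<lambda>w. reversal (F (reversal w))"]) simp_all
  qed
qed

text \<open>A collision at time \<open>t\<close> may happen slightly earlier or later for a nearby state. Hence \<open>flow t\<close>
  is continuous at such states only if the states before and after the collision are identified.\<close>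

lemma flow_through_collision:
  assumes w: "w \<in> global_states" "\<not> pre_collisional \<sigma> w"
    and V: "open V" "w \<in> V" "incoming \<sigma> w \<in> V"
  shows "\<forall>\<^sub>F u in at_right 0. \<exists>U. open U \<and> free_flow (- u) (incoming \<sigma> w) \<in> U \<and>
    (\<forall>b\<in>U \<inter> global_states. \<exists>y\<in>V. y \<in> refined_phase_space \<sigma> \<and> flow u b = outgoing \<sigma> y)"
proof (cases "w \<in> phase_interior \<sigma>")
  case True
  obtain e U where eU: "e > 0" "open U" "w \<in> U"
    "\<And>t y. y \<in> U \<Longrightarrow> \<bar>t\<bar> \<le> e \<Longrightarrow> free_flow t y \<in> phase_interior \<sigma>"
    using interior_tube[OF True] by metis
  show ?thesis
    unfolding eventually_at_right_field
  proof (intro exI[of _ e] conjI eU(1) allI impI)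
    fix u assume u: "0 < u" "u < e"
    show "\<exists>U. open U \<and> free_flow (- u) (incoming \<sigma> w) \<in> U \<and>
      (\<forall>b\<in>U \<inter> global_states. \<exists>y\<in>V. y \<in> refined_phase_space \<sigma> \<and> flow u b = outgoing \<sigma> y)"
    proof (intro exI[of _ "free_flow u -` (U \<inter> V)"] conjI ballI)
      show "open (free_flow u -` (U \<inter> V))"
        by (intro open_vimage open_Int eU(2) V(1) continuous_intros)
      show "free_flow (- u) (incoming \<sigma> w) \<in> free_flow u -` (U \<inter> V)"
        using eU(3) V(2) by (simp add: incoming_interior[OF True])
      fix b assume b: "b \<in> free_flow u -` (U \<inter> V) \<inter> global_states"
      let ?y = "free_flow u b"
      have y: "?y \<in> U" "?y \<in> V" using b by auto
      have int: "free_flow t b \<in> phase_interior \<sigma>" if "0 \<le> t" "t \<le> u" for t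
        using eU(4)[OF y(1), of "t - u"] that u by simp
      have "flows b u ?y"
        using int u(1) int[of 0] by (intro flows_free) (auto simp: interior_refined interior_not_collisional)
      then have "flow u b = outgoing \<sigma> ?y"
        using int[of u] u by (simp add: flow_def flow_map_eq outgoing_interior)
      then show "\<exists>y\<in>V. y \<in> refined_phase_space \<sigma> \<and> flow u b = outgoing \<sigma> y"
        using int[of u] u by (intro bexI[OF _ y(2)]) (simp add: interior_refined)
    qed
  qed
next
  case False
  note r = global_statesD(1)[OF w(1)]
  let ?w = "incoming \<sigma> w"
  have w': "?w \<in> refined_phase_space \<sigma>" by (rule outgoing_refined(6)[OF r])
  have pre: "pre_collisional \<sigma> ?w"
    using r
  proof (cases rule: refined_cases)
    case (2 p)
    then have "rate p w > 0"
      using collisional_rate(1)[OF r 2(1,2)] w(2) by linarith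
    then show ?thesis
      using outgoing_eq(2)[OF r 2(1,2)] refined_reflect[OF r 2(1,2)] 2
      by (simp add: collisional_rate(1)[of _ p])
  qed (use False in simp)
  obtain p e U where eU: "e > 0" "open U" "?w \<in> U" "U \<subseteq> obs.hits p"
    and entry_w: "obs.entry p ?w = 0" and scatter_w: "obs.scatter p ?w = outgoing \<sigma> ?w"
    and before: "\<And>y a. y \<in> U \<Longrightarrow> - e \<le> a \<Longrightarrow> a \<le> e \<Longrightarrow> a < obs.entry p y \<Longrightarrow> free_flow a y \<in> phase_interior \<sigma>"
    and after: "\<And>y b. y \<in> U \<Longrightarrow> - e \<le> b \<Longrightarrow> b \<le> e \<Longrightarrow> obs.entry p y < b \<Longrightarrow> free_flow b (obs.scatter p y) \<in> phase_interior \<sigma>"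
    and cross: "\<And>y a b. y \<in> U \<Longrightarrow> - e \<le> a \<Longrightarrow> a < obs.entry p y \<Longrightarrow> obs.entry p y \<le> b \<Longrightarrow> b \<le> e \<Longrightarrow>
       flows (free_flow a y) (b - a) (free_flow b (obs.scatter p y))"
    and "\<And>y b. y \<in> U \<Longrightarrow> y \<in> phase_space \<sigma> \<Longrightarrow> obs.entry p y < b \<Longrightarrow> b \<le> e \<Longrightarrow>
       flows y b (free_flow b (obs.scatter p y))"
    by (rule collision_flows[OF w' pre]) (rule that)
  have scatter_w': "obs.scatter p ?w = w"
    using scatter_w outgoing_refined(4)[OF r] w(2) by (simp add: outgoing_not_pre)
  show ?thesis
    unfolding eventually_at_right_field
  proof (intro exI[of _ e] conjI eU(1) allI impI)
    fix u assume u: "0 < u" "u < e"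
    \<comment> \<open>States \<open>y\<close> near the incoming representative, with scattered state
      near \<open>w\<close> and with an entry later than the start at relative time
      \<open>- u\<close>.\<close>
    let ?W = "U \<inter> V \<inter> (obs.hits p \<inter> obs.scatter p -` V) \<inter> (obs.hits p \<inter> obs.entry p -` {-u<..})"
    have "open ?W"
      using eU(2) V(1) smooth_vp_continuous[OF obs.smooth_vp_scatter, of p]
        smooth_on_imp_continuous_on[OF obs.smooth_entry, of p] obs.open_hits[of p]
      by (intro open_Int continuous_open_preimage) auto
    show "\<exists>U. open U \<and> free_flow (- u) ?w \<in> U \<and>
      (\<forall>b\<in>U \<inter> global_states. \<exists>y\<in>V. y \<in> refined_phase_space \<sigma> \<and> flow u b = outgoing \<sigma> y)"
    proof (intro exI[of _ "free_flow u -` ?W"] conjI ballI)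
      show "open (free_flow u -` ?W)"
        by (intro open_vimage \<open>open ?W\<close> continuous_intros)
      show "free_flow (- u) ?w \<in> free_flow u -` ?W"
        using eU(3,4) V(2,3) entry_w scatter_w' u(1) by auto
      fix b assume b: "b \<in> free_flow u -` ?W \<inter> global_states"
      let ?y = "free_flow u b"
      have y: "?y \<in> U" "?y \<in> V" "obs.scatter p ?y \<in> V" "- u < obs.entry p ?y" using b by auto
      have b_eq: "free_flow (- u) ?y = b" by simp
      show "\<exists>y\<in>V. y \<in> refined_phase_space \<sigma> \<and> flow u b = outgoing \<sigma> y"
      \<comment> \<open>If the collision has not happened when time \<open>u\<close> is up, the
        motion is near the incoming representative, otherwise near the outgoing one;
        \<open>V\<close> is a neighbourhood of both.\<close>
      proof (cases "0 < obs.entry p ?y")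
        case True
        have int: "free_flow t b \<in> phase_interior \<sigma>" if "0 \<le> t" "t \<le> u" for t
          using before[OF y(1), of "t - u"] that u True by simp
        have "flows b u ?y"
          using int u(1) int[of 0] by (intro flows_free) (auto simp: interior_refined interior_not_collisional)
        then have "flow u b = outgoing \<sigma> ?y"
          using int[of u] u by (simp add: flow_def flow_map_eq outgoing_interior)
        then show ?thesis
          using int[of u] u by (intro bexI[OF _ y(2)]) (simp add: interior_refined)
      next
        case False
        then have fl: "flows b u (obs.scatter p ?y)"
          using cross[OF y(1), of "- u" 0] y(4) u unfolding b_eq by simp
        then have "flow u b = outgoing \<sigma> (obs.scatter p ?y)"
          using u(1) flowsD(5)[OF fl] by (simp add: flow_def flow_map_eq)
        then show ?thesis
          using y(3) flowsD(3)[OF fl] by blast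
      qed
    qed
  qed
qed

lemma topspace_glued: "topspace (glued_topology \<sigma> global_states) = outgoing \<sigma> ` global_states"
proof (rule antisym)
  have "openin (glued_topology \<sigma> global_states) (topspace (glued_topology \<sigma> global_states))"
    by simp
  then show "topspace (glued_topology \<sigma> global_states) \<subseteq> outgoing \<sigma> ` global_states"
    unfolding openin_glued_topology by blast
  have "openin (glued_topology \<sigma> global_states) (outgoing \<sigma> ` global_states)"
    unfolding openin_glued_topology
  proof
    have "{x \<in> global_states. outgoing \<sigma> x \<in> outgoing \<sigma> ` global_states} = global_states" by blast
    then show "openin (top_of_set global_states) {x \<in> global_states. outgoing \<sigma> x \<in> outgoing \<sigma> ` global_states}"
      by simp
  qed simp
  then show "outgoing \<sigma> ` global_states \<subseteq> topspace (glued_topology \<sigma> global_states)"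
    by (rule openin_subset)
qed

lemma outgoing_global_states:
  assumes "x \<in> global_states"
  shows "outgoing \<sigma> x \<in> global_states" "incoming \<sigma> x \<in> global_states" "flow t (outgoing \<sigma> x) = flow t x"
proof -
  note r = global_statesD(1)[OF assms]
  show "outgoing \<sigma> x \<in> global_states"
    by (rule flow_same_outgoing(1)[OF assms]) (simp_all add: outgoing_refined[OF r])
  show "incoming \<sigma> x \<in> global_states"
    by (rule flow_same_outgoing(1)[OF assms]) (simp_all add: outgoing_refined[OF r])
  show "flow t (outgoing \<sigma> x) = flow t x"
    by (rule flow_same_outgoing(2)[OF assms, symmetric]) (simp_all add: outgoing_refined[OF r])
qed

text \<open>The motion is stopped at an interior state shortly before \<open>t\<close>, where it
  depends smoothly on the initial state, and \<open>flow_through_collision\<close> bridges the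
  remaining time. Pulled back to the global states, an open set of the glued space is the trace of
  an open \<open>V\<close>, which contains both representatives of each of its points.\<close>

lemma continuous_map_flow:
  "continuous_map (glued_topology \<sigma> global_states) (glued_topology \<sigma> global_states) (flow t)"
  unfolding continuous_map_def topspace_glued
proof (intro conjI allI impI)
  show "flow t \<in> outgoing \<sigma> ` global_states \<rightarrow> outgoing \<sigma> ` global_states"
  proof
    fix y assume "y \<in> outgoing \<sigma> ` global_states"
    then have "y \<in> global_states" using outgoing_global_states(1) by blast
    then show "flow t y \<in> outgoing \<sigma> ` global_states"
      using flow_outgoing[of y t] flow_global_states(1)[of y t] by (metis imageI)
  qed
  fix A assume "openin (glued_topology \<sigma> global_states) A"
  then obtain V where A: "A \<subseteq> outgoing \<sigma> ` global_states"
    and V: "open V" "{x \<in> global_states. outgoing \<sigma> x \<in> A} = global_states \<inter> V"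
    unfolding openin_glued_topology openin_open by blast
  have V_iff: "outgoing \<sigma> x \<in> A \<longleftrightarrow> x \<in> V" if "x \<in> global_states" for x
    using V(2) that by blast
  have eq: "{x \<in> global_states. outgoing \<sigma> x \<in> {x \<in> outgoing \<sigma> ` global_states. flow t x \<in> A}} =
      {x \<in> global_states. flow t x \<in> A}"
    by (intro Collect_cong conj_cong refl) (simp add: outgoing_global_states(3))
  show "openin (glued_topology \<sigma> global_states) {x \<in> outgoing \<sigma> ` global_states. flow t x \<in> A}"
    unfolding openin_glued_topology eq
  proof (rule conjI)
    show "openin (top_of_set global_states) {x \<in> global_states. flow t x \<in> A}"
    proof (subst openin_subopen, rule ballI)
      fix x assume "x \<in> {x \<in> global_states. flow t x \<in> A}"
      then have x: "x \<in> global_states" "flow t x \<in> A" by auto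
      let ?w = "flow t x"
      note w = flow_global_states[OF x(1), of t]
      have wV: "?w \<in> V" "incoming \<sigma> ?w \<in> V"
        using V_iff[OF w(1)] V_iff[OF outgoing_global_states(2)[OF w(1)]] x(2)
          outgoing_refined(4)[OF global_statesD(1)[OF w(1)]] flow_outgoing[OF x(1)] by auto
      from flow_through_collision[OF w V(1) wV] flow_local(2)[OF x(1), of t]
        arrival[OF global_statesD(1)[OF w(1)]]
      have "\<forall>\<^sub>F u in at_right 0. flow (t - u) x \<in> phase_interior \<sigma> \<and> (\<exists>U. open U \<and> flow (t - u) x \<in> U \<and>
          (\<forall>b\<in>U \<inter> global_states. \<exists>y\<in>V. y \<in> refined_phase_space \<sigma> \<and> flow u b = outgoing \<sigma> y))"
        by eventually_elim simp
      then obtain u U where u: "0 < u" "flow (t - u) x \<in> phase_interior \<sigma>" and U: "open U" "flow (t - u) x \<in> U"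
          "\<forall>b\<in>U \<inter> global_states. \<exists>y\<in>V. y \<in> refined_phase_space \<sigma> \<and> flow u b = outgoing \<sigma> y"
        using eventually_at_right_witness(1) by blast
      obtain N F where F: "smooth_vp N F" "x \<in> N" "\<And>y. y \<in> N \<Longrightarrow> y \<in> global_states \<Longrightarrow> flow (t - u) y = F y"
        by (rule flow_stable[OF x(1) u(2)]) (rule that)
      let ?N = "N \<inter> F -` U"
      have "open ?N"
        using F(1) U(1) smooth_vp_continuous[OF F(1)]
        by (intro continuous_open_preimage) (auto simp: smooth_vp_def)
      have "x \<in> ?N"
        using F(2,3) x(1) U(2) by simp
      have sub: "global_states \<inter> ?N \<subseteq> {x \<in> global_states. flow t x \<in> A}"
      proof
        fix y assume y: "y \<in> global_states \<inter> ?N"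
        then have "flow (t - u) y \<in> U \<inter> global_states"
          using F(3)[of y] flow_global_states(1)[of y "t - u"] by simp
        then obtain v where v: "v \<in> V" "v \<in> refined_phase_space \<sigma>" "flow u (flow (t - u) y) = outgoing \<sigma> v"
          using U(3) by blast
        then have eq: "flow t y = outgoing \<sigma> v"
          using y by (simp add: flow_flow)
        have "outgoing \<sigma> (flow t y) = outgoing \<sigma> v"
          unfolding eq by (rule outgoing_refined(3)[OF v(2)])
        then have "v \<in> global_states"
          using flow_same_outgoing(1)[OF flow_global_states(1) v(2)] y by blast
        then have "outgoing \<sigma> v \<in> A"
          using V_iff v(1) by blast
        then show "y \<in> {x \<in> global_states. flow t x \<in> A}"
          using y eq by simp
      qed
      show "\<exists>T. openin (top_of_set global_states) T \<and> x \<in> T \<and> T \<subseteq> {x \<in> global_states. flow t x \<in> A}"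
        using \<open>open ?N\<close> \<open>x \<in> ?N\<close> sub x(1) by (intro exI[of _ "global_states \<inter> ?N"]) auto
    qed
  qed auto
qed

lemma glued_identity:
  assumes "y \<in> outgoing \<sigma> ` global_states"
  shows "flow (- t) (flow t y) = y"
proof -
  obtain x where x: "x \<in> global_states" "y = outgoing \<sigma> x" using assms by blast
  note r = global_statesD(1)[OF x(1)]
  have "y \<in> global_states" "flow 0 y = y"
    using outgoing_global_states(1)[OF x(1)] flow_zero[OF outgoing_refined(1)[OF r]] outgoing_refined(3)[OF r] x(2)
    by simp_all
  then show ?thesis by (simp add: flow_flow)
qed

text \<open>The set on which \<open>glued_diffeomorphism\<close> asks the map to be a
  diffeomorphism.\<close>

definition interior_states :: "real \<Rightarrow> ('d, 'm) phase set" where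
  "interior_states t = {x \<in> global_states \<inter> phase_interior \<sigma>. flow t x \<in> phase_interior \<sigma>}"

lemma flow_inverse_interior:
  assumes "x \<in> interior_states t"
  shows "flow (- t) (flow t x) = x" "flow t x \<in> interior_states (- t)"
proof -
  have x: "x \<in> global_states" "x \<in> phase_interior \<sigma>" "flow t x \<in> phase_interior \<sigma>"
    using assms by (auto simp: interior_states_def)
  show *: "flow (- t) (flow t x) = x"
    using flow_flow[OF x(1)] flow_zero[OF global_statesD(1)[OF x(1)]] outgoing_interior[OF x(2)] by simp
  show "flow t x \<in> interior_states (- t)"
    using flow_global_states(1)[OF x(1)] x * by (simp add: interior_states_def)
qed

lemma flow_image_interior: "flow t ` interior_states t = interior_states (- t)"
proof (intro equalityI subsetI)
  fix y assume "y \<in> interior_states (- t)"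
  then show "y \<in> flow t ` interior_states t"
    using flow_inverse_interior[of y "- t"] by (metis imageI minus_minus)
qed (use flow_inverse_interior(2) in blast)

lemma inj_on_flow: "inj_on (flow t) (interior_states t)"
  by (rule inj_on_inverseI[of _ "flow (- t)"]) (rule flow_inverse_interior(1))

lemma smooth_map_on_flow: "smooth_map_on (interior_states t) (flow t)"
  unfolding smooth_map_on_def
proof
  fix x assume "x \<in> interior_states t"
  then have x: "x \<in> global_states" "flow t x \<in> phase_interior \<sigma>"
    by (auto simp: interior_states_def)
  obtain U F where F: "smooth_vp U F" "x \<in> U" "\<And>w. w \<in> U \<Longrightarrow> w \<in> global_states \<Longrightarrow> flow t w = F w"
    by (rule flow_stable[OF x]) (rule that)
  then show "\<exists>U F. open U \<and> x \<in> U \<and> (\<forall>k. Ck_on k U F) \<and> (\<forall>y\<in>interior_states t \<inter> U. F y = flow t y)"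
    unfolding smooth_vp_def smooth_on_def by (intro exI[of _ U] exI[of _ F]) (auto simp: interior_states_def)
qed

text \<open>The image is \<open>interior_states (- t)\<close> and the inverse is
  \<open>flow (- t)\<close> there, so smoothness of the inverse is an instance of smoothness of the
  flow.\<close>

lemma diffeomorphism_flow: "diffeomorphism (interior_states t) (flow t ` interior_states t) (flow t)"
proof -
  have "smooth_map_on (interior_states (- t)) (the_inv_into (interior_states t) (flow t))"
  proof -
    have "the_inv_into (interior_states t) (flow t) y = flow (- t) y" if "y \<in> interior_states (- t)" for y
      using that flow_inverse_interior[of y "- t"]
      by (intro the_inv_into_f_eq inj_on_flow) auto
    then show ?thesis
      using smooth_map_on_flow[of "- t"] unfolding smooth_map_on_def by simp
  qed
  then show ?thesis
    unfolding diffeomorphism_def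
    using inj_on_flow smooth_map_on_flow by (auto simp: bij_betw_def flow_image_interior)
qed

lemma glued_diffeomorphism_flow: "glued_diffeomorphism \<sigma> global_states (flow t)"
  unfolding glued_diffeomorphism_def
proof (intro conjI)
  show "flow t \<in> global_states \<rightarrow> global_states"
    using flow_global_states(1) by blast
  show "\<forall>x\<in>global_states. \<forall>y\<in>global_states. outgoing \<sigma> x = outgoing \<sigma> y \<longrightarrow> flow t x = flow t y"
    using flow_same_outgoing(2) global_statesD(1) by blast
  show "homeomorphic_map (glued_topology \<sigma> global_states) (glued_topology \<sigma> global_states) (flow t)"
    unfolding homeomorphic_map_maps homeomorphic_maps_def topspace_glued
    using continuous_map_flow[of t] continuous_map_flow[of "- t"] glued_identity[of _ t] glued_identity[of _ "- t"]
    by (intro exI[of _ "flow (- t)"]) auto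
  show "let S = {x \<in> global_states \<inter> phase_interior \<sigma>. flow t x \<in> phase_interior \<sigma>} in diffeomorphism S (flow t ` S) (flow t)"
    using diffeomorphism_flow[of t] unfolding interior_states_def Let_def .
qed

subsection \<open>Invariance of the measure\<close>

lemma reversal_volume:
  assumes "S \<in> sets lebesgue"
  shows "reversal ` S \<in> sets lebesgue" "emeasure lebesgue (reversal ` S) = emeasure lebesgue S"
proof -
  have "\<forall>x\<in>S. \<exists>D. (reversal has_derivative D) (at x) \<and> volume_preserving D"
    using smooth_vp_reversal unfolding smooth_vp_def by blast
  from bchoice[OF this] obtain D
    where D: "\<forall>x\<in>S. (reversal has_derivative D x) (at x) \<and> volume_preserving (D x)" ..
  have "inj_on reversal S"
    by (rule inj_on_inverseI[of _ reversal]) simp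
  note image = volume_preserving_image[OF assms this, of D]
  show "reversal ` S \<in> sets lebesgue"
    by (rule image(1)) (simp_all add: D)
  show "emeasure lebesgue (reversal ` S) = emeasure lebesgue S"
    by (rule image(2)) (simp_all add: D)
qed

text \<open>For nonnegative \<open>t\<close> this follows from the definition of
  \<open>flow\<close>; for negative \<open>t\<close> that case is applied to the state
  \<open>flow (- t) x\<close>.\<close>

lemma reversal_flow_interior:
  assumes "x \<in> interior_states (- t)"
  shows "reversal x \<in> interior_states t" "flow (- t) x = reversal (flow t (reversal x))"
proof -
  have *: "reversal x \<in> interior_states t \<and> flow (- t) x = reversal (flow t (reversal x))"
    if x: "x \<in> interior_states (- t)" and t: "0 \<le> t" for x t
  proof -
    have xg: "x \<in> global_states" "x \<in> phase_interior \<sigma>" "flow (- t) x \<in> phase_interior \<sigma>"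
      using x by (auto simp: interior_states_def)
    then have rx: "reversal x \<in> global_states" "reversal x \<in> phase_interior \<sigma>"
      by (simp_all add: reversal_global_states)
    let ?y = "flow_map t (reversal x)"
    have y: "reversal ?y \<in> refined_phase_space \<sigma>"
      using flowsD(3)[OF forward_flows[OF global_statesD(2)[OF rx(1)] t]] by simp
    note eq = flow_nonpos[OF xg(1) t]
    have int: "reversal ?y \<in> phase_interior \<sigma>"
      using xg(3) interior_outgoing_iff[OF y] unfolding eq by simp
    then have "?y \<in> phase_interior \<sigma>" by simp
    moreover have "flow t (reversal x) = ?y" using t by (simp add: flow_def)
    ultimately show ?thesis
      using rx eq outgoing_interior[OF int] by (simp add: interior_states_def)
  qed
  show "reversal x \<in> interior_states t" "flow (- t) x = reversal (flow t (reversal x))"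
  proof -
    have "reversal x \<in> interior_states t \<and> flow (- t) x = reversal (flow t (reversal x))"
    proof (cases "0 \<le> t")
      case True
      then show ?thesis using *[OF assms] by blast
    next
      case False
      then have t: "0 \<le> - t" by simp
      have x: "x \<in> global_states" "x \<in> phase_interior \<sigma>" "flow (- t) x \<in> phase_interior \<sigma>"
        using assms by (auto simp: interior_states_def)
      let ?y = "flow (- t) x"
      have y: "?y \<in> interior_states (- (- t))"
        using flow_inverse_interior(2)[OF assms] .
      from *[OF y t]
      have y': "reversal ?y \<in> interior_states (- t)" "flow t ?y = reversal (flow (- t) (reversal ?y))"
        by simp_all
      have "flow t ?y = x"
        using flow_inverse_interior(1)[OF assms] by simp
      moreover have "reversal (flow t ?y) = flow (- t) (reversal ?y)"
        unfolding y'(2) by simp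
      ultimately have rx: "reversal x = flow (- t) (reversal ?y)"
        by (simp only:)
      have "reversal x \<in> interior_states t"
        using flow_inverse_interior(2)[OF y'(1)] rx by simp
      moreover have "flow t (reversal x) = reversal ?y"
        using flow_inverse_interior(1)[OF y'(1)] rx by simp
      ultimately show ?thesis by simp
    qed
    then show "reversal x \<in> interior_states t" "flow (- t) x = reversal (flow t (reversal x))"
      by blast+
  qed
qed

lemma interior_states_flow_domain: "0 \<le> t \<Longrightarrow> interior_states t \<subseteq> flow_domain t"
proof
  fix x assume t: "0 \<le> t" and "x \<in> interior_states t"
  then have x: "x \<in> global_states" "x \<in> phase_interior \<sigma>" "flow_map t x \<in> phase_interior \<sigma>"
    by (auto simp: interior_states_def flow_def)
  then show "x \<in> flow_domain t"
    using forward_flows[OF global_statesD(2)[OF x(1)] t] by (intro flow_domainI) auto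
qed

text \<open>For negative times the map is a forward flow map between two reversals, each of which
  keeps volume.\<close>

lemma flow_volume:
  assumes S: "S \<in> sets lebesgue" "S \<subseteq> interior_states t"
  shows "flow t ` S \<in> sets lebesgue" "emeasure lebesgue (flow t ` S) = emeasure lebesgue S"
proof -
  have "flow t ` S \<in> sets lebesgue \<and> emeasure lebesgue (flow t ` S) = emeasure lebesgue S"
  proof (cases "0 \<le> t")
    case True
    then have "flow t ` S = flow_map t ` S" by (simp add: flow_def)
    moreover have "S \<subseteq> flow_domain t"
      using S(2) interior_states_flow_domain[OF True] by blast
    ultimately show ?thesis
      using flow_map_volume[OF S(1)] by simp
  next
    case False
    then have t: "0 \<le> - t" by simp
    have r: "reversal x \<in> interior_states (- t)" "flow t x = reversal (flow_map (- t) (reversal x))" if "x \<in> S" for x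
      using reversal_flow_interior[of x "- t"] that S(2) False by (auto simp: flow_def[of "- t"])
    have sub: "reversal ` S \<subseteq> flow_domain (- t)"
      using r(1) interior_states_flow_domain[OF t] by blast
    have eq: "flow t ` S = reversal ` (flow_map (- t) ` (reversal ` S))"
      using r(2) by (auto simp: image_image)
    note 1 = reversal_volume[OF S(1)]
    note 2 = flow_map_volume[OF 1(1) sub]
    show ?thesis
      unfolding eq using reversal_volume[OF 2(1)] 1 2 by simp
  qed
  then show "flow t ` S \<in> sets lebesgue" "emeasure lebesgue (flow t ` S) = emeasure lebesgue S"
    by blast+
qed

lemma negligible_free_flow_preimage:
  assumes "negligible A"
  shows "negligible {x :: ('d, 'm) phase. free_flow t x \<in> A}"
proof (rule negligible_subset)
  show "negligible (free_flow (- t) ` A)"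
    using smooth_vp_free_flow[of "- t"] assms unfolding smooth_vp_def
    by (intro negligible_differentiable_image_negligible)
      (auto simp: differentiable_on_def differentiable_def intro: has_derivative_at_withinI)
  show "{x. free_flow t x \<in> A} \<subseteq> free_flow (- t) ` A"
  proof
    fix x assume "x \<in> {x. free_flow t x \<in> A}"
    then show "x \<in> free_flow (- t) ` A"
      by (intro image_eqI[of _ _ "free_flow t x"]) simp_all
  qed
qed

text \<open>If the state at time \<open>t > 0\<close> is a collision, then from some earlier
  rational time \<open>r\<close> on the motion is free and reaches the boundary after a further time
  \<open>t - r\<close>. For each \<open>r\<close> this describes the flow preimage of a null set,
  and there are countably many \<open>r\<close>.\<close>

lemma negligible_not_interior: "negligible (global_states - interior_states t)"
proof -
  let ?bd = "phase_space \<sigma> - phase_interior \<sigma> :: ('d, 'm) phase set"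
  let ?N = "\<lambda>t. {x \<in> global_states \<inter> phase_interior \<sigma>. flow t x \<notin> phase_interior \<sigma>}"
  have pos: "negligible (?N t)" if t: "0 \<le> t" for t
  proof (rule negligible_subset)
    show "negligible (\<Union>r\<in>\<rat>. {x \<in> flow_domain r. flow_map r x \<in> {y. free_flow (t - r) y \<in> ?bd}})"
      proof (intro negligible_countable_Union countable_image countable_rat)
      fix S assume "S \<in> (\<lambda>r. {x \<in> flow_domain r. flow_map r x \<in> {y. free_flow (t - r) y \<in> ?bd}}) ` \<rat>"
      then obtain r where S: "S = {x \<in> flow_domain r. flow_map r x \<in> {y. free_flow (t - r) y \<in> ?bd}}"
        by blast
      show "negligible S"
        unfolding S by (intro negligible_flow_preimage negligible_free_flow_preimage negligible_boundary)
    qed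
    show "?N t \<subseteq> (\<Union>r\<in>\<rat>. {x \<in> flow_domain r. flow_map r x \<in> {y. free_flow (t - r) y \<in> ?bd}})"
    proof
      fix x assume "x \<in> ?N t"
      then have x: "x \<in> global_states" "x \<in> phase_interior \<sigma>" "flow t x \<notin> phase_interior \<sigma>" by auto
      have "t \<noteq> 0"
        using x flow_zero[OF global_statesD(1)[OF x(1)]] outgoing_interior[OF x(2)] by auto
      then have "0 < t" using t by simp
      let ?w = "incoming \<sigma> (flow t x)"
      note fr = global_statesD(1)[OF flow_global_states(1)[OF x(1), of t]]
      \<comment> \<open>The free motion arrives at the incoming representative, which has the same
        position as \<open>flow t x\<close> and so lies on the boundary too.\<close>
      have w: "?w \<in> ?bd"
        using outgoing_refined(6)[OF fr] refined_phase_space norm_outgoing(4)[OF fr] x(3)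
        by (auto simp: phase_interior_iff form_def)
      have "\<forall>\<^sub>F u in at_right 0. flow (t - u) x = free_flow (- u) ?w \<and> free_flow (- u) ?w \<in> phase_interior \<sigma> \<and> u < t"
        using flow_local(2)[OF x(1), of t] arrival[OF fr] eventually_at_right_small[OF \<open>0 < t\<close>]
        by eventually_elim simp
      then obtain e where e: "0 < e" "\<And>u. 0 < u \<Longrightarrow> u < e \<Longrightarrow>
          flow (t - u) x = free_flow (- u) ?w \<and> free_flow (- u) ?w \<in> phase_interior \<sigma> \<and> u < t"
        unfolding eventually_at_right_field by auto
      obtain r where r: "r \<in> \<rat>" "t - e < r" "r < t"
        using Rats_dense_in_real[of "t - e" t] e(1) by auto
      then have rr: "flow r x = free_flow (r - t) ?w" "flow r x \<in> phase_interior \<sigma>" "0 < r"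
        using e(2)[of "t - r"] by auto
      then have "flow_map r x = free_flow (r - t) ?w" "flow_map r x \<in> phase_interior \<sigma>"
        by (simp_all add: flow_def)
      moreover have "x \<in> flow_domain r"
        using interior_states_flow_domain[of r] rr x by (auto simp: interior_states_def)
      moreover have "free_flow (t - r) (free_flow (r - t) ?w) \<in> ?bd"
        using w by simp
      ultimately show "x \<in> (\<Union>r\<in>\<rat>. {x \<in> flow_domain r. flow_map r x \<in> {y. free_flow (t - r) y \<in> ?bd}})"
        using r(1) by (intro UN_I[of r]) simp_all
    qed
  qed
  have N: "negligible (?N t)"
  proof (cases "0 \<le> t")
    case False
    then have t: "0 \<le> - t" by simp
    show ?thesis
    proof (rule negligible_subset[OF negligible_reversal[OF pos[OF t]]])
      show "?N t \<subseteq> reversal ` ?N (- t)"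
      proof
        fix x assume "x \<in> ?N t"
        then have x: "x \<in> global_states" "x \<in> phase_interior \<sigma>" "flow t x \<notin> phase_interior \<sigma>" by auto
        have "flow (- t) (reversal x) \<notin> phase_interior \<sigma>"
        proof
          assume "flow (- t) (reversal x) \<in> phase_interior \<sigma>"
          then have "reversal x \<in> interior_states (- t)"
            using x by (simp add: interior_states_def reversal_global_states)
          from reversal_flow_interior(1)[OF this] have "x \<in> interior_states t" by simp
          then show False using x(3) by (simp add: interior_states_def)
        qed
        then have "reversal x \<in> ?N (- t)"
          using x by (simp add: reversal_global_states)
        moreover have "x = reversal (reversal x)" by simp
        ultimately show "x \<in> reversal ` ?N (- t)" by blast
      qed
    qed
  qed (rule pos)
  have "negligible (?bd \<union> ?N t)"
    by (intro negligible_Un negligible_boundary N)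
  then show ?thesis
  proof (rule negligible_subset)
    show "global_states - interior_states t \<subseteq> ?bd \<union> ?N t"
      using global_statesD(1) refined_phase_space unfolding interior_states_def by blast
  qed
qed

lemma emeasure_interior_states:
  assumes "A \<in> sets lebesgue" "A \<subseteq> global_states"
  shows "A \<inter> interior_states t \<in> sets lebesgue" "emeasure lebesgue (A \<inter> interior_states t) = emeasure lebesgue A"
proof -
  have N: "A - interior_states t \<in> null_sets lebesgue"
    using negligible_subset[OF negligible_not_interior[of t], of "A - interior_states t"] assms(2)
    by (auto simp: negligible_iff_null_sets)
  have eq: "A \<inter> interior_states t = A - (A - interior_states t)" by blast
  show "A \<inter> interior_states t \<in> sets lebesgue"
    unfolding eq by (rule sets.Diff[OF assms(1) null_setsD2[OF N]])
  show "emeasure lebesgue (A \<inter> interior_states t) = emeasure lebesgue A"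
    unfolding eq by (rule emeasure_Diff_null_set[OF N assms(1)])
qed

text \<open>Up to the null set of states that are not interior now or at time \<open>t\<close>, the
  preimage of \<open>A\<close> is the image of \<open>A\<close> under \<open>flow (- t)\<close>, and
  images keep volume.\<close>

lemma flow_preimage:
  assumes A: "A \<in> sets lebesgue" "A \<subseteq> global_states"
  shows "{x \<in> global_states. flow t x \<in> A} \<in> sets lebesgue"
    "emeasure lebesgue {x \<in> global_states. flow t x \<in> A} = emeasure lebesgue A"
proof -
  let ?P = "{x \<in> global_states. flow t x \<in> A}"
  note A' = emeasure_interior_states[OF A, of "- t"]
  have eq: "?P \<inter> interior_states t = flow (- t) ` (A \<inter> interior_states (- t))"
  proof (intro equalityI subsetI)
    fix x assume "x \<in> ?P \<inter> interior_states t"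
    then show "x \<in> flow (- t) ` (A \<inter> interior_states (- t))"
      using flow_inverse_interior[of x t] by (intro image_eqI[of _ _ "flow t x"]) auto
  next
    fix x assume "x \<in> flow (- t) ` (A \<inter> interior_states (- t))"
    then obtain y where y: "y \<in> A" "y \<in> interior_states (- t)" "x = flow (- t) y" by blast
    then show "x \<in> ?P \<inter> interior_states t"
      using flow_inverse_interior[of y "- t"] by (auto simp: interior_states_def)
  qed
  have P: "?P \<inter> interior_states t \<in> sets lebesgue" "emeasure lebesgue (?P \<inter> interior_states t) = emeasure lebesgue A"
    unfolding eq using flow_volume[OF A'(1)] A'(2) by auto
  have N: "?P - interior_states t \<in> null_sets lebesgue"
    using negligible_subset[OF negligible_not_interior[of t], of "?P - interior_states t"]
    by (auto simp: negligible_iff_null_sets)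
  have P_eq: "?P = (?P \<inter> interior_states t) \<union> (?P - interior_states t)" by blast
  show "?P \<in> sets lebesgue"
    by (subst P_eq) (use P N in \<open>auto intro: sets.Un\<close>)
  show "emeasure lebesgue ?P = emeasure lebesgue A"
    by (subst P_eq) (use P N in \<open>simp add: emeasure_Un_null_set\<close>)
qed

lemma measure_preserving_flow: "measure_preserving_on global_states (flow t)"
proof -
  note G = lebesgue_global_states
  have sets: "A \<in> sets (lebesgue_on global_states) \<longleftrightarrow> A \<in> sets lebesgue \<and> A \<subseteq> global_states" for A
    using G by (simp add: sets_restrict_space_iff conj_commute)
  have pre: "flow t -` A \<inter> space (lebesgue_on global_states) = {x \<in> global_states. flow t x \<in> A}" for A
    by auto
  have meas: "flow t \<in> lebesgue_on global_states \<rightarrow>\<^sub>M lebesgue_on global_states"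
  proof (rule measurableI)
    show "flow t x \<in> space (lebesgue_on global_states)" if "x \<in> space (lebesgue_on global_states)" for x
      using that flow_global_states(1) by simp
    show "flow t -` A \<inter> space (lebesgue_on global_states) \<in> sets (lebesgue_on global_states)"
      if "A \<in> sets (lebesgue_on global_states)" for A
      using that flow_preimage(1)[of A t] unfolding pre sets by auto
  qed
  moreover have "distr (lebesgue_on global_states) (lebesgue_on global_states) (flow t) = lebesgue_on global_states"
  proof (rule measure_eqI)
    fix A assume "A \<in> sets (distr (lebesgue_on global_states) (lebesgue_on global_states) (flow t))"
    then have A: "A \<in> sets (lebesgue_on global_states)" by simp
    then have A': "A \<in> sets lebesgue" "A \<subseteq> global_states" by (auto simp: sets)
    have "emeasure (distr (lebesgue_on global_states) (lebesgue_on global_states) (flow t)) A =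
        emeasure (lebesgue_on global_states) {x \<in> global_states. flow t x \<in> A}"
      using emeasure_distr[OF meas A] unfolding pre .
    also have "\<dots> = emeasure lebesgue {x \<in> global_states. flow t x \<in> A}"
      using G by (intro emeasure_restrict_space) auto
    also have "\<dots> = emeasure lebesgue A"
      by (rule flow_preimage(2)[OF A'])
    also have "\<dots> = emeasure (lebesgue_on global_states) A"
      using G A' by (intro emeasure_restrict_space[symmetric]) auto
    finally show "emeasure (distr (lebesgue_on global_states) (lebesgue_on global_states) (flow t)) A =
        emeasure (lebesgue_on global_states) A" .
  qed simp
  ultimately show ?thesis
    by (simp add: measure_preserving_on_def)
qed

text \<open>\<open>x\<close> and \<open>star \<sigma> x\<close> have the same outgoing
  representative, and the flow depends on that alone.\<close>

lemma flow_star: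
  assumes x: "x \<in> global_states" "x \<in> nongrazing_collisions \<sigma>"
  shows "star \<sigma> x \<in> global_states" "flow t (star \<sigma> x) = flow t x"
proof -
  have r: "star \<sigma> x \<in> refined_phase_space \<sigma>"
    using star_properties(1)[OF x(2)] by (simp add: refined_phase_space_def)
  note * = flow_same_outgoing[OF x(1) r star_properties(3)[OF x(2), symmetric]]
  show "star \<sigma> x \<in> global_states" "flow t (star \<sigma> x) = flow t x"
    using * by simp_all
qed

lemma flow_free_flow:
  assumes "triples = ({} :: ('m \<times> 'm \<times> 'm) set)" and x: "x \<in> global_states"
  shows "flow t x = free_flow t x"
proof -
  have int: "y \<in> phase_interior \<sigma>" for y :: "('d, 'm) phase"
    using assms(1) by (simp add: phase_interior_iff)
  have "flows y t (free_flow t y)" if "0 \<le> t" for t y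
    using int that interior_refined interior_not_collisional(1) by (intro flows_free) blast+
  note * = flow_map_eq[OF this]
  show ?thesis
  proof (cases "0 \<le> t")
    case True
    then show ?thesis using * by (simp add: flow_def)
  next
    case False
    then show ?thesis
      using *[of "- t" "reversal x"] outgoing_interior[OF int] by (simp add: flow_def reversal_flow)
  qed
qed

end

text \<open>Cover by empty sets. The exponent \<open>DIM('a) - 1\<close> is positive, so the powers
  of their diameter 0 vanish instead of being 1.\<close>

lemma surface_measure_empty:
  assumes "1 < DIM('a::euclidean_space)"
  shows "surface_measure ({} :: 'a set) = 0"
proof -
  have "(INF C\<in>{C :: nat \<Rightarrow> 'a set. {} \<subseteq> (\<Union>n. C n) \<and> (\<forall>n. bounded (C n) \<and> diameter (C n) \<le> \<delta>)}.
      (\<Sum>n. ennreal (diameter (C n) ^ (DIM('a) - 1)))) \<le> 0" if "0 < \<delta>" for \<delta> :: real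
    by (rule INF_lower2[of "\<lambda>n. {}"]) (use that assms in \<open>auto simp: power_0_left\<close>)
  then show ?thesis
    unfolding surface_measure_def by simp
qed

lemma triples_card_le_2:
  assumes "CARD('m::{finite,linorder}) \<le> 2"
  shows "triples = ({} :: ('m \<times> 'm \<times> 'm) set)"
proof (rule ccontr)
  assume "triples \<noteq> ({} :: ('m \<times> 'm \<times> 'm) set)"
  then obtain i j k :: 'm where "i < j" "j < k"
    by (auto simp: triples_def)
  then have "i \<noteq> j" "i \<noteq> k" "j \<noteq> k" by auto
  then have "card {i, j, k} = 3" by simp
  moreover have "card {i, j, k} \<le> CARD('m)"
    by (rule card_mono) auto
  ultimately show False using assms by simp
qed

theorem theorem3p14:
  assumes d: "CARD('d::finite) \<ge> 2"
  shows "\<exists>c::real. 0 < c \<and> c < 1 \<and> (\<forall>\<sigma>. 0 < \<sigma> \<and> \<sigma> < c \<longrightarrow>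
    (\<exists>(\<Gamma> :: ('d, 'm::{finite,linorder}) phase set)
      (\<Psi> :: real \<Rightarrow> ('d, 'm) phase \<Rightarrow> ('d, 'm) phase).
      \<Gamma> \<subseteq> refined_phase_space \<sigma> \<and>
      gdelta_in euclidean \<Gamma> \<and>
      refined_phase_space \<sigma> - \<Gamma> \<in> null_sets lebesgue \<and>
      (\<forall>Z\<in>\<Gamma>. trajectory \<sigma> Z (\<lambda>t. \<Psi> t Z)) \<and>
      (\<forall>t. \<Psi> t \<in> \<Gamma> \<rightarrow> \<Gamma> \<and> glued_diffeomorphism \<sigma> \<Gamma> (\<Psi> t) \<and> measure_preserving_on \<Gamma> (\<Psi> t)) \<and>
      (\<forall>Z\<in>\<Gamma>. \<forall>t s. \<Psi> (t + s) Z = (\<Psi> t \<circ> \<Psi> s) Z \<and> (\<Psi> t \<circ> \<Psi> s) Z = (\<Psi> s \<circ> \<Psi> t) Z) \<and>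
      (\<forall>Z\<in>\<Gamma>. \<forall>t. kinetic_energy (\<Psi> t Z) = kinetic_energy Z) \<and>
      (CARD('m) \<ge> 3 \<longrightarrow>
        surface_measure {Z \<in> \<Gamma> \<inter> nongrazing_collisions \<sigma>.
          \<not> (star \<sigma> Z \<in> \<Gamma> \<and> (\<forall>t. \<Psi> t (star \<sigma> Z) = \<Psi> t Z))} = 0) \<and>
      (CARD('m) \<le> 2 \<longrightarrow> (\<forall>Z\<in>\<Gamma>. \<forall>t. \<Psi> t Z = free_flow t Z))))"
proof (rule exI[of _ "1 / 2"], intro conjI allI impI)
  fix \<sigma> :: real
  assume "0 < \<sigma> \<and> \<sigma> < 1 / 2"
  then interpret interaction \<sigma> "TYPE(('d, 'm) phase)"
    by unfold_locales simp
  have dim: "1 < DIM(('d, 'm) phase)"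
  proof -
    have "1 \<le> CARD('m)" by (simp add: Suc_leI)
    then have "2 * 1 \<le> CARD('d) * CARD('m)"
      using d by (intro mult_mono) auto
    then show ?thesis by (simp add: mult.commute)
  qed
  \<comment> \<open>The exceptional set of collisions is empty, which is more than surface measure
    0.\<close>
  have empty: "{Z \<in> global_states \<inter> nongrazing_collisions \<sigma>.
      \<not> (star \<sigma> Z \<in> global_states \<and> (\<forall>t. flow t (star \<sigma> Z) = flow t Z))} = {}"
    using flow_star by blast
  have star: "surface_measure {Z \<in> global_states \<inter> nongrazing_collisions \<sigma>.
      \<not> (star \<sigma> Z \<in> global_states \<and> (\<forall>t. flow t (star \<sigma> Z) = flow t Z))} = 0"
    unfolding empty by (rule surface_measure_empty[OF dim])
  show "\<exists>(\<Gamma> :: ('d, 'm) phase set) (\<Psi> :: real \<Rightarrow> ('d, 'm) phase \<Rightarrow> ('d, 'm) phase).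
      \<Gamma> \<subseteq> refined_phase_space \<sigma> \<and>
      gdelta_in euclidean \<Gamma> \<and>
      refined_phase_space \<sigma> - \<Gamma> \<in> null_sets lebesgue \<and>
      (\<forall>Z\<in>\<Gamma>. trajectory \<sigma> Z (\<lambda>t. \<Psi> t Z)) \<and>
      (\<forall>t. \<Psi> t \<in> \<Gamma> \<rightarrow> \<Gamma> \<and> glued_diffeomorphism \<sigma> \<Gamma> (\<Psi> t) \<and> measure_preserving_on \<Gamma> (\<Psi> t)) \<and>
      (\<forall>Z\<in>\<Gamma>. \<forall>t s. \<Psi> (t + s) Z = (\<Psi> t \<circ> \<Psi> s) Z \<and> (\<Psi> t \<circ> \<Psi> s) Z = (\<Psi> s \<circ> \<Psi> t) Z) \<and>
      (\<forall>Z\<in>\<Gamma>. \<forall>t. kinetic_energy (\<Psi> t Z) = kinetic_energy Z) \<and>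
      (CARD('m) \<ge> 3 \<longrightarrow>
        surface_measure {Z \<in> \<Gamma> \<inter> nongrazing_collisions \<sigma>.
          \<not> (star \<sigma> Z \<in> \<Gamma> \<and> (\<forall>t. \<Psi> t (star \<sigma> Z) = \<Psi> t Z))} = 0) \<and>
      (CARD('m) \<le> 2 \<longrightarrow> (\<forall>Z\<in>\<Gamma>. \<forall>t. \<Psi> t Z = free_flow t Z))"
  proof (intro exI[of _ global_states] exI[of _ flow] conjI ballI allI impI)
    show "global_states \<subseteq> refined_phase_space \<sigma>"
      using global_statesD(1) by blast
    show "refined_phase_space \<sigma> - global_states \<in> null_sets lebesgue"
      using negligible_not_global by (simp add: negligible_iff_null_sets)
    show "flow t \<in> global_states \<rightarrow> global_states" for t
      using flow_global_states(1) by blast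
    show "flow (t + u) Z = (flow t \<circ> flow u) Z" "(flow t \<circ> flow u) Z = (flow u \<circ> flow t) Z"
      if "Z \<in> global_states" for t u Z
      using that by (simp_all add: flow_flow add.commute)
    show "flow t Z = free_flow t Z" if "CARD('m) \<le> 2" "Z \<in> global_states" for t Z
      by (rule flow_free_flow[OF triples_card_le_2[OF that(1)] that(2)])
    show "surface_measure {Z \<in> global_states \<inter> nongrazing_collisions \<sigma>.
        \<not> (star \<sigma> Z \<in> global_states \<and> (\<forall>t. flow t (star \<sigma> Z) = flow t Z))} = 0"
      by (rule star)
  qed (simp_all add: gdelta_global_states trajectory_flow glued_diffeomorphism_flow
      measure_preserving_flow kinetic_energy_flow)
qed auto

end
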